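(* Let $G$ be a mixed signed, directed graph and $k$ a field. The edge ring $k[G]$ satisfies Serre's condition $R_1$ if and only if every facet subgraph $H$ of $G$ satisfies $\mathrm{comp}(H)\le\mathrm{comp}(G)+1$.
   Context: A mixed signed, directed graph $G$ on vertex set $\{1,\dots,n\}$ has a set of signed edges $+ij$ or $-ij$ (loops $\pm ii$ allowed) and directed edges $(i,j)$ with $i\ne j$; between a pair of vertices any subset of $+ij,-ij,(i,j),(j,i)$ may occur. Define $\rho(\pm ij)=\pm(e_i+e_j)$ (so $\rho(\pm ii)=\pm2e_i$) and $\rho((i,j))=e_j-e_i$ in $\mathbb{R}^n$. The edge ring is $k[G]=k[x^a: a\in\rho(E(G))]\subseteq k[x_1^{\pm1},\dots,x_n^{\pm1}]$, $x^a=\prod x_i^{a_i}$. A Noetherian ring $R$ satisfies $R_1$ if $R_\mathfrak p$ is regular for all primes $\mathfrak p$ with $\dim R_\mathfrak p\le 1$. The augmented signed graph $\widetilde G$ is obtained by replacing each directed edge $(i,j)$ by a new (artificial) vertex $t_{(i,j)}$ and the two signed edges $-i\,t_{(i,j)}$ and $+t_{(i,j)}\,j$. A subgraph $H$ of $G$ has vertex set $\{1,\dots,n\}$ and a subset of the edges of $G$; $G\setminus H$ is the set of edges of $G$ not in $H$; $\widetilde H$ is the augmented graph of $H$ (with artificial vertices only for directed edges of $H$). For a signed graph, a component is a maximal connected subgraph (isolated vertices are components), and it is bipartite if its vertex set can be partitioned into $L,R$ (one possibly empty) with every edge having one endpoint in each (a component with a loop is not bipartite). Components and bipartite components of $G$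 (resp. $H$) are those of $\widetilde G$ (resp. $\widetilde H$); $\mathrm{comp}(\cdot)$ and $\mathrm{bicomp}(\cdot)$ count components and bipartite components. For a set $S$ of vertices of an augmented graph, $\pi(S)=S\cap\{1,\dots,n\}$. A subgraph $H$ of $G$ is a facet subgraph if (1) $\mathrm{bicomp}(H)=\mathrm{bicomp}(G)+1$, and (2) for any bipartite component $H'$ of $H$ which is not a component of $G$, there is a bipartition $V(\widetilde{H'})=\widetilde L\cup\widetilde R$ such that, with $L=\pi(\widetilde L)$ and $R=\pi(\widetilde R)$, every edge $e\in G\setminus H$ is of one of the forms: a positive edge with at least one endpoint in $L$ and none in $R$; a negative edge with at least one endpoint in $R$ and none in $L$; a directed edge $(i,j)$ with $j\in L$ and $i\notin L$; or a directed edge $(i,j)$ with $i\in R$ and $j\notin R$. *)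

theory Defs
  imports "HOL-Algebra.Ring_Divisibility" "HOL-Library.Poly_Mapping"
          "HOL-Library.Extended_Nat" "HOL-Computational_Algebra.Fraction_Field"
begin

definition sub_ring_of :: "'a::comm_ring_1 set \<Rightarrow> 'a ring" where
  "sub_ring_of S = \<lparr>carrier = S, mult = (*), one = 1, zero = 0, add = (+)\<rparr>"

definition krull_dim :: "('a, 'b) ring_scheme \<Rightarrow> enat" where
  "krull_dim A = Sup {enat n | n. \<exists>P :: nat \<Rightarrow> 'a set.
      (\<forall>i\<le>n. primeideal (P i) A) \<and> (\<forall>i<n. P i \<subset> P (Suc i))}"

definition local_ring :: "('a, 'b) ring_scheme \<Rightarrow> bool" where
  "local_ring A \<longleftrightarrow> cring A \<and> (\<exists>!m. maximalideal m A)"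

definition regular_local_ring :: "('a, 'b) ring_scheme \<Rightarrow> bool" where
  "regular_local_ring A \<longleftrightarrow> noetherian_ring A \<and> local_ring A \<and> krull_dim A \<noteq> \<infinity> \<and>
     (\<exists>m X. maximalideal m A \<and> finite X \<and> X \<subseteq> carrier A \<and>
            enat (card X) = krull_dim A \<and> genideal A X = m)"

definition localization :: "'a::idom set \<Rightarrow> 'a set \<Rightarrow> 'a fract set" where
  "localization S P = {Fract a s | a s. a \<in> S \<and> s \<in> S \<and> s \<notin> P}"

definition serre_R1 :: "'a::idom set \<Rightarrow> bool" where
  "serre_R1 S \<longleftrightarrow> (\<forall>P. primeideal P (sub_ring_of S) \<longrightarrow>
      krull_dim (sub_ring_of (localization S P)) \<le> 1 \<longrightarrow>
      regular_local_ring (sub_ring_of (localization S P)))"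

text \<open>Sgn True i j = +ij, Sgn False i j = -ij (normalised with i \<le> j), Dir i j = (i,j).\<close>
datatype edge = Sgn bool nat nat | Dir nat nat

definition wf_graph :: "nat \<Rightarrow> edge set \<Rightarrow> bool" where
  "wf_graph n E \<longleftrightarrow> finite E \<and> (\<forall>e\<in>E. case e of
      Sgn s i j \<Rightarrow> 1 \<le> i \<and> i \<le> j \<and> j \<le> n
    | Dir i j \<Rightarrow> i \<in> {1..n} \<and> j \<in> {1..n} \<and> i \<noteq> j)"

definition unitv :: "nat \<Rightarrow> nat \<Rightarrow>\<^sub>0 int" where
  "unitv i = Poly_Mapping.single i 1"

fun rho :: "edge \<Rightarrow> (nat \<Rightarrow>\<^sub>0 int)" where
  "rho (Sgn True i j) = unitv i + unitv j"
| "rho (Sgn False i j) = - (unitv i + unitv j)"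
| "rho (Dir i j) = unitv j - unitv i"

text \<open>Laurent polynomials over k: finitely supported functions from exponent vectors to k.
  The edge ring is the k-subalgebra generated by the monomials x^(rho e).\<close>
inductive_set edge_ring :: "edge set \<Rightarrow> ((nat \<Rightarrow>\<^sub>0 int) \<Rightarrow>\<^sub>0 'k::field) set"
  for E :: "edge set" where
  const: "Poly_Mapping.single 0 c \<in> edge_ring E"
| gen: "e \<in> E \<Longrightarrow> Poly_Mapping.single (rho e) 1 \<in> edge_ring E"
| add: "p \<in> edge_ring E \<Longrightarrow> q \<in> edge_ring E \<Longrightarrow> p + q \<in> edge_ring E"
| mult: "p \<in> edge_ring E \<Longrightarrow> q \<in> edge_ring E \<Longrightarrow> p * q \<in> edge_ring E"

text \<open>Vertices of augmented graphs: original vertices V i and artificial vertices T i j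
  (standing for t_(i,j)).\<close>
datatype avert = V nat | T nat nat

definition aug_verts :: "nat \<Rightarrow> edge set \<Rightarrow> avert set" where
  "aug_verts n H = V ` {1..n} \<union> {T i j | i j. Dir i j \<in> H}"

definition aug_edges :: "edge set \<Rightarrow> (bool \<times> avert \<times> avert) set" where
  "aug_edges H = {(s, V i, V j) | s i j. Sgn s i j \<in> H}
     \<union> {(False, V i, T i j) | i j. Dir i j \<in> H}
     \<union> {(True, T i j, V j) | i j. Dir i j \<in> H}"

definition adj :: "(bool \<times> avert \<times> avert) set \<Rightarrow> (avert \<times> avert) set" where
  "adj AE = {(u, v). \<exists>s. (s, u, v) \<in> AE \<or> (s, v, u) \<in> AE}"

definition comp_vsets :: "avert set \<Rightarrow> (bool \<times> avert \<times> avert) set \<Rightarrow> avert set set" where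
  "comp_vsets Vs AE = Vs // ((adj AE)\<^sup>* \<inter> (Vs \<times> Vs))"

definition edges_in :: "(bool \<times> avert \<times> avert) set \<Rightarrow> avert set \<Rightarrow> (bool \<times> avert \<times> avert) set" where
  "edges_in AE C = {(s, u, v). (s, u, v) \<in> AE \<and> u \<in> C \<and> v \<in> C}"

definition components :: "avert set \<Rightarrow> (bool \<times> avert \<times> avert) set
    \<Rightarrow> (avert set \<times> (bool \<times> avert \<times> avert) set) set" where
  "components Vs AE = {(C, edges_in AE C) | C. C \<in> comp_vsets Vs AE}"

definition is_bipartition :: "(bool \<times> avert \<times> avert) set \<Rightarrow> avert set \<Rightarrow> avert set \<Rightarrow> avert set \<Rightarrow> bool" where
  "is_bipartition AE C L R \<longleftrightarrow> L \<union> R = C \<and> L \<inter> R = {} \<and>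
     (\<forall>(s, u, v) \<in> edges_in AE C. (u \<in> L \<and> v \<in> R) \<or> (u \<in> R \<and> v \<in> L))"

definition bipartite :: "(bool \<times> avert \<times> avert) set \<Rightarrow> avert set \<Rightarrow> bool" where
  "bipartite AE C \<longleftrightarrow> (\<exists>L R. is_bipartition AE C L R)"

definition ncomp :: "nat \<Rightarrow> edge set \<Rightarrow> nat" where
  "ncomp n H = card (comp_vsets (aug_verts n H) (aug_edges H))"

definition nbicomp :: "nat \<Rightarrow> edge set \<Rightarrow> nat" where
  "nbicomp n H = card {C \<in> comp_vsets (aug_verts n H) (aug_edges H). bipartite (aug_edges H) C}"

definition proj :: "avert set \<Rightarrow> nat set" where
  "proj S = {i. V i \<in> S}"

definition edge_form_ok :: "nat set \<Rightarrow> nat set \<Rightarrow> edge \<Rightarrow> bool" where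
  "edge_form_ok L R e = (case e of
      Sgn True i j \<Rightarrow> (i \<in> L \<or> j \<in> L) \<and> i \<notin> R \<and> j \<notin> R
    | Sgn False i j \<Rightarrow> (i \<in> R \<or> j \<in> R) \<and> i \<notin> L \<and> j \<notin> L
    | Dir i j \<Rightarrow> (j \<in> L \<and> i \<notin> L) \<or> (i \<in> R \<and> j \<notin> R))"

definition facet_subgraph :: "nat \<Rightarrow> edge set \<Rightarrow> edge set \<Rightarrow> bool" where
  "facet_subgraph n E H \<longleftrightarrow> H \<subseteq> E \<and> nbicomp n H = nbicomp n E + 1 \<and>
     (\<forall>C \<in> comp_vsets (aug_verts n H) (aug_edges H).
        bipartite (aug_edges H) C \<and>
        (C, edges_in (aug_edges H) C) \<notin> components (aug_verts n E) (aug_edges E) \<longrightarrow>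
        (\<exists>Lt Rt. is_bipartition (aug_edges H) C Lt Rt \<and>
                 (\<forall>e \<in> E - H. edge_form_ok (proj Lt) (proj Rt) e)))"

end

theory Submission
  imports Defs
begin

text \<open>
  For a prime \<open>P\<close> of the edge ring \<open>A\<close> such that \<open>A_P\<close> has dimension at most one, regularity of \<open>A_P\<close>
  means that its maximal ideal is principal. A height one prime is homogeneous for every grading for
  which it contains a nonzero homogeneous element. If it contains no monomial, this and division
  with remainder in one suitably chosen variable give a generator. If it contains a monomial, it
  consists of the elements whose exponents lie off a facet of the cone of \<open>E\<close>, and the edges on that facet form a
  facet subgraph \<open>H\<close>.

  An exponent vector lies in the lattice of \<open>H\<close> iff its signed sum over each bipartite component
  vanishes and its sum over each other component is even. The facet functional is supported, up to
  functionals vanishing on \<open>E\<close>, on a bipartite component \<open>C\<close> of \<open>H\<close> which is touched by all edges in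
  \<open>E - H\<close>. The maximal ideal is principal iff all these edges are multiples of a single one modulo the
  lattice of \<open>H\<close>. Two edges joining \<open>C\<close> to different components are incongruent by parity, so this
  happens iff the edges in \<open>E - H\<close> join \<open>C\<close> to at most one other component, that is, iff adding them
  to \<open>H\<close> lowers the number of components by at most one.
\<close>

section \<open>Localizations of subrings\<close>

text \<open>The exponent monoid need not be saturated, so linear and parity conditions do not decide
  membership in it. They do decide membership in the group generated by \<open>H\<close>. An element
  of that group is a difference of two exponents on the face, and monomials on the face are units
  after localizing. Hence congruences modulo this group are all that is compared, and divisibility
  in the localization is written without fractions, as b f = p c with b outside P. The recurring
  factor 2 comes from non-bipartite components of \<open>H\<close>: there twice a basis vector lies
  in the group, while a single one has odd coordinate sum. Where parity is not under control,
  doubled exponents or elements with even exponents are used. The functional of C takes the value 1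
  on an outside edge that leaves C and 2 on one that stays inside. An inside edge can thus count as
  twice a leaving edge, which is why edges are compared with multiples of an edge. Value 1 is also
  the least positive height, so the monomial of a leaving edge has no room for two factors of
  positive height; this is what turns incongruent leaving edges into an obstruction.\<close>

definition subring_set :: "'a::comm_ring_1 set \<Rightarrow> bool" where
  "subring_set A \<longleftrightarrow> 0 \<in> A \<and> 1 \<in> A \<and> (\<forall>x\<in>A. \<forall>y\<in>A. x + y \<in> A \<and> x * y \<in> A) \<and> (\<forall>x\<in>A. - x \<in> A)"

definition ideal_of :: "'a::comm_ring_1 set \<Rightarrow> 'a set \<Rightarrow> bool" where
  "ideal_of A I \<longleftrightarrow> I \<subseteq> A \<and> 0 \<in> I \<and> (\<forall>x\<in>I. \<forall>y\<in>I. x + y \<in> I) \<and> (\<forall>a\<in>A. \<forall>x\<in>I. a * x \<in> I)"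

definition prime_of :: "'a::comm_ring_1 set \<Rightarrow> 'a set \<Rightarrow> bool" where
  "prime_of A P \<longleftrightarrow> ideal_of A P \<and> 1 \<notin> P \<and> (\<forall>x\<in>A. \<forall>y\<in>A. x * y \<in> P \<longrightarrow> x \<in> P \<or> y \<in> P)"

lemma sub_ring_of_simps [simp]:
  "carrier (sub_ring_of A) = A" "x \<otimes>\<^bsub>sub_ring_of A\<^esub> y = x * y" "x \<oplus>\<^bsub>sub_ring_of A\<^esub> y = x + y"
  "\<one>\<^bsub>sub_ring_of A\<^esub> = 1" "\<zero>\<^bsub>sub_ring_of A\<^esub> = 0"
  by (auto simp: sub_ring_of_def)

lemma subring_setD:
  assumes "subring_set A"
  shows "0 \<in> A" "1 \<in> A" "\<And>x y. x \<in> A \<Longrightarrow> y \<in> A \<Longrightarrow> x + y \<in> A"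
    "\<And>x y. x \<in> A \<Longrightarrow> y \<in> A \<Longrightarrow> x * y \<in> A" "\<And>x. x \<in> A \<Longrightarrow> - x \<in> A"
    "\<And>x y. x \<in> A \<Longrightarrow> y \<in> A \<Longrightarrow> x - y \<in> A" "\<And>x n. x \<in> A \<Longrightarrow> x ^ n \<in> A"
proof -
  show *: "0 \<in> A" "1 \<in> A" "\<And>x y. x \<in> A \<Longrightarrow> y \<in> A \<Longrightarrow> x + y \<in> A"
    "\<And>x y. x \<in> A \<Longrightarrow> y \<in> A \<Longrightarrow> x * y \<in> A" "\<And>x. x \<in> A \<Longrightarrow> - x \<in> A"
    using assms by (auto simp: subring_set_def)
  show "\<And>x y. x \<in> A \<Longrightarrow> y \<in> A \<Longrightarrow> x - y \<in> A"
    using *(3,5) by (metis add_uminus_conv_diff)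
  show "x ^ n \<in> A" if "x \<in> A" for x n
    by (induction n) (auto simp: * that)
qed

lemma ideal_ofD:
  assumes "ideal_of A I"
  shows "\<And>x. x \<in> I \<Longrightarrow> x \<in> A" "0 \<in> I" "\<And>x y. x \<in> I \<Longrightarrow> y \<in> I \<Longrightarrow> x + y \<in> I"
    "\<And>a x. a \<in> A \<Longrightarrow> x \<in> I \<Longrightarrow> a * x \<in> I" "\<And>a x. a \<in> A \<Longrightarrow> x \<in> I \<Longrightarrow> x * a \<in> I"
  using assms by (auto simp: ideal_of_def mult.commute)

lemma ideal_of_uminus:
  assumes "subring_set A" "ideal_of A I" "x \<in> I"
  shows "- x \<in> I"
  using ideal_ofD(4)[OF assms(2) subring_setD(5)[OF assms(1) subring_setD(2)[OF assms(1)]] assms(3)]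
  by simp

lemma ideal_of_diff:
  assumes "subring_set A" "ideal_of A I" "x \<in> I" "y \<in> I"
  shows "x - y \<in> I"
  using ideal_ofD(3)[OF assms(2,3) ideal_of_uminus[OF assms(1,2,4)]] by simp

lemma prime_ofD:
  assumes "prime_of A P"
  shows "ideal_of A P" "1 \<notin> P" "\<And>x y. x \<in> A \<Longrightarrow> y \<in> A \<Longrightarrow> x * y \<in> P \<Longrightarrow> x \<in> P \<or> y \<in> P"
  using assms by (auto simp: prime_of_def)

lemma cring_sub_ring_of:
  assumes "subring_set A"
  shows "cring (sub_ring_of A)"
proof (rule cringI)
  note A = subring_setD[OF assms]
  show "abelian_group (sub_ring_of A)"
  proof (rule abelian_groupI)
    fix x assume "x \<in> carrier (sub_ring_of A)"
    then show "\<exists>y\<in>carrier (sub_ring_of A). y \<oplus>\<^bsub>sub_ring_of A\<^esub> x = \<zero>\<^bsub>sub_ring_of A\<^esub>"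
      by (auto intro!: bexI[of _ "- x"] A)
  qed (auto simp: A algebra_simps)
  show "comm_monoid (sub_ring_of A)"
    by (rule comm_monoidI) (auto simp: A algebra_simps)
qed (auto simp: algebra_simps)

lemma ideal_sub_ring_of:
  assumes "subring_set A"
  shows "ideal I (sub_ring_of A) \<longleftrightarrow> ideal_of A I"
proof
  interpret cring "sub_ring_of A" by (rule cring_sub_ring_of[OF assms])
  note A = subring_setD[OF assms]
  show "ideal_of A I" if "ideal I (sub_ring_of A)"
  proof -
    interpret I: ideal I "sub_ring_of A" by fact
    show ?thesis
      unfolding ideal_of_def
      using I.a_subset I.zero_closed I.a_closed I.I_l_closed by auto
  qed
  show "ideal I (sub_ring_of A)" if I: "ideal_of A I"
  proof (rule idealI)
    show "subgroup I (add_monoid (sub_ring_of A))"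
    proof
      fix x assume x: "x \<in> I"
      have "\<ominus>\<^bsub>sub_ring_of A\<^esub> x = - x"
        by (rule minus_equality) (use x ideal_ofD(1)[OF I] A in auto)
      then show "inv\<^bsub>add_monoid (sub_ring_of A)\<^esub> x \<in> I"
        using ideal_of_uminus[OF assms I x] by (simp add: a_inv_def)
    qed (use ideal_ofD[OF I] in auto)
  qed (use ideal_ofD[OF I] ring_axioms in auto)
qed

lemma primeideal_sub_ring_of:
  assumes "subring_set A"
  shows "primeideal P (sub_ring_of A) \<longleftrightarrow> prime_of A P"
proof
  note A = subring_setD[OF assms]
  have 1: "1 \<notin> P \<longleftrightarrow> A \<noteq> P" if "ideal_of A P"
    using ideal_ofD(1,4)[OF that] A by (metis equalityI mult.right_neutral subsetI)
  show "prime_of A P" if "primeideal P (sub_ring_of A)"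
  proof -
    interpret primeideal P "sub_ring_of A" by fact
    show ?thesis
      unfolding prime_of_def using I_prime I_notcarr ideal_sub_ring_of[OF assms] is_ideal 1 by auto
  qed
  show "primeideal P (sub_ring_of A)" if P: "prime_of A P"
    by (rule primeidealI)
      (use prime_ofD[OF P] ideal_sub_ring_of[OF assms] 1 cring_sub_ring_of[OF assms] in auto)
qed

section \<open>Krull dimension, and regularity of local domains of dimension at most one\<close>

lemma krull_dim_chain:
  assumes "subring_set A" "\<And>i. i \<le> n \<Longrightarrow> prime_of A (P i)" "\<And>i. i < n \<Longrightarrow> P i \<subset> P (Suc i)"
  shows "enat n \<le> krull_dim (sub_ring_of A)"
  unfolding krull_dim_def by (rule Sup_upper) (use assms primeideal_sub_ring_of in blast)

lemma krull_dim_le: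
  assumes "subring_set A"
    "\<And>P m. (\<And>i. i \<le> m \<Longrightarrow> prime_of A (P i)) \<Longrightarrow> (\<And>i. i < m \<Longrightarrow> P i \<subset> P (Suc i)) \<Longrightarrow> m \<le> n"
  shows "krull_dim (sub_ring_of A) \<le> enat n"
  unfolding krull_dim_def
proof (rule Sup_least, clarify)
  fix m and P :: "nat \<Rightarrow> 'a set"
  assume "\<forall>i\<le>m. primeideal (P i) (sub_ring_of A)" "\<forall>i<m. P i \<subset> P (Suc i)"
  then have "m \<le> n" using assms(2)[of m P] by (auto simp: primeideal_sub_ring_of[OF assms(1)])
  then show "enat m \<le> enat n" by simp
qed

lemma prime_of_zero:
  fixes A :: "'a::idom set"
  assumes "subring_set A"
  shows "prime_of A {0}"
  using subring_setD[OF assms] by (auto simp: prime_of_def ideal_of_def)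

text \<open>Otherwise {0}, \<open>I\<close>, \<open>J\<close> would form a chain of length
  two.\<close>

lemma krull_dim_le_1_between:
  fixes A :: "'a::idom set"
  assumes A: "subring_set A" and dim: "krull_dim (sub_ring_of A) \<le> 1"
    and I: "prime_of A I" and J: "prime_of A J" and "I \<subset> J"
  shows "I = {0}"
proof (rule ccontr)
  assume "I \<noteq> {0}"
  then have "{0} \<subset> I" using ideal_ofD(2)[OF prime_ofD(1)[OF I]] by auto
  define C where "C = (\<lambda>i::nat. if i = 0 then {0} else if i = 1 then I else J)"
  have "enat 2 \<le> krull_dim (sub_ring_of A)"
  proof (rule krull_dim_chain[OF A, of _ C])
    show "prime_of A (C i)" for i
      using I J prime_of_zero[OF A] by (auto simp: C_def)
    show "C i \<subset> C (Suc i)" if "i < 2" for i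
      using that \<open>I \<subset> J\<close> \<open>{0} \<subset> I\<close> by (auto simp: C_def)
  qed
  with dim have "enat 2 \<le> enat 1" by (metis one_enat_def order.trans)
  then show False by simp
qed

text \<open>If the maximal ideal \<open>p B\<close> of a local domain is nonzero, the intersection of the powers of \<open>p B\<close>
  is a prime ideal strictly below it; in dimension at most one it therefore vanishes, and every
  nonzero element is a unit times a power of \<open>p\<close>.\<close>

lemma regular_local_ring_principal:
  fixes B :: "'a::idom set"
  assumes B: "subring_set B" and m: "ideal_of B m" "1 \<notin> m"
    and unit: "\<And>x. x \<in> B \<Longrightarrow> x \<notin> m \<Longrightarrow> \<exists>y\<in>B. x * y = 1"
    and p: "p \<in> m" "\<And>x. x \<in> m \<Longrightarrow> \<exists>b\<in>B. x = p * b"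
    and dim: "krull_dim (sub_ring_of B) \<le> 1"
  shows "regular_local_ring (sub_ring_of B)"
proof -
  note BD = subring_setD[OF B] and mD = ideal_ofD[OF m(1)]
  interpret cring "sub_ring_of B" by (rule cring_sub_ring_of[OF B])
  have pB: "p \<in> B" using p mD by auto
  have sub_m: "J \<subseteq> m" if J: "ideal_of B J" "1 \<notin> J" for J
  proof
    fix x assume x: "x \<in> J"
    show "x \<in> m"
    proof (rule ccontr)
      assume "x \<notin> m"
      then obtain y where "y \<in> B" "x * y = 1" using unit ideal_ofD(1)[OF J(1) x] by auto
      then show False using ideal_ofD(5)[OF J(1) _ x] J(2) by metis
    qed
  qed
  have prp: "1 \<notin> J \<longleftrightarrow> B \<noteq> J" if "ideal_of B J" for J
    using ideal_ofD(1,4)[OF that] BD by (metis equalityI mult.right_neutral subsetI)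
  have prime_m: "prime_of B m"
    unfolding prime_of_def
  proof (intro conjI ballI impI m)
    fix x y assume xy: "x \<in> B" "y \<in> B" "x * y \<in> m"
    show "x \<in> m \<or> y \<in> m"
    proof (rule ccontr)
      assume "\<not> (x \<in> m \<or> y \<in> m)"
      then obtain x' y' where "x' \<in> B" "y' \<in> B" "x * x' = 1" "y * y' = 1" using unit xy by meson
      moreover have "(x * y) * (x' * y') = (x * x') * (y * y')" by (simp add: algebra_simps)
      ultimately have "(x * y) * (x' * y') = 1" by simp
      then show False using mD(5)[OF BD(4)[OF \<open>x' \<in> B\<close> \<open>y' \<in> B\<close>] xy(3)] m(2) by simp
    qed
  qed
  have max_m: "maximalideal m (sub_ring_of B)"
  proof (rule maximalidealI)
    show "J = m \<or> J = carrier (sub_ring_of B)" if "ideal J (sub_ring_of B)" "m \<subseteq> J" for J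
      using that sub_m[of J] prp[of J] ideal_sub_ring_of[OF B] by auto
  qed (use m prp ideal_sub_ring_of[OF B] in auto)
  have uniq: "J = m" if "maximalideal J (sub_ring_of B)" for J
  proof -
    interpret J: maximalideal J "sub_ring_of B" by fact
    have J: "ideal_of B J" using J.is_ideal ideal_sub_ring_of[OF B] by auto
    have "J \<subseteq> m" using sub_m[OF J] prp[OF J] J.I_notcarr by auto
    then show ?thesis
      using J.I_maximal[of m] m prp[OF m(1)] mD(1) ideal_sub_ring_of[OF B] by auto
  qed
  have loc: "local_ring (sub_ring_of B)"
    unfolding local_ring_def using max_m uniq is_cring by blast
  have Idl: "genideal (sub_ring_of B) {x} = {x * b | b. b \<in> B}" if "x \<in> B" for x
  proof -
    have "Idl\<^bsub>sub_ring_of B\<^esub> {x} = PIdl\<^bsub>sub_ring_of B\<^esub> x" 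
      by (rule cgenideal_eq_genideal[symmetric]) (use that in auto)
    also have "\<dots> = {x * b | b. b \<in> B}" by (auto simp: cgenideal_def mult.commute)
    finally show ?thesis .
  qed
  have m_eq: "m = genideal (sub_ring_of B) {p}"
    using Idl[OF pB] p mD(5)[OF _ p(1)] by auto
  have Idl0: "genideal (sub_ring_of B) {} = {0}"
  proof
    have "ideal {0} (sub_ring_of B)" using zeroideal by simp
    then show "genideal (sub_ring_of B) {} \<subseteq> {0}" by (rule genideal_minimal) auto
    have "ideal (genideal (sub_ring_of B) {}) (sub_ring_of B)" by (rule genideal_ideal) auto
    then show "{0} \<subseteq> genideal (sub_ring_of B) {}" 
      using ideal_sub_ring_of[OF B] ideal_ofD(2) by blast
  qed
  show ?thesis
  \<comment> \<open>For \<open>p = 0\<close> the ring is a field, and dimension 0 demands the empty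
    generating set. For \<open>p\<close> nonzero the chain from {0} to \<open>m\<close> pins the
    dimension at 1, matching the single generator.\<close>
  proof (cases "p = 0")
    case True
    then have m0: "m = {0}" using p mD(2) by auto
    have noeth: "noetherian_ring (sub_ring_of B)"
    proof (rule noetherian_ringI)
      fix J assume "ideal J (sub_ring_of B)"
      then have J: "ideal_of B J" using ideal_sub_ring_of[OF B] by auto
      consider "J = B" | "J = {0}" using sub_m[OF J] prp[OF J] m0 ideal_ofD(2)[OF J] by auto
      then show "\<exists>A\<subseteq>carrier (sub_ring_of B). finite A \<and> J = Idl\<^bsub>sub_ring_of B\<^esub> A"
      proof cases
        case 1
        then show ?thesis using genideal_one BD(2) by (intro exI[of _ "{1}"]) auto
      next
        case 2
        then show ?thesis using Idl0 by (intro exI[of _ "{}"]) auto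
      qed
    qed
    have "krull_dim (sub_ring_of B) \<le> enat 0"
    proof (rule krull_dim_le[OF B])
      fix P :: "nat \<Rightarrow> 'a set" and k
      assume P: "\<And>i. i \<le> k \<Longrightarrow> prime_of B (P i)" "\<And>i. i < k \<Longrightarrow> P i \<subset> P (Suc i)"
      show "k \<le> 0"
      proof (rule ccontr)
        assume "\<not> k \<le> 0"
        then have "P 0 \<subset> P 1" "prime_of B (P 0)" "prime_of B (P 1)" using P[of 0] P(1)[of 1] by auto
        then show False
          using sub_m[of "P 1"] m0 ideal_ofD(2)[of B "P 0"] by (auto simp: prime_of_def)
      qed
    qed
    then have "krull_dim (sub_ring_of B) = 0" by (simp add: zero_enat_def[symmetric])
    moreover from this have "maximalideal m (sub_ring_of B) \<and> finite {} \<and> {} \<subseteq> carrier (sub_ring_of B) \<and>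
        enat (card {}) = krull_dim (sub_ring_of B) \<and> genideal (sub_ring_of B) {} = m"
      using max_m m0 Idl0 by (simp add: zero_enat_def)
    ultimately show ?thesis
      unfolding regular_local_ring_def using noeth loc by (metis infinity_ne_i0)
  next
    case False
    define I where "I = {x \<in> B. \<forall>n. \<exists>b\<in>B. x = p ^ n * b}"
    have idI: "ideal_of B I"
      unfolding ideal_of_def
    proof (intro conjI ballI)
      show "I \<subseteq> B" by (auto simp: I_def)
      have "\<exists>b\<in>B. 0 = p ^ n * b" for n by (rule bexI[of _ 0]) (simp_all add: BD)
      then show "0 \<in> I" by (simp add: I_def BD)
    next
      fix x y assume x: "x \<in> I" and y: "y \<in> I"
      show "x + y \<in> I"
      proof -
        have "\<exists>b\<in>B. x + y = p ^ n * b" for n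
        proof -
          obtain b c where b: "b \<in> B" "x = p ^ n * b" and c: "c \<in> B" "y = p ^ n * c"
            using x y unfolding I_def mem_Collect_eq by meson
          have "x + y = p ^ n * (b + c)" by (simp add: b(2)[symmetric] c(2)[symmetric] distrib_left)
          then show ?thesis using BD(3)[OF b(1) c(1)] by blast
        qed
        then show ?thesis using x y BD(3) by (auto simp: I_def)
      qed
    next
      fix a x assume that: "a \<in> B" and x: "x \<in> I"
      show "a * x \<in> I"
      proof -
        have "\<exists>b\<in>B. a * x = p ^ n * b" for n
        proof -
          obtain b where b: "b \<in> B" "x = p ^ n * b" using x unfolding I_def mem_Collect_eq by meson
          have "a * x = p ^ n * (a * b)" by (simp add: b(2)[symmetric] mult.left_commute)
          then show ?thesis using BD(4)[OF that b(1)] by blast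
        qed
        then show ?thesis using x that BD(4) by (auto simp: I_def)
      qed
    qed
    have rep: "\<exists>n. \<exists>b\<in>B - m. x = p ^ n * b" if "x \<in> B" "x \<notin> I" for x
    proof -
      have ex: "\<exists>n. \<not> (\<exists>b\<in>B. x = p ^ n * b)" using that by (auto simp: I_def)
      define N where "N = (LEAST n. \<not> (\<exists>b\<in>B. x = p ^ n * b))"
      have N: "\<not> (\<exists>b\<in>B. x = p ^ N * b)" using LeastI_ex[OF ex] by (simp add: N_def)
      then have "N \<noteq> 0" using that by (intro notI) auto
      then obtain n where n: "N = Suc n" using not0_implies_Suc by blast
      then have "n < N" by simp
      then obtain b where b: "b \<in> B" "x = p ^ n * b"
        using not_less_Least[of n "\<lambda>n. \<not> (\<exists>b\<in>B. x = p ^ n * b)"] unfolding N_def by blast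
      have "b \<notin> m"
      proof
        assume "b \<in> m"
        then obtain c where "c \<in> B" "b = p * c" using p(2) by blast
        then show False using N n b by (metis mult.assoc power_Suc2)
      qed
      then show ?thesis using b by blast
    qed
    have prI: "prime_of B I"
      unfolding prime_of_def
    proof (intro conjI ballI impI idI)
      show "1 \<notin> I"
      proof
        assume "1 \<in> I"
        then obtain b where "b \<in> B" "1 = p ^ 1 * b" unfolding I_def by blast
        then show False using mD(5)[OF _ p(1)] m(2) by (metis power_one_right)
      qed
      fix x y assume xy: "x \<in> B" "y \<in> B" "x * y \<in> I"
      show "x \<in> I \<or> y \<in> I"
      proof (rule ccontr)
        assume "\<not> (x \<in> I \<or> y \<in> I)"
        then obtain n k b c where *: "b \<in> B - m" "c \<in> B - m" "x = p ^ n * b" "y = p ^ k * c"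
          using rep xy by meson
        \<comment> \<open>One more than the sum of the two orders, so that cancelling
          \<open>p ^ (n + k)\<close> leaves a multiple of \<open>p\<close>.\<close>
        from xy(3) obtain d where d: "d \<in> B" "x * y = p ^ (n + k + 1) * d" unfolding I_def by blast
        have "p ^ (n + k) * (b * c) = p ^ (n + k) * (p * d)"
          using d(2) * by (simp add: power_add algebra_simps)
        then have "b * c = p * d" using False by simp
        then have "b * c \<in> m" using mD(5)[OF d(1) p(1)] by simp
        then show False using *(1,2) prime_ofD(3)[OF prime_m, of b c] by blast
      qed
    qed
    have "p \<notin> I"
    proof
      assume "p \<in> I"
      then obtain b where b: "b \<in> B" "p = p ^ 2 * b" unfolding I_def by blast
      then have "p * b = 1" using False by (simp add: power2_eq_square mult.assoc)
      then show False using mD(5)[OF b(1) p(1)] m(2) by metis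
    qed
    then have "I \<subset> m" using sub_m[OF idI prime_ofD(2)[OF prI]] p(1) by auto
    then have I0: "I = {0}" by (rule krull_dim_le_1_between[OF B dim prI prime_m])
    have noeth: "noetherian_ring (sub_ring_of B)"
    proof (rule noetherian_ringI)
      fix J assume J': "ideal J (sub_ring_of B)"
      then have J: "ideal_of B J" using ideal_sub_ring_of[OF B] by auto
      show "\<exists>A\<subseteq>carrier (sub_ring_of B). finite A \<and> J = Idl\<^bsub>sub_ring_of B\<^esub> A"
      proof (cases "J = {0}")
        case True
        then show ?thesis using Idl0 by (intro exI[of _ "{}"]) auto
      next
        case False
        have pw: "\<exists>k u. u \<in> B \<and> x = p ^ k * u \<and> p ^ k \<in> J" if x: "x \<in> J" "x \<noteq> 0" for x
        proof -
          obtain k u where u: "u \<in> B - m" "x = p ^ k * u" using rep[of x] I0 ideal_ofD(1)[OF J] x by auto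
          then obtain v where "v \<in> B" "u * v = 1" using unit by auto
          then have "p ^ k = x * v" using u(2) by (metis mult.assoc mult.right_neutral)
          then have "p ^ k \<in> J" using ideal_ofD(5)[OF J \<open>v \<in> B\<close> x(1)] by metis
          then show ?thesis using u by blast
        qed
        obtain x where "x \<in> J" "x \<noteq> 0" using False ideal_ofD(2)[OF J] by auto
        then have ex: "\<exists>k. p ^ k \<in> J" using pw by blast
        \<comment> \<open>The smallest power of \<open>p\<close> in \<open>J\<close> generates it,
          because up to a unit every nonzero element is a power of \<open>p\<close>.\<close>
        define n where "n = (LEAST k. p ^ k \<in> J)"
        have n: "p ^ n \<in> J" unfolding n_def using ex by (rule LeastI_ex)
        have "J = Idl\<^bsub>sub_ring_of B\<^esub> {p ^ n}"
        proof
          show "J \<subseteq> Idl\<^bsub>sub_ring_of B\<^esub> {p ^ n}"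
          proof
            fix y assume y: "y \<in> J"
            show "y \<in> Idl\<^bsub>sub_ring_of B\<^esub> {p ^ n}"
            proof (cases "y = 0")
              case True
              then show ?thesis using Idl[of "p ^ n"] BD pB by auto
            next
              case False
              then obtain k u where u: "u \<in> B" "y = p ^ k * u" "p ^ k \<in> J" using pw y by blast
              then have "n \<le> k" unfolding n_def by (auto intro: Least_le)
              then have "y = p ^ n * (p ^ (k - n) * u)"
                using u(2) by (simp add: mult.assoc[symmetric] power_add[symmetric])
              then show ?thesis using Idl[of "p ^ n"] BD pB u by auto
            qed
          qed
          show "Idl\<^bsub>sub_ring_of B\<^esub> {p ^ n} \<subseteq> J"
            by (rule genideal_minimal[OF J']) (use n in auto)
        qed
        then show ?thesis using BD pB by (intro exI[of _ "{p ^ n}"]) auto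
      qed
    qed
    have "enat 1 \<le> krull_dim (sub_ring_of B)"
      by (rule krull_dim_chain[OF B, of _ "\<lambda>i. if i = 0 then {0} else m"])
        (use prime_m prime_of_zero[OF B] False p(1) mD(2) in auto)
    then have "krull_dim (sub_ring_of B) = 1" using dim by (metis one_enat_def antisym)
    moreover from this have "maximalideal m (sub_ring_of B) \<and> finite {p} \<and> {p} \<subseteq> carrier (sub_ring_of B) \<and>
        enat (card {p}) = krull_dim (sub_ring_of B) \<and> genideal (sub_ring_of B) {p} = m"
      using max_m m_eq pB by (simp add: one_enat_def)
    ultimately show ?thesis
      unfolding regular_local_ring_def using noeth loc by (metis infinity_ne_i1)
  qed
qed

text \<open>The generating set witnessing regularity has at most one element; if empty, it generates
  the same ideal as {0}, so one generator can be returned in either case. The ideal \<open>m\<close>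
  is the maximal one because its complement consists of units.\<close>

lemma regular_local_ring_le_1D:
  fixes B :: "'a::idom set"
  assumes B: "subring_set B" and reg: "regular_local_ring (sub_ring_of B)"
    and dim: "krull_dim (sub_ring_of B) \<le> 1"
    and m: "ideal_of B m" "1 \<notin> m"
    and unit: "\<And>x. x \<in> B \<Longrightarrow> x \<notin> m \<Longrightarrow> \<exists>y\<in>B. x * y = 1"
  obtains p where "p \<in> m" "\<And>x. x \<in> m \<Longrightarrow> \<exists>b\<in>B. x = p * b"
proof -
  interpret cring "sub_ring_of B" by (rule cring_sub_ring_of[OF B])
  obtain m' X where X: "maximalideal m' (sub_ring_of B)" "finite X" "X \<subseteq> B"
      "enat (card X) = krull_dim (sub_ring_of B)" "genideal (sub_ring_of B) X = m'"
    using reg unfolding regular_local_ring_def by auto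
  interpret m': maximalideal m' "sub_ring_of B" by fact
  have m'i: "ideal_of B m'" using m'.is_ideal ideal_sub_ring_of[OF B] by auto
  have "1 \<notin> m'" using m'.I_notcarr ideal_ofD(4)[OF m'i] ideal_ofD(1)[OF m'i]
    by (metis equalityI mult.right_neutral subsetI sub_ring_of_simps(1))
  have "m' \<subseteq> m"
  proof
    fix x assume x: "x \<in> m'"
    show "x \<in> m"
    proof (rule ccontr)
      assume "x \<notin> m"
      then obtain y where "y \<in> B" "x * y = 1" using unit ideal_ofD(1)[OF m'i x] by auto
      then show False using ideal_ofD(5)[OF m'i _ x] \<open>1 \<notin> m'\<close> by metis
    qed
  qed
  then have mm: "m = m'"
    using m'.I_maximal[of m] ideal_ofD(1)[OF m(1)] m subring_setD(2)[OF B] ideal_sub_ring_of[OF B] by auto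
  have "card X \<le> 1" using dim X(4) by (metis enat_ord_simps(1) one_enat_def)
  then consider "X = {}" | x where "X = {x}" using X(2) by (metis card_0_eq card_1_singletonE le_less less_one)
  then obtain x where x: "x \<in> B" "X \<subseteq> {x}" "genideal (sub_ring_of B) X = genideal (sub_ring_of B) {x}"
  proof cases
    case 1
    have "genideal (sub_ring_of B) {} = genideal (sub_ring_of B) {0}"
    proof
      show "genideal (sub_ring_of B) {} \<subseteq> genideal (sub_ring_of B) {0}"
        by (rule genideal_minimal) (use genideal_ideal[of "{0}"] subring_setD(1)[OF B] in auto)
      have i: "ideal (genideal (sub_ring_of B) {}) (sub_ring_of B)" by (rule genideal_ideal) auto
      then have "0 \<in> genideal (sub_ring_of B) {}" using ideal_sub_ring_of[OF B] ideal_ofD(2) by blast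
      then show "genideal (sub_ring_of B) {0} \<subseteq> genideal (sub_ring_of B) {}"
        by (intro genideal_minimal[OF i]) auto
    qed
    then show ?thesis using that[of 0] subring_setD(1)[OF B] 1 by auto
  next
    case (2 x)
    then show ?thesis using that[of x] X by auto
  qed
  have "m = PIdl\<^bsub>sub_ring_of B\<^esub> x"
    using mm X(5) x(3) cgenideal_eq_genideal[of x] x(1) by auto
  also have "\<dots> = {x * b | b. b \<in> B}" by (auto simp: cgenideal_def mult.commute)
  finally have "m = {x * b | b. b \<in> B}" .
  then show ?thesis using that[of x] subring_setD(2)[OF B] by force
qed


section \<open>Primes of a localization, and regularity without fractions\<close>

lemma local_ext_mem_iff:
  fixes A :: "'a::idom set"
  assumes A: "subring_set A" and P: "prime_of A P" and Q: "prime_of A Q" "Q \<subseteq> P"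
    and "a \<in> A" "s \<in> A" "s \<notin> P"
  shows "Fract a s \<in> {Fract a s | a s. a \<in> Q \<and> s \<in> A \<and> s \<notin> P} \<longleftrightarrow> a \<in> Q"
proof
  assume "Fract a s \<in> {Fract a s | a s. a \<in> Q \<and> s \<in> A \<and> s \<notin> P}"
  then obtain a' s' where *: "Fract a s = Fract a' s'" "a' \<in> Q" "s' \<in> A" "s' \<notin> P" by blast
  moreover have "s \<noteq> 0" "s' \<noteq> 0" using assms * ideal_ofD(2)[OF prime_ofD(1)[OF P]] by auto
  \<comment> \<open>Fractions have many representatives. Cross-multiplication moves the numerator
    into \<open>Q\<close>, and \<open>s'\<close> can be cancelled because \<open>Q\<close> lies
    inside \<open>P\<close>.\<close>
  ultimately have "a * s' = a' * s" by (simp add: eq_fract)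
  then have "a * s' \<in> Q" using ideal_ofD(5)[OF prime_ofD(1)[OF Q(1)] assms(6) *(2)] by simp
  then show "a \<in> Q" using prime_ofD(3)[OF Q(1) assms(5) *(3)] *(4) Q(2) by auto
qed (use assms in blast)

lemma local_unit:
  fixes A :: "'a::idom set"
  assumes A: "subring_set A" and P: "prime_of A P" and "a \<in> A" "a \<notin> P" "s \<in> A" "s \<notin> P"
  shows "Fract s a \<in> localization A P" "Fract a s * Fract s a = 1"
proof -
  show "Fract s a \<in> localization A P" using assms by (auto simp: localization_def)
  have "s \<noteq> 0" "a \<noteq> 0" using assms ideal_ofD(2)[OF prime_ofD(1)[OF P]] by auto
  then show "Fract a s * Fract s a = 1" by (simp add: One_fract_def eq_fract)
qed

context
  fixes A :: "'a::idom set" and P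
  assumes A: "subring_set A" and P: "prime_of A P"
begin

private lemma nz: "s \<noteq> 0" if "s \<notin> P"
  using that ideal_ofD(2)[OF prime_ofD(1)[OF P]] by auto

private lemma mult_notin: "s * t \<notin> P" if "s \<in> A" "s \<notin> P" "t \<in> A" "t \<notin> P"
  using that prime_ofD(3)[OF P] by blast

lemma subring_set_localization: "subring_set (localization A P)"
  unfolding subring_set_def
proof (intro conjI ballI)
  note AD = subring_setD[OF A]
  have 1: "1 \<in> A" "1 \<notin> P" using AD prime_ofD(2)[OF P] by auto
  then show "0 \<in> localization A P" "1 \<in> localization A P"
    unfolding localization_def Zero_fract_def One_fract_def using AD(1) by blast+
  fix x assume "x \<in> localization A P"
  then obtain a s where x: "x = Fract a s" "a \<in> A" "s \<in> A" "s \<notin> P" unfolding localization_def by blast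
  then show "- x \<in> localization A P" unfolding localization_def minus_fract x(1) using AD(5) by blast
  fix y assume "y \<in> localization A P"
  then obtain b t where y: "y = Fract b t" "b \<in> A" "t \<in> A" "t \<notin> P" unfolding localization_def by blast
  have "x + y = Fract (a * t + b * s) (s * t)" using x y nz by (simp add: add_fract)
  moreover have "a * t + b * s \<in> A" "s * t \<in> A" using x y AD(3,4) by auto
  ultimately show "x + y \<in> localization A P" 
    unfolding localization_def using mult_notin x y by blast
  have "x * y = Fract (a * b) (s * t)" using x y by simp
  moreover have "a * b \<in> A" "s * t \<in> A" using x y AD(4) by auto
  ultimately show "x * y \<in> localization A P" 
    unfolding localization_def using mult_notin x y by blast
qed

lemma prime_of_local_ext:
  assumes Q: "prime_of A Q" "Q \<subseteq> P"
  shows "prime_of (localization A P) {Fract a s | a s. a \<in> Q \<and> s \<in> A \<and> s \<notin> P}" (is "prime_of ?B ?Q")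
proof -
  note AD = subring_setD[OF A] and QD = ideal_ofD[OF prime_ofD(1)[OF Q(1)]]
  note iff = local_ext_mem_iff[OF A P Q]
  have 1: "1 \<in> A" "1 \<notin> P" using AD prime_ofD(2)[OF P] by auto
  have "ideal_of ?B ?Q"
    unfolding ideal_of_def
  proof (intro conjI ballI)
    show "?Q \<subseteq> ?B" unfolding localization_def using QD(1) by blast
    show "0 \<in> ?Q" unfolding Zero_fract_def using QD(2) 1 by blast
  next
    fix x y assume "x \<in> ?Q" "y \<in> ?Q"
    then obtain a s b t where x: "x = Fract a s" "a \<in> Q" "s \<in> A" "s \<notin> P" 
      and y: "y = Fract b t" "b \<in> Q" "t \<in> A" "t \<notin> P" by blast
    have "x + y = Fract (a * t + b * s) (s * t)" using x y nz by (simp add: add_fract)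
    moreover have "a * t + b * s \<in> Q" "s * t \<in> A" using x y AD(4) QD(3,5) by auto
    ultimately show "x + y \<in> ?Q" using mult_notin x y by blast
  next
    fix x y assume "x \<in> ?B" "y \<in> ?Q"
    then obtain a s b t where x: "x = Fract a s" "a \<in> A" "s \<in> A" "s \<notin> P" 
      and y: "y = Fract b t" "b \<in> Q" "t \<in> A" "t \<notin> P" unfolding localization_def by blast
    have "x * y = Fract (a * b) (s * t)" using x y by simp
    moreover have "a * b \<in> Q" "s * t \<in> A" using x y AD(4) QD(4) by auto
    ultimately show "x * y \<in> ?Q" using mult_notin x y by blast
  qed
  moreover have "1 \<notin> ?Q" 
    unfolding One_fract_def using iff[OF AD(2) 1] prime_ofD(2)[OF Q(1)] by blast
  moreover have "x \<in> ?Q \<or> y \<in> ?Q" if xy: "x \<in> ?B" "y \<in> ?B" "x * y \<in> ?Q" for x y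
  proof -
    obtain a s b t where x: "x = Fract a s" "a \<in> A" "s \<in> A" "s \<notin> P" 
      and y: "y = Fract b t" "b \<in> A" "t \<in> A" "t \<notin> P" using xy unfolding localization_def by blast
    have "Fract (a * b) (s * t) \<in> ?Q" using xy(3) x y by simp
    then have "a * b \<in> Q"
      using iff[of "a * b" "s * t"] mult_notin x y AD(4) by blast
    then have "a \<in> Q \<or> b \<in> Q" using prime_ofD(3)[OF Q(1)] x y by blast
    then show ?thesis using x y by blast
  qed
  ultimately show ?thesis unfolding prime_of_def by blast
qed

lemma prime_of_local_contr:
  assumes J: "prime_of (localization A P) J"
  shows "prime_of A {a \<in> A. Fract a 1 \<in> J}" "{a \<in> A. Fract a 1 \<in> J} \<subseteq> P"
    "J = {Fract a s | a s. a \<in> {a \<in> A. Fract a 1 \<in> J} \<and> s \<in> A \<and> s \<notin> P}"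
proof -
  note AD = subring_setD[OF A] and JD = ideal_ofD[OF prime_ofD(1)[OF J]]
  have 1: "1 \<in> A" "1 \<notin> P" using AD prime_ofD(2)[OF P] by auto
  have mem: "Fract a 1 \<in> localization A P" if "a \<in> A" for a
    unfolding localization_def using that 1 by blast
  show "prime_of A {a \<in> A. Fract a 1 \<in> J}"
    unfolding prime_of_def ideal_of_def
  proof (intro conjI ballI impI)
    show "0 \<in> {a \<in> A. Fract a 1 \<in> J}" using AD(1) JD(2) by (simp add: Zero_fract_def)
    show "1 \<notin> {a \<in> A. Fract a 1 \<in> J}" using prime_ofD(2)[OF J] by (simp add: One_fract_def)
    show "x + y \<in> {a \<in> A. Fract a 1 \<in> J}"
      if "x \<in> {a \<in> A. Fract a 1 \<in> J}" "y \<in> {a \<in> A. Fract a 1 \<in> J}" for x y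
      using that JD(3)[of "Fract x 1" "Fract y 1"] AD(3) by (simp add: add_fract)
    show "a * x \<in> {a \<in> A. Fract a 1 \<in> J}" if "a \<in> A" "x \<in> {a \<in> A. Fract a 1 \<in> J}" for a x
      using that JD(4)[of "Fract a 1" "Fract x 1"] mem[of a] AD(4) by simp
    show "x \<in> {a \<in> A. Fract a 1 \<in> J} \<or> y \<in> {a \<in> A. Fract a 1 \<in> J}"
      if "x \<in> A" "y \<in> A" "x * y \<in> {a \<in> A. Fract a 1 \<in> J}" for x y
      using that prime_ofD(3)[OF J, of "Fract x 1" "Fract y 1"] mem by simp
  qed auto
  show "{a \<in> A. Fract a 1 \<in> J} \<subseteq> P"
  proof
    fix a assume a: "a \<in> {a \<in> A. Fract a 1 \<in> J}"
    show "a \<in> P"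
    proof (rule ccontr)
      assume "a \<notin> P"
      then have "Fract a 1 * Fract 1 a = 1" "Fract 1 a \<in> localization A P"
        using local_unit[OF A P _ _ 1] a by auto
      then show False using JD(5) a prime_ofD(2)[OF J] by (metis (no_types, lifting) mem_Collect_eq)
    qed
  qed
  show "J = {Fract a s | a s. a \<in> {a \<in> A. Fract a 1 \<in> J} \<and> s \<in> A \<and> s \<notin> P}" (is "_ = ?R")
  proof (intro equalityI subsetI)
    fix x assume x: "x \<in> J"
    then obtain a s where a: "x = Fract a s" "a \<in> A" "s \<in> A" "s \<notin> P" 
      using JD(1) unfolding localization_def by blast
    have "Fract a 1 = Fract s 1 * x" using nz[OF a(4)] a(1) by (simp add: eq_fract)
    then have "Fract a 1 \<in> J" using JD(4)[OF mem[OF a(3)] x] by simp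
    then show "x \<in> ?R" using a by blast
  next
    fix x assume "x \<in> ?R"
    then obtain a s where a: "x = Fract a s" "a \<in> A" "Fract a 1 \<in> J" "s \<in> A" "s \<notin> P" by blast
    have "x = Fract 1 s * Fract a 1" using a(1) by simp
    moreover have "Fract 1 s \<in> localization A P" using a 1 unfolding localization_def by blast
    ultimately show "x \<in> J" using JD(4)[OF _ a(3)] by metis
  qed
qed

lemma localization_props:
  defines "m \<equiv> {Fract a s | a s. a \<in> P \<and> s \<in> A \<and> s \<notin> P}"
  shows "ideal_of (localization A P) m" "1 \<notin> m"
    "\<And>x. x \<in> localization A P \<Longrightarrow> x \<notin> m \<Longrightarrow> \<exists>y\<in>localization A P. x * y = 1"
proof -
  show "ideal_of (localization A P) m" "1 \<notin> m"
    using prime_ofD(1,2)[OF prime_of_local_ext[OF P order_refl]] unfolding m_def by blast+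
  fix x assume "x \<in> localization A P" "x \<notin> m"
  then obtain a s where a: "x = Fract a s" "a \<in> A" "a \<notin> P" "s \<in> A" "s \<notin> P"
    unfolding m_def localization_def by blast
  then show "\<exists>y\<in>localization A P. x * y = 1" using local_unit[OF A P a(2-)] by blast
qed

text \<open>Extension to the localization is strictly monotone on primes inside \<open>P\<close>. So
  the extension of \<open>Q\<close> lies strictly below the maximal ideal and vanishes by the
  dimension bound, and the ring embeds into its localization.\<close>

lemma krull_dim_localization_le_1D:
  assumes dim: "krull_dim (sub_ring_of (localization A P)) \<le> 1"
    and Q: "prime_of A Q" "Q \<subset> P"
  shows "Q = {0}"
proof -
  define e where "e = (\<lambda>Q. {Fract a s | a s. a \<in> Q \<and> s \<in> A \<and> s \<notin> P})"
  have 1: "1 \<in> A" "1 \<notin> P" using subring_setD[OF A] prime_ofD(2)[OF P] by auto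
  have Q': "Q \<subseteq> P" using Q by auto
  obtain x where x: "x \<in> P" "x \<notin> Q" using Q by auto
  have "e Q \<subseteq> e P" using Q unfolding e_def by blast
  moreover have "Fract x 1 \<in> e P" using x 1 unfolding e_def by blast
  moreover have "Fract x 1 \<notin> e Q"
    using local_ext_mem_iff[OF A P Q(1) Q' _ 1] x ideal_ofD(1)[OF prime_ofD(1)[OF P]] unfolding e_def by blast
  ultimately have "e Q \<subset> e P" by blast
  moreover have "prime_of (localization A P) (e P)" "prime_of (localization A P) (e Q)"
    using prime_of_local_ext[OF P order_refl] prime_of_local_ext[OF Q(1) Q'] by (simp_all only: e_def)
  ultimately have *: "e Q = {0}"
    by (intro krull_dim_le_1_between[OF subring_set_localization dim])
  have "a = 0" if "a \<in> Q" for a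
  proof -
    have "Fract a 1 \<in> e Q" using that 1 unfolding e_def by blast
    then have "Fract a 1 = Fract 0 1" using * by (simp add: Zero_fract_def)
    then show ?thesis by (simp add: eq_fract)
  qed
  then show ?thesis using ideal_ofD(2)[OF prime_ofD(1)[OF Q(1)]] by blast
qed

text \<open>The condition on \<open>p\<close> is principality of the maximal ideal of the
  localization after clearing denominators, \<open>b\<close> being the unit to divide by.\<close>

lemma regular_localization_principal:
  assumes dim: "krull_dim (sub_ring_of (localization A P)) \<le> 1"
    and p: "p \<in> P" "\<And>f. f \<in> P \<Longrightarrow> \<exists>b\<in>A - P. \<exists>c\<in>A. b * f = p * c"
  shows "regular_local_ring (sub_ring_of (localization A P))"
proof (rule regular_local_ring_principal[OF subring_set_localization localization_props _ _ dim])
  have 1: "1 \<in> A" "1 \<notin> P" using subring_setD[OF A] prime_ofD(2)[OF P] by auto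
  show "Fract p 1 \<in> {Fract a s |a s. a \<in> P \<and> s \<in> A \<and> s \<notin> P}" using p 1 by blast
  fix x assume "x \<in> {Fract a s |a s. a \<in> P \<and> s \<in> A \<and> s \<notin> P}"
  then obtain a s where x: "x = Fract a s" "a \<in> P" "s \<in> A" "s \<notin> P" by blast
  then obtain b c where b: "b \<in> A" "b \<notin> P" "c \<in> A" "b * a = p * c" using p(2) by blast
  have "x = Fract p 1 * Fract c (b * s)"
  proof -
    have "a * (b * s) = (p * c) * s" using b(4) by (simp add: mult.commute mult.left_commute)
    moreover have "b * s \<noteq> 0" "s \<noteq> 0" using nz x b by auto
    ultimately show ?thesis using x(1) by (simp add: eq_fract)
  qed
  moreover have "Fract c (b * s) \<in> localization A P"
    unfolding localization_def using b x mult_notin subring_setD(4)[OF A] by blast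
  ultimately show "\<exists>b\<in>localization A P. x = Fract p 1 * b" by blast
qed

text \<open>A prime of the localization is recovered from its contraction, so a chain of three
  primes would contract to a strict chain inside \<open>P\<close>. Its middle member is nonzero,
  hence equal to \<open>P\<close>, and leaves no room above. So the dimension is at most one and the
  condition applies.\<close>

lemma principal_of_serre_R1:
  assumes R1: "serre_R1 A"
    and ht: "\<And>Q. prime_of A Q \<Longrightarrow> Q \<subseteq> P \<Longrightarrow> Q \<noteq> {0} \<Longrightarrow> Q = P"
  obtains p where "p \<in> P" "\<And>f. f \<in> P \<Longrightarrow> \<exists>b\<in>A - P. \<exists>c\<in>A. b * f = p * c"
proof -
  let ?B = "localization A P"
  define m where "m = {Fract a s | a s. a \<in> P \<and> s \<in> A \<and> s \<notin> P}"
  have 1: "1 \<in> A" "1 \<notin> P" using subring_setD[OF A] prime_ofD(2)[OF P] by auto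
  have dim: "krull_dim (sub_ring_of ?B) \<le> enat 1"
  proof (rule krull_dim_le[OF subring_set_localization])
    fix C and k :: nat assume C: "\<And>i. i \<le> k \<Longrightarrow> prime_of ?B (C i)" "\<And>i. i < k \<Longrightarrow> C i \<subset> C (Suc i)"
    show "k \<le> 1"
    proof (rule ccontr)
      assume "\<not> k \<le> 1"
      then have pr: "prime_of ?B (C 0)" "prime_of ?B (C 1)" "prime_of ?B (C 2)"
        and sub: "C 0 \<subset> C 1" "C 1 \<subset> C 2"
        using C(1)[of 0] C(1)[of 1] C(1)[of 2] C(2)[of 0] C(2)[of 1] by (auto simp: numeral_2_eq_2)
      define c where "c = (\<lambda>J. {a \<in> A. Fract a 1 \<in> J})"
      have c: "prime_of A (c J)" "c J \<subseteq> P" "J = {Fract a s | a s. a \<in> c J \<and> s \<in> A \<and> s \<notin> P}" 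
        if "prime_of ?B J" for J
        using prime_of_local_contr[OF that] unfolding c_def by auto
      have strict: "c I \<subset> c J" if "prime_of ?B I" "prime_of ?B J" "I \<subset> J" for I J
      proof -
        have "c I \<subseteq> c J" unfolding c_def by (rule Collect_mono) (use that(3) in blast)
        moreover have "c I \<noteq> c J" using c(3)[OF that(1)] c(3)[OF that(2)] that(3) by (metis psubsetE subset_refl)
        ultimately show ?thesis by (rule psubsetI)
      qed
      have "c (C 0) \<subset> c (C 1)" "c (C 1) \<subset> c (C 2)"
        using strict[OF pr(1,2) sub(1)] strict[OF pr(2,3) sub(2)] .
      moreover have "c (C 1) = P"
      proof (rule ht[OF c(1,2)[OF pr(2)]])
        have "{0} \<subseteq> c (C 0)" using ideal_ofD(2)[OF prime_ofD(1)[OF c(1)[OF pr(1)]]] by simp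
        then have "{0} \<subset> c (C 1)" using \<open>c (C 0) \<subset> c (C 1)\<close> by (rule subset_psubset_trans)
        then show "c (C 1) \<noteq> {0}" by blast
      qed
      ultimately show False using c(2)[OF pr(3)] by blast
    qed
  qed
  then have dim1: "krull_dim (sub_ring_of ?B) \<le> 1" by (simp add: one_enat_def)
  have reg: "regular_local_ring (sub_ring_of ?B)"
    using R1 P dim1 primeideal_sub_ring_of[OF A] unfolding serre_R1_def by blast
  obtain q where q: "q \<in> m" "\<And>x. x \<in> m \<Longrightarrow> \<exists>b\<in>?B. x = q * b"
    by (rule regular_local_ring_le_1D[OF subring_set_localization reg dim1 localization_props, folded m_def]) auto
  then obtain p s where p: "q = Fract p s" "p \<in> P" "s \<in> A" "s \<notin> P" unfolding m_def by blast
  show ?thesis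
  proof (rule that[OF p(2)])
    fix f assume "f \<in> P"
    then have "Fract f 1 \<in> m" unfolding m_def using 1 by blast
    then obtain c t where c: "c \<in> A" "t \<in> A" "t \<notin> P" "Fract f 1 = q * Fract c t"
      using q(2) unfolding localization_def by blast
    then have "f * (s * t) = p * c" using p nz by (simp add: eq_fract)
    then have "(s * t) * f = p * c" by (simp add: mult.commute)
    then show "\<exists>b\<in>A - P. \<exists>c\<in>A. b * f = p * c"
      using mult_notin c p subring_setD(4)[OF A] by blast
  qed
qed

end

section \<open>Semigroup rings\<close>

abbreviation keys :: "('a \<Rightarrow>\<^sub>0 'b::zero) \<Rightarrow> 'a set" where "keys \<equiv> Poly_Mapping.keys"
abbreviation lookup :: "('a \<Rightarrow>\<^sub>0 'b::zero) \<Rightarrow> 'a \<Rightarrow> 'b" where "lookup \<equiv> Poly_Mapping.lookup"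

text \<open>For \<open>Z\<close> of the form \<open>h v = c\<close> with \<open>h\<close> additive
  this is the part of degree \<open>c\<close> for the grading \<open>h\<close>; inequalities cut off
  the low or the high part.\<close>

lift_definition restr :: "('a \<Rightarrow> bool) \<Rightarrow> ('a \<Rightarrow>\<^sub>0 'b) \<Rightarrow> ('a \<Rightarrow>\<^sub>0 'b::zero)"
  is "\<lambda>Z f a. if Z a then f a else 0"
  by (rule finite_subset) auto

lemma lookup_restr: "lookup (restr Z p) v = (if Z v then lookup p v else 0)"
  by transfer simp

lemma keys_restr: "keys (restr Z p) = {v \<in> keys p. Z v}"
  by (auto simp: in_keys_iff lookup_restr split: if_splits)

lemma restr_zero [simp]: "restr Z 0 = 0"
  by (rule poly_mapping_eqI) (simp add: lookup_restr)

lemma restr_add: "restr Z (p + q) = restr Z p + restr Z q"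
  for p q :: "'a \<Rightarrow>\<^sub>0 'b::comm_monoid_add"
  by (rule poly_mapping_eqI) (simp add: lookup_restr lookup_add)

lemma restr_diff: "restr Z (p - q) = restr Z p - restr Z q"
  for p q :: "'a \<Rightarrow>\<^sub>0 'b::ab_group_add"
  by (rule poly_mapping_eqI) (simp add: lookup_restr lookup_minus)

lemma restr_sum: "restr Z (sum f I) = (\<Sum>i\<in>I. restr Z (f i))"
  for f :: "'i \<Rightarrow> 'a \<Rightarrow>\<^sub>0 'b::comm_monoid_add"
  by (rule poly_mapping_eqI) (simp add: lookup_restr lookup_sum)

lemma restr_restr: "restr Y (restr Z p) = restr (\<lambda>v. Y v \<and> Z v) p"
  by (rule poly_mapping_eqI) (simp add: lookup_restr)

lemma restr_id: "(\<And>v. v \<in> keys p \<Longrightarrow> Z v) \<Longrightarrow> restr Z p = p"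
  by (rule poly_mapping_eqI) (auto simp: lookup_restr in_keys_iff)

lemma restr_eq_0: "(\<And>v. v \<in> keys p \<Longrightarrow> \<not> Z v) \<Longrightarrow> restr Z p = 0"
  by (rule poly_mapping_eqI) (auto simp: lookup_restr in_keys_iff)

lemma restr_cong: "(\<And>v. v \<in> keys p \<Longrightarrow> Y v = Z v) \<Longrightarrow> restr Y p = restr Z p"
  by (rule poly_mapping_eqI) (auto simp: lookup_restr in_keys_iff)

lemma restr_split: "p = restr Z p + restr (\<lambda>v. \<not> Z v) p"
  for p :: "'a \<Rightarrow>\<^sub>0 'b::comm_monoid_add"
  by (rule poly_mapping_eqI) (simp add: lookup_restr lookup_add)

lemma restr_eq_single: "restr (\<lambda>v. v = c) p = Poly_Mapping.single c (lookup p c)"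
  by (rule poly_mapping_eqI) (simp add: lookup_restr lookup_single)

lemma restr_decomp:
  fixes p :: "'a \<Rightarrow>\<^sub>0 'b::comm_monoid_add"
  shows "p = (\<Sum>c\<in>h ` keys p. restr (\<lambda>v. h v = c) p)"
proof (rule poly_mapping_eqI)
  fix v
  have "(\<Sum>c\<in>h ` keys p. if h v = c then lookup p v else 0) = lookup p v"
    by (cases "v \<in> keys p") (auto simp: in_keys_iff)
  then show "lookup p v = lookup (\<Sum>c\<in>h ` keys p. restr (\<lambda>v. h v = c) p) v"
    by (simp add: lookup_sum lookup_restr)
qed

lemma sum_single_lookup: "p = (\<Sum>v\<in>keys p. Poly_Mapping.single v (lookup p v))"
  for p :: "'a \<Rightarrow>\<^sub>0 'b::comm_monoid_add"
  using restr_decomp[of p "\<lambda>v. v"] by (simp add: restr_eq_single)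

lemma lookup_single_mult:
  fixes p :: "'a::ab_group_add \<Rightarrow>\<^sub>0 'b::comm_ring_1"
  shows "lookup (Poly_Mapping.single u k * p) w = k * lookup p (w - u)"
proof -
  have "lookup (Poly_Mapping.single u k * p) w = 
      (\<Sum>v\<in>keys p. lookup (Poly_Mapping.single (u + v) (k * lookup p v)) w)"
    by (subst (1) sum_single_lookup[of p]) (simp add: sum_distrib_left mult_single lookup_sum)
  also have "\<dots> = (\<Sum>v\<in>keys p. if v = w - u then k * lookup p v else 0)"
    by (intro sum.cong refl) (auto simp: lookup_single when_def)
  also have "\<dots> = k * lookup p (w - u)"
    by (auto simp: sum.delta in_keys_iff)
  finally show ?thesis .
qed

lemma keys_monom_mult:
  fixes p :: "'a::ab_group_add \<Rightarrow>\<^sub>0 'b::comm_ring_1"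
  shows "keys (Poly_Mapping.single u 1 * p) = (+) u ` keys p"
proof -
  have "w \<in> (+) u ` keys p \<longleftrightarrow> w - u \<in> keys p" for w by force
  then show ?thesis by (auto simp: in_keys_iff lookup_single_mult)
qed

lemma restr_single_mult:
  fixes p :: "'a::ab_group_add \<Rightarrow>\<^sub>0 'b::comm_ring_1" and h :: "'a \<Rightarrow> 'g::ab_group_add"
  assumes h: "\<And>a b. h (a + b) = h a + h b"
  shows "restr (\<lambda>v. h v = c) (Poly_Mapping.single u k * p)
    = Poly_Mapping.single u k * restr (\<lambda>v. h v = c - h u) p"
proof (rule poly_mapping_eqI)
  fix w
  have "h w = h (w - u) + h u" using h[of "w - u" u] by simp
  then have "h w = c \<longleftrightarrow> h (w - u) = c - h u" by (auto simp: algebra_simps)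
  then show "lookup (restr (\<lambda>v. h v = c) (Poly_Mapping.single u k * p)) w
    = lookup (Poly_Mapping.single u k * restr (\<lambda>v. h v = c - h u) p) w"
    by (simp add: lookup_restr lookup_single_mult)
qed

lemma keys_multE:
  assumes "v \<in> keys (p * q)"
  obtains a b where "v = a + b" "a \<in> keys p" "b \<in> keys q"
  using assms keys_mult by fast

text \<open>Degrees below \<open>a + b\<close> do not occur, and degree \<open>a + b\<close> is
  reached only when both factors contribute their part of lowest degree.\<close>

lemma restr_mult_low:
  fixes p q :: "'a::ab_group_add \<Rightarrow>\<^sub>0 'b::comm_ring_1" and h :: "'a \<Rightarrow> 'g::linordered_ab_group_add"
  assumes h: "\<And>a b. h (a + b) = h a + h b"
    and p: "\<And>v. v \<in> keys p \<Longrightarrow> a \<le> h v" and q: "\<And>v. v \<in> keys q \<Longrightarrow> b \<le> h v"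
  shows "restr (\<lambda>v. h v = a + b) (p * q) = restr (\<lambda>v. h v = a) p * restr (\<lambda>v. h v = b) q"
proof -
  let ?p1 = "restr (\<lambda>v. h v = a) p" and ?p2 = "restr (\<lambda>v. h v \<noteq> a) p"
  let ?q1 = "restr (\<lambda>v. h v = b) q" and ?q2 = "restr (\<lambda>v. h v \<noteq> b) q"
  have "p * q = ?p1 * q + ?p2 * q"
    using restr_split[of p "\<lambda>v. h v = a"] by (metis distrib_right)
  moreover have "?p1 * q = ?p1 * ?q1 + ?p1 * ?q2"
    using restr_split[of q "\<lambda>v. h v = b"] by (metis distrib_left)
  ultimately have "p * q = ?p1 * ?q1 + (?p1 * ?q2 + ?p2 * q)"
    by (simp add: add.assoc)
  then have "restr (\<lambda>v. h v = a + b) (p * q) = restr (\<lambda>v. h v = a + b) (?p1 * ?q1)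
    + (restr (\<lambda>v. h v = a + b) (?p1 * ?q2) + restr (\<lambda>v. h v = a + b) (?p2 * q))"
    by (simp only: restr_add)
  also have "restr (\<lambda>v. h v = a + b) (?p1 * ?q1) = ?p1 * ?q1"
    by (rule restr_id) (auto elim!: keys_multE simp: keys_restr h)
  also have "restr (\<lambda>v. h v = a + b) (?p1 * ?q2) = 0"
    by (rule restr_eq_0) (auto elim!: keys_multE simp: keys_restr h)
  also have "restr (\<lambda>v. h v = a + b) (?p2 * q) = 0"
  proof (rule restr_eq_0)
    fix v assume "v \<in> keys (?p2 * q)"
    then obtain x y where v: "v = x + y" "x \<in> keys p" "h x \<noteq> a" "y \<in> keys q"
      by (auto elim!: keys_multE simp: keys_restr)
    then have "a + b < h x + h y" using p[of x] q[of y] by (intro add_less_le_mono) auto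
    then show "h v \<noteq> a + b" using v h by auto
  qed
  finally show ?thesis by simp
qed

section \<open>Semigroup rings and the primes attached to gradings\<close>

definition sring :: "'a set \<Rightarrow> ('a \<Rightarrow>\<^sub>0 'k::zero) set" where
  "sring S = {p. keys p \<subseteq> S}"

lemma ideal_of_sum:
  assumes "ideal_of A I" "\<And>i. i \<in> X \<Longrightarrow> f i \<in> I"
  shows "sum f X \<in> I"
  using assms(2) by (induction X rule: infinite_finite_induct) (auto simp: ideal_ofD[OF assms(1)])

locale semigroup_ring =
  fixes S :: "'a::linordered_ab_group_add set" and A :: "('a \<Rightarrow>\<^sub>0 'k::field) set"
  assumes S0: "0 \<in> S" and S_add: "\<And>a b. a \<in> S \<Longrightarrow> b \<in> S \<Longrightarrow> a + b \<in> S"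
  defines "A \<equiv> sring S"
begin

lemma A_iff: "p \<in> A \<longleftrightarrow> keys p \<subseteq> S"
  by (simp add: A_def sring_def)

lemma subring_A: "subring_set A"
  unfolding subring_set_def
proof (intro conjI ballI)
  fix x y assume xy: "x \<in> A" "y \<in> A"
  then show "x + y \<in> A" using keys_add[of x y] by (auto simp: A_iff)
  show "x * y \<in> A" using xy by (auto simp: A_iff elim!: keys_multE intro: S_add)
next
  fix x assume "x \<in> A"
  then show "- x \<in> A" by (auto simp: A_iff in_keys_iff)
qed (auto simp: A_iff S0)

lemmas AD = subring_setD[OF subring_A]

lemma A_single: "v \<in> S \<Longrightarrow> Poly_Mapping.single v c \<in> A"
  by (simp add: A_iff)

lemma A_restr: "p \<in> A \<Longrightarrow> restr Z p \<in> A"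
  by (auto simp: A_iff keys_restr)

text \<open>As no degree is negative, taking the part of degree 0 is multiplicative, and its kernel
  is this ideal. Primality follows because the ambient ring has no zero divisors.\<close>

lemma prime_of_positive:
  fixes h :: "'a \<Rightarrow> 'g::linordered_ab_group_add"
  assumes h: "\<And>a b. h (a + b) = h a + h b" and pos: "\<And>v. v \<in> S \<Longrightarrow> 0 \<le> h v"
  shows "prime_of A {f \<in> A. \<forall>v\<in>keys f. 0 < h v}" (is "prime_of A ?P")
  unfolding prime_of_def ideal_of_def
proof (intro conjI ballI impI)
  have h0: "h 0 = 0" using h[of 0 0] by simp
  show "?P \<subseteq> A" "0 \<in> ?P" using AD(1) by auto
  show "1 \<notin> ?P" by (simp add: h0)
  show "x + y \<in> ?P" if "x \<in> ?P" "y \<in> ?P" for x y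
    using that AD(3) keys_add[of x y] by auto
  show "x * y \<in> ?P" if "x \<in> A" "y \<in> ?P" for x y
  proof -
    have "0 < h v" if v: "v \<in> keys (x * y)" for v
    proof -
      obtain a b where "v = a + b" "a \<in> keys x" "b \<in> keys y" using v by (rule keys_multE)
      moreover from this have "0 \<le> h a" "0 < h b" using \<open>x \<in> A\<close> \<open>y \<in> ?P\<close> pos by (auto simp: A_iff)
      ultimately show ?thesis by (simp add: h add_nonneg_pos)
    qed
    then show ?thesis using that AD(4) by auto
  qed
  fix f g assume fg: "f \<in> A" "g \<in> A" "f * g \<in> ?P"
  show "f \<in> ?P \<or> g \<in> ?P"
  proof (rule ccontr)
    assume "\<not> (f \<in> ?P \<or> g \<in> ?P)"
    then obtain u v where "u \<in> keys f" "\<not> 0 < h u" "v \<in> keys g" "\<not> 0 < h v" using fg by blast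
    moreover from this have "h u = 0" "h v = 0" using pos[of u] pos[of v] fg by (force simp: A_iff)+
    ultimately have "u \<in> keys (restr (\<lambda>v. h v = 0) f)" "v \<in> keys (restr (\<lambda>v. h v = 0) g)"
      by (simp_all add: keys_restr)
    then have "restr (\<lambda>v. h v = 0) f \<noteq> 0" "restr (\<lambda>v. h v = 0) g \<noteq> 0" by auto
    moreover have "restr (\<lambda>v. h v = 0 + 0) (f * g) = restr (\<lambda>v. h v = 0) f * restr (\<lambda>v. h v = 0) g"
      by (rule restr_mult_low[OF h]) (use fg pos in \<open>auto simp: A_iff\<close>)
    moreover have "restr (\<lambda>v. h v = 0 + 0) (f * g) = 0"
      using fg(3) by (intro restr_eq_0) auto
    ultimately show False by simp
  qed
qed

text \<open>The largest homogeneous ideal inside a prime is again prime: since degrees are totally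
  ordered, the lowest parts outside \<open>P\<close> of two factors can be isolated in their
  product.\<close>

lemma prime_of_homogeneous:
  fixes h :: "'a \<Rightarrow> 'g::linordered_ab_group_add"
  assumes h: "\<And>a b. h (a + b) = h a + h b" and P: "prime_of A P"
  shows "prime_of A {f \<in> A. \<forall>c. restr (\<lambda>v. h v = c) f \<in> P}" (is "prime_of A ?P")
    "{f \<in> A. \<forall>c. restr (\<lambda>v. h v = c) f \<in> P} \<subseteq> P"
proof -
  note PD = ideal_ofD[OF prime_ofD(1)[OF P]]
  have h0: "h 0 = 0" using h[of 0 0] by simp
  show "?P \<subseteq> P"
  proof
    fix f assume f: "f \<in> ?P"
    have "(\<Sum>c\<in>h ` keys f. restr (\<lambda>v. h v = c) f) \<in> P"
      by (rule ideal_of_sum[OF prime_ofD(1)[OF P]]) (use f in auto)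
    then show "f \<in> P" by (simp only: restr_decomp[of f h, symmetric])
  qed
  have id: "ideal_of A ?P"
    unfolding ideal_of_def
  proof (intro conjI ballI)
    show "?P \<subseteq> A" "0 \<in> ?P" using AD(1) PD(2) by auto
    show "x + y \<in> ?P" if "x \<in> ?P" "y \<in> ?P" for x y
      using that AD(3) PD(3) by (auto simp: restr_add)
    fix g f assume g: "g \<in> A" and f: "f \<in> ?P"
    have "restr (\<lambda>v. h v = c) (g * f) \<in> P" for c
    proof -
      have "g * f = (\<Sum>u\<in>keys g. Poly_Mapping.single u (lookup g u) * f)"
        by (subst (1) sum_single_lookup[of g]) (simp add: sum_distrib_right)
      then have "restr (\<lambda>v. h v = c) (g * f)
          = (\<Sum>u\<in>keys g. Poly_Mapping.single u (lookup g u) * restr (\<lambda>v. h v = c - h u) f)"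
        by (simp add: restr_sum restr_single_mult[of h, OF h])
      also have "\<dots> \<in> P"
        using g f by (intro ideal_of_sum[OF prime_ofD(1)[OF P]] PD(4)) (auto simp: A_iff)
      finally show ?thesis .
    qed
    then show "g * f \<in> ?P" using AD(4)[OF g] f by auto
  qed
  show "prime_of A ?P"
    unfolding prime_of_def
  proof (intro conjI ballI impI id)
    show "1 \<notin> ?P" using \<open>?P \<subseteq> P\<close> prime_ofD(2)[OF P] by blast
    fix f g assume fg: "f \<in> A" "g \<in> A" "f * g \<in> ?P"
    have low: "\<exists>c. restr (\<lambda>v. h v = c) f \<notin> P \<and> restr (\<lambda>v. h v < c) f \<in> ?P"
      if f: "f \<in> A" "f \<notin> ?P" for f
    proof -
      let ?D = "{c. restr (\<lambda>v. h v = c) f \<notin> P}"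
      have "?D \<subseteq> h ` keys f"
      proof (rule ccontr)
        assume "\<not> ?D \<subseteq> h ` keys f"
        then obtain c where c: "restr (\<lambda>v. h v = c) f \<notin> P" "c \<notin> h ` keys f" by blast
        then have "restr (\<lambda>v. h v = c) f = 0" by (intro restr_eq_0) auto
        then show False using c PD(2) by simp
      qed
      then have fin: "finite ?D" by (rule finite_subset) simp
      have ne: "?D \<noteq> {}" using f by auto
      define c where "c = Min ?D"
      have "c \<in> ?D" unfolding c_def using fin ne by (rule Min_in)
      moreover have "restr (\<lambda>v. h v < c) f \<in> ?P"
      proof -
        have "restr (\<lambda>v. h v = d) (restr (\<lambda>v. h v < c) f) \<in> P" for d
        proof (cases "d < c")
          case True
          then have "d \<notin> ?D" using Min_le[OF fin, of d] unfolding c_def by force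
          moreover have "restr (\<lambda>v. h v = d) (restr (\<lambda>v. h v < c) f) = restr (\<lambda>v. h v = d) f"
            unfolding restr_restr using True by (intro restr_cong) auto
          ultimately show ?thesis by simp
        next
          case False
          then have "restr (\<lambda>v. h v = d) (restr (\<lambda>v. h v < c) f) = 0"
            by (intro restr_eq_0) (auto simp: keys_restr)
          then show ?thesis using PD(2) by simp
        qed
        then show ?thesis using A_restr[OF f(1)] by blast
      qed
      ultimately show ?thesis by blast
    qed
    show "f \<in> ?P \<or> g \<in> ?P"
    proof (rule ccontr)
      assume "\<not> (f \<in> ?P \<or> g \<in> ?P)"
      then obtain c d where c: "restr (\<lambda>v. h v = c) f \<notin> P" "restr (\<lambda>v. h v < c) f \<in> ?P"
        and d: "restr (\<lambda>v. h v = d) g \<notin> P" "restr (\<lambda>v. h v < d) g \<in> ?P" 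
        using low fg by meson
      define f1 g1 where "f1 = restr (\<lambda>v. h v < c) f" and "g1 = restr (\<lambda>v. h v < d) g"
      define f2 g2 where "f2 = restr (\<lambda>v. \<not> h v < c) f" and "g2 = restr (\<lambda>v. \<not> h v < d) g"
      have f: "f = f1 + f2" unfolding f1_def f2_def by (rule restr_split)
      have g: "g = g1 + g2" unfolding g1_def g2_def by (rule restr_split)
      have A2: "f2 \<in> A" "g2 \<in> A" unfolding f2_def g2_def using fg A_restr by auto
      \<comment> \<open>Cutting off the low parts changes the product only by an element of the
        homogeneous ideal. What remains starts in degrees \<open>c\<close> and \<open>d\<close>, so
        its part of degree \<open>c + d\<close> is the product of two elements outside
        \<open>P\<close>.\<close>
      have "f2 * g2 = f * g - (g * f1 + f2 * g1)" unfolding f g by (simp add: algebra_simps)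
      also have "\<dots> \<in> ?P"
        by (intro ideal_of_diff[OF subring_A id fg(3)] ideal_ofD(3,4)[OF id])
          (use fg A2 c d in \<open>auto simp: f1_def g1_def\<close>)
      finally have "restr (\<lambda>v. h v = c + d) (f2 * g2) \<in> P" by blast
      moreover have "restr (\<lambda>v. h v = c + d) (f2 * g2)
          = restr (\<lambda>v. h v = c) f2 * restr (\<lambda>v. h v = d) g2"
        by (rule restr_mult_low[OF h]) (auto simp: f2_def g2_def keys_restr)
      moreover have "restr (\<lambda>v. h v = c) f2 = restr (\<lambda>v. h v = c) f"
        "restr (\<lambda>v. h v = d) g2 = restr (\<lambda>v. h v = d) g"
        unfolding f2_def g2_def restr_restr by (auto intro!: restr_cong)
      ultimately have "restr (\<lambda>v. h v = c) f * restr (\<lambda>v. h v = d) g \<in> P" by simp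
      then show False using c(1) d(1) prime_ofD(3)[OF P A_restr[OF fg(1)] A_restr[OF fg(2)]] by blast
    qed
  qed
qed

end

section \<open>Height one primes and their homogeneity\<close>

locale height_one_prime = semigroup_ring +
  fixes P
  assumes P: "prime_of A P" and nonzero: "P \<noteq> {0}"
    and height: "\<And>Q. prime_of A Q \<Longrightarrow> Q \<subset> P \<Longrightarrow> Q = {0}"
begin

lemmas PD = ideal_ofD[OF prime_ofD(1)[OF P]]

text \<open>The homogeneous core of \<open>P\<close> is a prime inside \<open>P\<close>. The
  homogeneous element \<open>f\<close> keeps it nonzero, so height one makes it all of
  \<open>P\<close>.\<close>

lemma homogeneous:
  fixes h :: "'a \<Rightarrow> 'g::linordered_ab_group_add"
  assumes h: "\<And>a b. h (a + b) = h a + h b"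
    and f: "f \<in> P" "f \<noteq> 0" "\<And>v. v \<in> keys f \<Longrightarrow> h v = c" and g: "g \<in> P"
  shows "restr (\<lambda>v. h v = d) g \<in> P"
proof -
  let ?P = "{f \<in> A. \<forall>c. restr (\<lambda>v. h v = c) f \<in> P}"
  have "restr (\<lambda>v. h v = d) f \<in> P" for d
  proof (cases "d = c")
    case True
    then have "restr (\<lambda>v. h v = d) f = f" using f(3) by (intro restr_id) auto
    then show ?thesis using f(1) by simp
  next
    case False
    then have "restr (\<lambda>v. h v = d) f = 0" using f(3) by (intro restr_eq_0) auto
    then show ?thesis using PD(2) by simp
  qed
  then have "f \<in> ?P" using f(1) PD(1) by blast
  then have "?P \<noteq> {0}" using f(2) by blast
  then have "?P = P"
    using height[OF prime_of_homogeneous(1)[of h, OF h P]] prime_of_homogeneous(2)[of h, OF h P] by blast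
  then show ?thesis using g by blast
qed

text \<open>Membership of \<open>f\<close> in the ideal generated by \<open>p\<close> in the
  localization at \<open>P\<close>, with the denominator cleared.\<close>

definition quasi_multiple where
  "quasi_multiple p f \<longleftrightarrow> f \<in> A \<and> (\<exists>b\<in>A - P. \<exists>c\<in>A. b * f = p * c)"

lemma mult_notin_P: "a \<in> A - P \<Longrightarrow> b \<in> A - P \<Longrightarrow> a * b \<in> A - P"
  using prime_ofD(3)[OF P] AD(4) by blast

lemma one_notin_P: "1 \<in> A - P"
  using AD(2) prime_ofD(2)[OF P] by blast

lemma quasi_multiple_0: "quasi_multiple p 0"
  unfolding quasi_multiple_def using one_notin_P AD(1) by (intro conjI bexI[of _ 1] bexI[of _ 0]) auto

lemma quasi_multiple_add:
  assumes "quasi_multiple p f" "quasi_multiple p g"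
  shows "quasi_multiple p (f + g)"
proof -
  obtain b c b' c' where *: "f \<in> A" "g \<in> A" "b \<in> A - P" "c \<in> A" "b * f = p * c" "b' \<in> A - P" "c' \<in> A" "b' * g = p * c'"
    using assms unfolding quasi_multiple_def by blast
  have "(b * b') * (f + g) = b' * (b * f) + b * (b' * g)" by (simp add: algebra_simps)
  also have "\<dots> = p * (b' * c + b * c')" unfolding *(5,8) by (simp add: algebra_simps)
  finally show ?thesis
    unfolding quasi_multiple_def using mult_notin_P[OF *(3,6)] AD(3,4) * by blast
qed

lemma quasi_multiple_sum:
  assumes "\<And>i. i \<in> X \<Longrightarrow> quasi_multiple p (f i)"
  shows "quasi_multiple p (sum f X)"
  using assms by (induction X rule: infinite_finite_induct) (auto simp: quasi_multiple_0 quasi_multiple_add)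

lemma quasi_multiple_mult:
  assumes "quasi_multiple p f" "a \<in> A"
  shows "quasi_multiple p (a * f)"
proof -
  obtain b c where *: "f \<in> A" "b \<in> A - P" "c \<in> A" "b * f = p * c"
    using assms unfolding quasi_multiple_def by blast
  then have "b * (a * f) = p * (a * c)" by (metis mult.left_commute)
  then show ?thesis unfolding quasi_multiple_def using * AD(4) assms(2) by blast
qed

text \<open>Exponents are totally ordered, so the identity is itself an admissible grading, and
  monomials are homogeneous for it. Once \<open>P\<close> contains a monomial it contains every term
  of its elements.\<close>

lemma monomial_prime:
  assumes "Poly_Mapping.single u 1 \<in> P" and f: "f \<in> P" "v \<in> keys f"
  shows "Poly_Mapping.single v 1 \<in> P"
proof -
  have "restr (\<lambda>w. w = v) f \<in> P"
  proof (rule homogeneous[of "\<lambda>v. v", OF _ assms(1)])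
    show "Poly_Mapping.single u (1::'b) \<noteq> 0" by (metis lookup_single_eq lookup_zero zero_neq_one)
  qed (use f in auto)
  then have "Poly_Mapping.single 0 (inverse (lookup f v)) * Poly_Mapping.single v (lookup f v) \<in> P"
    by (intro PD(4)) (auto simp: restr_eq_single A_iff S0)
  then show ?thesis using f(2) by (simp add: mult_single in_keys_iff)
qed

end


section \<open>Height one primes without monomials\<close>

definition head :: "nat \<Rightarrow> (nat \<Rightarrow>\<^sub>0 int) \<Rightarrow> (nat \<Rightarrow>\<^sub>0 int)" where
  "head i v = restr (\<lambda>j. j < i) v"

lemma head_add: "head i (v + w) = head i v + head i w"
  by (simp add: head_def restr_add)

lemma head_Suc_eqI:
  assumes "head i v = head i w" "lookup v i = lookup w i"
  shows "head (Suc i) v = head (Suc i) w"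
proof (rule poly_mapping_eqI)
  fix j
  have "lookup (head i v) j = lookup (head i w) j" using assms by simp
  then show "lookup (head (Suc i) v) j = lookup (head (Suc i) w) j"
    using assms(2) by (cases "j = i") (auto simp: head_def lookup_restr less_Suc_eq)
qed

locale height_one_prime_no_monomial = height_one_prime S A P
  for S :: "(nat \<Rightarrow>\<^sub>0 int) set" and A :: "((nat \<Rightarrow>\<^sub>0 int) \<Rightarrow>\<^sub>0 'k::field) set" and P +
  fixes N :: nat
  assumes no_monomial: "\<And>v. Poly_Mapping.single v 1 \<notin> P"
    and bound: "\<And>v i. v \<in> S \<Longrightarrow> i \<in> keys v \<Longrightarrow> i < N"
begin

text \<open>Homogeneity for the grading by the first \<open>i\<close> coordinates. The degree
  \<open>head i v\<close> is again an exponent vector, so the order on exponents also orders the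
  degrees.\<close>

definition head_const :: "nat \<Rightarrow> ((nat \<Rightarrow>\<^sub>0 int) \<Rightarrow>\<^sub>0 'k) \<Rightarrow> bool" where
  "head_const i f \<longleftrightarrow> (\<exists>c. \<forall>v\<in>keys f. head i v = c)"

text \<open>For \<open>i = 0\<close> homogeneity is no restriction. For \<open>i = N\<close> a
  nonzero homogeneous element is a single term and would put a monomial into \<open>P\<close>. So
  the property is lost at some step in between.\<close>

lemma exists_level:
  "\<exists>i. (\<exists>f\<in>P. f \<noteq> 0 \<and> head_const i f) \<and> (\<forall>f\<in>P. head_const (Suc i) f \<longrightarrow> f = 0)"
proof (rule ccontr)
  assume no: "\<not> ?thesis"
  have "\<exists>f\<in>P. f \<noteq> 0 \<and> head_const i f" for i
  proof (induction i)
    case 0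
    obtain f where "f \<in> P" "f \<noteq> 0" using nonzero PD(2) by auto
    moreover have "head_const 0 f"
      unfolding head_const_def head_def by (rule exI[of _ 0]) (auto intro: restr_eq_0)
    ultimately show ?case by blast
  next
    case (Suc i)
    then show ?case using no by blast
  qed
  then obtain f c where f: "f \<in> P" "f \<noteq> 0" "\<And>v. v \<in> keys f \<Longrightarrow> head N v = c"
    unfolding head_const_def by blast
  have "head N v = v" if "v \<in> keys f" for v
    unfolding head_def using that f(1) PD(1) bound by (intro restr_id) (auto simp: A_iff)
  then have "keys f \<subseteq> {c}" using f(3) by auto
  moreover have "keys f \<noteq> {}" using f(2) by auto
  ultimately have keys: "keys f = {c}" by blast
  have "f = Poly_Mapping.single c (lookup f c)"
    using sum_single_lookup[of f] keys by simp
  moreover have "Poly_Mapping.single 0 (inverse (lookup f c)) * f \<in> P"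
    using PD(4)[OF A_single[OF S0] f(1)] .
  ultimately have "Poly_Mapping.single c (inverse (lookup f c) * lookup f c) \<in> P"
    by (metis add_0 mult_single)
  moreover have "lookup f c \<noteq> 0" using keys by (auto simp: in_keys_iff)
  ultimately show False using no_monomial[of c] by simp
qed

definition width_le :: "nat \<Rightarrow> nat \<Rightarrow> ((nat \<Rightarrow>\<^sub>0 int) \<Rightarrow>\<^sub>0 'k) \<Rightarrow> int \<Rightarrow> bool" where
  "width_le i w f a \<longleftrightarrow> (\<forall>v\<in>keys f. a \<le> lookup v i \<and> lookup v i \<le> a + int w) \<and> (\<exists>v\<in>keys f. lookup v i = a)"

lemma exists_width_le:
  assumes "f \<noteq> 0" "\<And>v. v \<in> keys f \<Longrightarrow> b \<le> lookup v i \<and> lookup v i \<le> b + int k"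
  shows "\<exists>w\<le>k. \<exists>a\<ge>b. a + int w \<le> b + int k \<and> width_le i w f a"
proof -
  let ?X = "(\<lambda>v. lookup v i) ` keys f"
  define a where "a = Min ?X"
  have fin: "finite ?X" "?X \<noteq> {}" using assms(1) by auto
  have "a \<in> ?X" unfolding a_def using fin by (rule Min_in)
  then obtain v where v: "v \<in> keys f" "lookup v i = a" by auto
  have "a \<le> lookup v i" if "v \<in> keys f" for v unfolding a_def using that fin by (intro Min_le) auto
  then have "width_le i (nat (b + int k - a)) f a"
    unfolding width_le_def using v assms(2) by (auto simp: ball_conj_distrib)
  moreover have "a \<ge> b" "a \<le> b + int k" using assms(2)[OF v(1)] v(2) by auto
  ultimately show ?thesis
    by (intro exI[of _ "nat (b + int k - a)"] conjI exI[of _ a]) auto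
qed

lemma exists_width_le':
  assumes "f \<noteq> 0"
  shows "\<exists>w a. width_le i w f a"
proof -
  let ?X = "(\<lambda>v. lookup v i) ` keys f"
  have fin: "finite ?X" by auto
  obtain v where v: "v \<in> keys f" using assms by (metis keys_eq_empty all_not_in_conv)
  have "Min ?X \<le> lookup v i \<and> lookup v i \<le> Min ?X + int (nat (Max ?X - Min ?X))" if "v \<in> keys f" for v
  proof -
    have "Min ?X \<le> lookup v i" "lookup v i \<le> Max ?X" using that fin by (auto intro: Min_le Max_ge)
    then show ?thesis by auto
  qed
  then show ?thesis using exists_width_le[OF assms] by blast
qed

text \<open>Choose the first level \<open>i\<close> such that \<open>P\<close> is homogeneous for the first \<open>i\<close> coordinates but contains
  no nonzero element homogeneous for \<open>i + 1\<close> coordinates. Pseudo-division in the remaining coordinate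
  by an element of minimal width only multiplies by elements outside \<open>P\<close>.\<close>

lemma exists_generator: "\<exists>p\<in>P. \<forall>f\<in>P. quasi_multiple p f"
proof -
  obtain i f0 where i: "f0 \<in> P" "f0 \<noteq> 0" "head_const i f0" "\<And>f. f \<in> P \<Longrightarrow> head_const (Suc i) f \<Longrightarrow> f = 0"
    using exists_level by blast
  let ?W = "\<lambda>w. \<exists>f a. f \<in> P \<and> head_const i f \<and> width_le i w f a"
  define w where "w = (LEAST w. ?W w)"
  obtain w0 a0 where "width_le i w0 f0 a0" using exists_width_le'[OF i(2)] by blast
  then have "?W w0" using i(1,3) by blast
  then have "?W w" unfolding w_def by (rule LeastI)
  then obtain p a where p: "p \<in> P" "head_const i p" "width_le i w p a" by blast
  have w_le: "w \<le> w'" if "?W w'" for w' unfolding w_def using that by (rule Least_le)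
  define bot :: "int \<Rightarrow> ((nat \<Rightarrow>\<^sub>0 int) \<Rightarrow>\<^sub>0 'k) \<Rightarrow> ((nat \<Rightarrow>\<^sub>0 int) \<Rightarrow>\<^sub>0 'k)"
    where "bot = (\<lambda>a. restr (\<lambda>v. lookup v i = a))"
  \<comment> \<open>The lowest coefficient in coordinate \<open>i\<close> is homogeneous even for
    \<open>i + 1\<close> coordinates, so by the choice of \<open>i\<close> it lies outside
    \<open>P\<close> and is an admissible multiplier.\<close>
  have bot: "bot a f \<in> A - P" if "f \<in> P" "head_const i f" "width_le i k f a" for f a k
  proof -
    have "head_const (Suc i) (bot a f)"
      using that(2) unfolding head_const_def bot_def keys_restr by (metis (mono_tags, lifting) head_Suc_eqI mem_Collect_eq)
    moreover have "bot a f \<noteq> 0"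
      using that(3) unfolding width_le_def bot_def by (metis (mono_tags, lifting) empty_iff keys_restr keys_zero mem_Collect_eq)
    ultimately show ?thesis using i(4) A_restr PD(1)[OF that(1)] unfolding bot_def by blast
  qed
  have homog: "quasi_multiple p g" if "g \<in> P" "head_const i g" "width_le i k g b" for g b k
    using that
  proof (induction k arbitrary: g b rule: less_induct)
    case (less k)
    note g = less.prems
    \<comment> \<open>The lowest coefficients in coordinate \<open>i\<close> cancel in degree
      \<open>a + b\<close>. Since \<open>w \<le> k\<close>, no degree above \<open>a + b + k\<close>
      appears, so either \<open>g'\<close> is 0 or its spread is at most
      \<open>k - 1\<close>.\<close>
    define g' where "g' = g * bot a p - p * bot b g"
    have wk: "w \<le> k" using w_le g by blast
    have bp: "bot a p \<in> A - P" "bot b g \<in> A - P" using bot p g by blast+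
    have g'P: "g' \<in> P"
      unfolding g'_def by (rule ideal_of_diff[OF subring_A prime_ofD(1)[OF P]]) (use g p bp PD(5) in auto)
    have keys_g': "\<exists>x y. v = x + y \<and> x \<in> keys g \<and> y \<in> keys p \<and> (lookup y i = a \<or> lookup x i = b)" if "v \<in> keys g'" for v
    proof -
      have "v \<in> keys (g * bot a p) \<or> v \<in> keys (p * bot b g)"
        using that keys_diff[of "g * bot a p" "p * bot b g"] unfolding g'_def by blast
      then show ?thesis
      proof
        assume "v \<in> keys (g * bot a p)"
        then obtain x y where "v = x + y" "x \<in> keys g" "y \<in> keys (bot a p)" by (rule keys_multE)
        then show ?thesis by (auto simp: bot_def keys_restr)
      next
        assume "v \<in> keys (p * bot b g)"
        then obtain x y where "v = x + y" "x \<in> keys p" "y \<in> keys (bot b g)" by (rule keys_multE)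
        then have "v = y + x \<and> y \<in> keys g \<and> x \<in> keys p \<and> (lookup x i = a \<or> lookup y i = b)"
          by (simp add: bot_def keys_restr add.commute)
        then show ?thesis by blast
      qed
    qed
    have "head_const i g'"
    proof -
      obtain c d where c: "\<And>v. v \<in> keys g \<Longrightarrow> head i v = c" and d: "\<And>v. v \<in> keys p \<Longrightarrow> head i v = d"
        using g(2) p(2) unfolding head_const_def by blast
      have "head i v = c + d" if v: "v \<in> keys g'" for v
        using keys_g'[OF v] by (auto simp: head_add c d)
      then show ?thesis unfolding head_const_def by blast
    qed
    have low: "restr (\<lambda>v. lookup v i = b + a) g' = 0"
    proof -
      have "restr (\<lambda>v. lookup v i = b + a) (g * bot a p)
          = restr (\<lambda>v. lookup v i = b) g * restr (\<lambda>v. lookup v i = a) (bot a p)"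
        by (rule restr_mult_low) (use g in \<open>auto simp: lookup_add bot_def keys_restr width_le_def\<close>)
      moreover have "restr (\<lambda>v. lookup v i = a + b) (p * bot b g)
          = restr (\<lambda>v. lookup v i = a) p * restr (\<lambda>v. lookup v i = b) (bot b g)"
        by (rule restr_mult_low) (use p in \<open>auto simp: lookup_add bot_def keys_restr width_le_def\<close>)
      moreover have "restr (\<lambda>v. lookup v i = a) (bot a p) = restr (\<lambda>v. lookup v i = a) p"
        "restr (\<lambda>v. lookup v i = b) (bot b g) = restr (\<lambda>v. lookup v i = b) g"
        by (auto simp: bot_def restr_restr)
      ultimately show ?thesis
        unfolding g'_def restr_diff by (simp only: add.commute[of b a] mult.commute diff_self)
    qed
    have "quasi_multiple p g'"
    proof (cases "g' = 0")
      case True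
      then show ?thesis by (simp add: quasi_multiple_0)
    next
      case False
      have range: "a + b + 1 \<le> lookup v i \<and> lookup v i \<le> a + b + int k" if v: "v \<in> keys g'" for v
      proof -
        have "lookup v i \<noteq> b + a"
        proof
          assume "lookup v i = b + a"
          then have "v \<in> keys (restr (\<lambda>v. lookup v i = b + a) g')" using v by (simp add: keys_restr)
          then show False using low by simp
        qed
        then show ?thesis
          using keys_g'[OF v] g(3) p(3) wk by (fastforce simp: width_le_def lookup_add)
      qed
      obtain v0 where "v0 \<in> keys g'" using False by (metis keys_eq_empty all_not_in_conv)
      from range[OF this] have "k > 0" by linarith
      have "a + b + 1 \<le> lookup v i \<and> lookup v i \<le> a + b + 1 + int (k - 1)" if "v \<in> keys g'" for v
        using range[OF that] \<open>k > 0\<close> by linarith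
      then have "\<exists>w'\<le>k - 1. \<exists>c\<ge>a + b + 1. c + int w' \<le> a + b + 1 + int (k - 1) \<and> width_le i w' g' c"
        by (rule exists_width_le[OF False])
      then obtain w' c where "w' \<le> k - 1" "width_le i w' g' c" by blast
      then show ?thesis using less.IH[OF _ g'P \<open>head_const i g'\<close>, of w' c] \<open>k > 0\<close> by linarith
    qed
    then obtain b' c' where b': "b' \<in> A - P" "c' \<in> A" "b' * g' = p * c'"
      unfolding quasi_multiple_def by blast
    have "(b' * bot a p) * g = b' * g' + p * (b' * bot b g)"
      unfolding g'_def by (simp add: right_diff_distrib mult.assoc mult.left_commute mult.commute)
    also have "\<dots> = p * (c' + b' * bot b g)" unfolding b'(3) by (simp add: distrib_left)
    finally have eq: "(b' * bot a p) * g = p * (c' + b' * bot b g)" .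
    have "b' * bot a p \<in> A - P" using mult_notin_P[OF b'(1) bp(1)] .
    moreover have "c' + b' * bot b g \<in> A" using b' bp by (intro AD(3) AD(4)) auto
    ultimately show ?case
      unfolding quasi_multiple_def using eq PD(1)[OF g(1)] by blast
  qed
  have "quasi_multiple p f" if f: "f \<in> P" for f
  proof -
    obtain c0 where c0: "\<And>v. v \<in> keys f0 \<Longrightarrow> head i v = c0" using i(3) unfolding head_const_def by blast
    have "quasi_multiple p (restr (\<lambda>v. head i v = c) f)" for c
    proof (cases "restr (\<lambda>v. head i v = c) f = 0")
      case True
      then show ?thesis by (simp add: quasi_multiple_0)
    next
      case False
      then obtain k b where "width_le i k (restr (\<lambda>v. head i v = c) f) b" using exists_width_le' by blast
      moreover have "restr (\<lambda>v. head i v = c) f \<in> P"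
        by (rule homogeneous[of "head i", OF head_add i(1,2) c0 f])
      moreover have "head_const i (restr (\<lambda>v. head i v = c) f)" unfolding head_const_def by (auto simp: keys_restr)
      ultimately show ?thesis using homog by blast
    qed
    then show ?thesis by (subst restr_decomp[of f "head i"]) (rule quasi_multiple_sum)
  qed
  then show ?thesis using p(1) by blast
qed

end

section \<open>Edge monoids and Gordan's theorem\<close>

definition lin :: "(nat \<Rightarrow> int) \<Rightarrow> (nat \<Rightarrow>\<^sub>0 int) \<Rightarrow> int" where
  "lin y v = (\<Sum>i\<in>keys v. y i * lookup v i)"

lemma lin_superset: "finite X \<Longrightarrow> keys v \<subseteq> X \<Longrightarrow> lin y v = (\<Sum>i\<in>X. y i * lookup v i)"
  unfolding lin_def by (rule sum.mono_neutral_left) (auto simp: in_keys_iff)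

lemma lin_add: "lin y (v + w) = lin y v + lin y w"
proof -
  have "lin y (v + w) = (\<Sum>i\<in>keys v \<union> keys w. y i * lookup (v + w) i)"
    by (rule lin_superset) (use keys_add[of v w] in auto)
  also have "\<dots> = (\<Sum>i\<in>keys v \<union> keys w. y i * lookup v i) + (\<Sum>i\<in>keys v \<union> keys w. y i * lookup w i)"
    by (simp add: lookup_add distrib_left sum.distrib)
  also have "\<dots> = lin y v + lin y w"
    using lin_superset[of "keys v \<union> keys w" v y] lin_superset[of "keys v \<union> keys w" w y] by simp
  finally show ?thesis .
qed

lemma lin_0 [simp]: "lin y 0 = 0" by (simp add: lin_def)

lemma lin_uminus: "lin y (- v) = - lin y v"
  using lin_add[of y v "- v"] by simp

lemma lin_diff: "lin y (v - w) = lin y v - lin y w"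
  using lin_add[of y v "- w"] by (simp add: lin_uminus)

lemma lin_unitv [simp]: "lin y (unitv i) = y i"
  by (simp add: lin_def unitv_def)

lemma lin_frag_cmul: "lin y (frag_cmul c v) = c * lin y v"
  using lin_superset[of "keys v" "frag_cmul c v" y] keys_cmul[of c v]
  by (simp add: lin_def sum_distrib_left mult.left_commute)

lemma lin_combine: "lin (\<lambda>i. a * y i + b * z i) v = a * lin y v + b * lin z v"
  by (simp add: lin_def sum.distrib sum_distrib_left algebra_simps)

fun ends :: "edge \<Rightarrow> nat set" where
  "ends (Sgn s i j) = {i, j}"
| "ends (Dir i j) = {i, j}"

lemma lin_rho:
  "lin y (rho (Sgn s i j)) = (if s then y i + y j else - (y i + y j))"
  "lin y (rho (Dir i j)) = y j - y i"
  by (cases s; simp add: lin_add lin_uminus lin_diff)+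

section \<open>The monoid and the group generated by the edges\<close>

inductive_set edge_monoid :: "edge set \<Rightarrow> (nat \<Rightarrow>\<^sub>0 int) set" for E where
  edge_monoid_0: "0 \<in> edge_monoid E"
| edge_monoid_step: "e \<in> E \<Longrightarrow> v \<in> edge_monoid E \<Longrightarrow> rho e + v \<in> edge_monoid E"

lemma edge_monoid_add: "v \<in> edge_monoid E \<Longrightarrow> w \<in> edge_monoid E \<Longrightarrow> v + w \<in> edge_monoid E"
  by (induction v rule: edge_monoid.induct) (auto simp: add.assoc intro: edge_monoid.intros)

lemma edge_monoid_rho: "e \<in> E \<Longrightarrow> rho e \<in> edge_monoid E"
  using edge_monoid_step[OF _ edge_monoid_0] by simp

lemma edge_monoid_mono: "H \<subseteq> E \<Longrightarrow> edge_monoid H \<subseteq> edge_monoid E"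
proof
  fix v assume "v \<in> edge_monoid H" "H \<subseteq> E"
  then show "v \<in> edge_monoid E" by (induction v rule: edge_monoid.induct) (auto intro: edge_monoid.intros)
qed

text \<open>Kept as differences, since a congruence modulo this group is used by moving
  \<open>a\<close> and \<open>b\<close> to opposite sides, which turns it into an identity between
  monomials of the ring.\<close>

definition edge_group :: "edge set \<Rightarrow> (nat \<Rightarrow>\<^sub>0 int) set" where
  "edge_group E = {a - b | a b. a \<in> edge_monoid E \<and> b \<in> edge_monoid E}"

lemma edge_groupI: "a \<in> edge_monoid E \<Longrightarrow> b \<in> edge_monoid E \<Longrightarrow> a - b \<in> edge_group E"
  by (auto simp: edge_group_def)

lemma edge_monoid_gp: "a \<in> edge_monoid E \<Longrightarrow> a \<in> edge_group E"
  using edge_groupI[OF _ edge_monoid_0] by simp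

lemma edge_group_0: "0 \<in> edge_group E"
  by (rule edge_monoid_gp[OF edge_monoid_0])

lemma edge_group_diff:
  assumes "v \<in> edge_group E" "w \<in> edge_group E"
  shows "v - w \<in> edge_group E"
proof -
  obtain a b c d where "v = a - b" "w = c - d" "a \<in> edge_monoid E" "b \<in> edge_monoid E" "c \<in> edge_monoid E" "d \<in> edge_monoid E"
    using assms unfolding edge_group_def by blast
  then have "v - w = (a + d) - (b + c)" "a + d \<in> edge_monoid E" "b + c \<in> edge_monoid E"
    by (auto intro: edge_monoid_add)
  then show ?thesis using edge_groupI by metis
qed

lemma edge_group_uminus: "v \<in> edge_group E \<Longrightarrow> - v \<in> edge_group E"
  using edge_group_diff[OF edge_group_0] by fastforce

lemma edge_group_add: "v \<in> edge_group E \<Longrightarrow> w \<in> edge_group E \<Longrightarrow> v + w \<in> edge_group E"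
  using edge_group_diff[OF _ edge_group_uminus] by fastforce

lemma edge_group_rho: "e \<in> E \<Longrightarrow> rho e \<in> edge_group E"
  by (rule edge_monoid_gp[OF edge_monoid_rho])

lemma edge_group_frag_cmul:
  assumes "v \<in> edge_group E"
  shows "frag_cmul c v \<in> edge_group E"
proof -
  have nat: "frag_cmul (int k) v \<in> edge_group E" for k
  proof (induction k)
    case (Suc k)
    then have "v + frag_cmul (int k) v \<in> edge_group E" by (rule edge_group_add[OF assms])
    then show ?case using frag_cmul_distrib[of 1 "int k" v] by simp
  qed (simp add: edge_group_0)
  show ?thesis
  proof (cases "c \<ge> 0")
    case True
    then show ?thesis using nat[of "nat c"] by simp
  next
    case False
    then show ?thesis using edge_group_uminus[OF nat[of "nat (- c)"]] by simp
  qed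
qed

lemma edge_group_sum: "(\<And>i. i \<in> X \<Longrightarrow> f i \<in> edge_group E) \<Longrightarrow> sum f X \<in> edge_group E"
  by (induction X rule: infinite_finite_induct) (auto simp: edge_group_0 edge_group_add)

lemma lin_mon_zero:
  assumes "\<And>e. e \<in> E \<Longrightarrow> lin y (rho e) = 0" "v \<in> edge_monoid E"
  shows "lin y v = 0"
  using assms(2) by (induction v rule: edge_monoid.induct) (auto simp: lin_add assms(1))

lemma lin_gp_zero:
  assumes "\<And>e. e \<in> E \<Longrightarrow> lin y (rho e) = 0" "v \<in> edge_group E"
  shows "lin y v = 0"
  using assms lin_mon_zero[of E y] unfolding edge_group_def by (auto simp: lin_diff)

lemma lin_mon_nonneg:
  assumes "\<And>e. e \<in> E \<Longrightarrow> 0 \<le> lin y (rho e)" "v \<in> edge_monoid E"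
  shows "0 \<le> lin y v"
  using assms(2) by (induction v rule: edge_monoid.induct) (auto simp: lin_add assms(1))

lemma lin_mon_face:
  assumes "\<And>e. e \<in> E \<Longrightarrow> 0 \<le> lin y (rho e)" "v \<in> edge_monoid E" "lin y v = 0"
  shows "v \<in> edge_monoid {e \<in> E. lin y (rho e) = 0}"
  using assms(2,3)
proof (induction v rule: edge_monoid.induct)
  case (edge_monoid_step e v)
  then have "lin y (rho e) = 0" "lin y v = 0"
    using assms(1) lin_mon_nonneg[of E y v, OF assms(1)] by (fastforce simp: lin_add)+
  then show ?case using edge_monoid_step by (auto intro: edge_monoid.edge_monoid_step)
qed (rule edge_monoid.edge_monoid_0)

lemma edge_ring_eq_sring: "edge_ring E = (sring (edge_monoid E) :: ((nat \<Rightarrow>\<^sub>0 int) \<Rightarrow>\<^sub>0 'k::field) set)"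
proof (intro equalityI subsetI)
  fix p :: "(nat \<Rightarrow>\<^sub>0 int) \<Rightarrow>\<^sub>0 'k" assume "p \<in> edge_ring E"
  then show "p \<in> sring (edge_monoid E)"
  proof induction
    case (add p q)
    then show ?case using keys_add[of p q] by (auto simp: sring_def)
  next
    case (mult p q)
    then show ?case by (auto simp: sring_def elim!: keys_multE intro: edge_monoid_add)
  qed (auto simp: sring_def edge_monoid_0 edge_monoid_rho)
next
  fix p :: "(nat \<Rightarrow>\<^sub>0 int) \<Rightarrow>\<^sub>0 'k" assume p: "p \<in> sring (edge_monoid E)"
  have single: "Poly_Mapping.single v (1::'k) \<in> edge_ring E" if "v \<in> edge_monoid E" for v
    using that
  proof induction
    case edge_monoid_0
    show ?case by (rule edge_ring.const)
  next
    case (edge_monoid_step e v)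
    then have "Poly_Mapping.single (rho e) (1::'k) * Poly_Mapping.single v 1 \<in> edge_ring E"
      by (intro edge_ring.mult edge_ring.gen)
    then show ?case by (simp add: mult_single)
  qed
  have "Poly_Mapping.single v (lookup p v) \<in> edge_ring E" if "v \<in> keys p" for v
  proof -
    have "Poly_Mapping.single 0 (lookup p v) * Poly_Mapping.single v 1 \<in> edge_ring E"
      using that p by (intro edge_ring.mult edge_ring.const single) (auto simp: sring_def)
    then show ?thesis by (simp add: mult_single)
  qed
  moreover have "sum f X \<in> edge_ring E" if "\<And>i. i \<in> X \<Longrightarrow> f i \<in> edge_ring E"
    for f :: "(nat \<Rightarrow>\<^sub>0 int) \<Rightarrow> (nat \<Rightarrow>\<^sub>0 int) \<Rightarrow>\<^sub>0 'k" and X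
  proof -
    have "0 \<in> (edge_ring E :: ((nat \<Rightarrow>\<^sub>0 int) \<Rightarrow>\<^sub>0 'k) set)" using edge_ring.const[of "0::'k" E] by simp
    then show ?thesis using that
      by (induction X rule: infinite_finite_induct) (simp_all add: edge_ring.add)
  qed
  ultimately have "(\<Sum>v\<in>keys p. Poly_Mapping.single v (lookup p v)) \<in> edge_ring E" by simp
  then show "p \<in> edge_ring E" using sum_single_lookup[of p] by (rule back_subst[OF _ sym])
qed

text \<open>Only nonempty sums are allowed: the vector 0 belongs to the lattice
  \<open>edge_group H\<close>, from which the cone has to be disjoint when \<open>gordan\<close> is
  applied.\<close>

inductive_set cone :: "'a::ab_group_add set \<Rightarrow> 'a set" for A where
  cone_base: "a \<in> A \<Longrightarrow> a \<in> cone A"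
| cone_add: "a \<in> cone A \<Longrightarrow> b \<in> cone A \<Longrightarrow> a + b \<in> cone A"

lemma cone_subset: "A \<subseteq> cone B \<Longrightarrow> cone A \<subseteq> cone B"
proof
  fix x assume "x \<in> cone A" "A \<subseteq> cone B"
  then show "x \<in> cone B" by induction (auto intro: cone_add)
qed

lemma cone_frag_cmul:
  assumes "a \<in> cone A" "0 < k"
  shows "frag_cmul k a \<in> cone A"
proof -
  have "frag_cmul (int (Suc m)) a \<in> cone A" for m
  proof (induction m)
    case (Suc m)
    then have "a + frag_cmul (int (Suc m)) a \<in> cone A" by (rule cone_add[OF assms(1)])
    then show ?case using frag_cmul_distrib[of 1 "int (Suc m)" a] by simp
  qed (simp add: assms(1))
  from this[of "nat k - 1"] show ?thesis using assms(2) by simp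
qed

text \<open>Induction on the number of vectors: given \<open>y\<close> positive on all vectors but \<open>a\<close>, project the
  others along \<open>a\<close> into the kernel of \<open>y\<close>, staying inside the cone, and combine \<open>y\<close> with a functional
  positive on the projections.\<close>

lemma gordan:
  fixes Y :: "(nat \<Rightarrow> int) set" and \<Lambda> :: "(nat \<Rightarrow>\<^sub>0 int) set"
  assumes Y: "\<And>y z a b. y \<in> Y \<Longrightarrow> z \<in> Y \<Longrightarrow> (\<lambda>i. a * y i + b * z i) \<in> Y" "(\<lambda>_. 0) \<in> Y"
    and sep: "\<And>v. v \<in> X \<Longrightarrow> (\<And>y. y \<in> Y \<Longrightarrow> lin y v = 0) \<Longrightarrow> frag_cmul 2 v \<in> \<Lambda>"
    and X: "\<And>v w. v \<in> X \<Longrightarrow> w \<in> X \<Longrightarrow> v + w \<in> X" 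
    and "finite A" "A \<subseteq> X" "cone A \<inter> \<Lambda> = {}"
  shows "\<exists>y\<in>Y. \<forall>a\<in>A. 0 < lin y a"
  using assms(5-7)
proof (induction "card A" arbitrary: A rule: less_induct)
  case less
  show ?case
  proof (cases "A = {}")
    case True
    then show ?thesis using Y(2) by blast
  next
    case False
    then obtain a B where A: "A = insert a B" "a \<notin> B" by (metis all_not_in_conv mk_disjoint_insert)
    have finB: "finite B" "card B < card A" using A less.prems(1) by auto
    have BX: "B \<subseteq> X" "a \<in> X" using A less.prems by auto
    have coneX: "v \<in> X" if "v \<in> cone A" for v using that by induction (use less.prems X in auto)
    have "cone B \<subseteq> cone A" by (rule cone_subset) (use A in \<open>auto intro: cone_base\<close>)
    then have "\<exists>y\<in>Y. \<forall>a\<in>B. 0 < lin y a"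
      using less.hyps[OF finB(2) finB(1) BX(1)] less.prems(3) by blast
    then obtain y where y: "y \<in> Y" "\<And>b. b \<in> B \<Longrightarrow> 0 < lin y b" by blast
    show ?thesis
    proof (cases "0 < lin y a")
      case True
      then show ?thesis using y A by blast
    next
      case False
      define \<alpha> where "\<alpha> = - lin y a"
      have \<alpha>: "0 \<le> \<alpha>" using False by (simp add: \<alpha>_def)
      define f where "f = (\<lambda>b. frag_cmul (lin y b) a + frag_cmul \<alpha> b)"
      have fc: "f b \<in> cone A" if "b \<in> B" for b
      proof (cases "\<alpha> = 0")
        case True
        then show ?thesis
          unfolding f_def using cone_frag_cmul[OF cone_base[of a A], of "lin y b"] y(2)[OF that] A by simp
      next
        case False
        then show ?thesis
          unfolding f_def using y(2)[OF that] A \<alpha> that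
          by (intro cone_add cone_frag_cmul cone_base) auto
      qed
      have "f ` B \<subseteq> cone A" using fc by blast
      then have cf: "cone (f ` B) \<subseteq> cone A" "f ` B \<subseteq> X" using cone_subset coneX by blast+
      have "card (f ` B) < card A" using card_image_le[OF finB(1), of f] finB(2) by linarith
      then have "\<exists>z\<in>Y. \<forall>a\<in>f ` B. 0 < lin z a"
        using less.hyps[of "f ` B"] finB(1) cf less.prems(3) by blast
      then obtain z where z: "z \<in> Y" "\<And>b. b \<in> B \<Longrightarrow> 0 < lin y b * lin z a + \<alpha> * lin z b"
        by (auto simp: f_def lin_add lin_frag_cmul)
      show ?thesis
      proof (cases "\<alpha> = 0")
        case True
        \<comment> \<open>Here \<open>y\<close> vanishes at \<open>a\<close>. If there are other
          vectors, each \<open>f b\<close> is a positive multiple of \<open>a\<close> and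
          \<open>z\<close> serves. If \<open>a\<close> is alone, \<open>sep\<close> decides: were
          \<open>a\<close> killed by all of \<open>Y\<close>, twice \<open>a\<close> would lie in
          both the cone and \<open>\<Lambda>\<close>.\<close>
        have "\<exists>z\<in>Y. 0 < lin z a"
        proof (cases "B = {}")
          case True
          have "\<not> (\<forall>y\<in>Y. lin y a = 0)"
          proof
            assume "\<forall>y\<in>Y. lin y a = 0"
            then have "frag_cmul 2 a \<in> \<Lambda>" using sep BX(2) by blast
            moreover have "frag_cmul 2 a \<in> cone A" using A by (intro cone_frag_cmul cone_base) auto
            ultimately show False using less.prems(3) by blast
          qed
          then obtain u where u: "u \<in> Y" "lin u a \<noteq> 0" by blast
          have "(\<lambda>i. sgn (lin u a) * u i + 0 * u i) \<in> Y" using Y(1)[OF u(1) u(1)] .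
          moreover have "0 < lin (\<lambda>i. sgn (lin u a) * u i + 0 * u i) a"
            unfolding lin_combine using u(2) by (simp add: sgn_if)
          ultimately show ?thesis by blast
        next
          case False
          then obtain b where "b \<in> B" by blast
          then have "0 < lin y b * lin z a" "0 < lin y b" using z(2) y(2) True by auto
          then show ?thesis using z(1) by (metis zero_less_mult_pos)
        qed
        then obtain z where z: "z \<in> Y" "0 < lin z a" by blast
        define M where "M = 1 + (\<Sum>b\<in>B. \<bar>lin z b\<bar>)"
        have "lin (\<lambda>i. M * y i + 1 * z i) b > 0" if "b \<in> B" for b
        proof -
          have "\<bar>lin z b\<bar> < M" unfolding M_def using finB(1) that
            by (smt (verit) abs_ge_zero member_le_sum)
          moreover from this have "M * 1 \<le> M * lin y b" using y(2)[OF that] by (intro mult_left_mono) auto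
          ultimately show ?thesis unfolding lin_combine by linarith
        qed
        moreover have "lin (\<lambda>i. M * y i + 1 * z i) a > 0"
          unfolding lin_combine using True z(2) by (simp add: \<alpha>_def)
        moreover have "(\<lambda>i. M * y i + 1 * z i) \<in> Y" using Y(1)[OF y(1) z(1)] .
        ultimately show ?thesis using A by (intro bexI[of _ "\<lambda>i. M * y i + 1 * z i"]) auto
      next
        case False
        then have pos: "\<alpha> > 0" using \<alpha> by simp
        define M where "M = 1 + (\<Sum>b\<in>B. lin y b)"
        have M: "lin y b < M" if "b \<in> B" for b
        proof -
          have "lin y b \<le> (\<Sum>b\<in>B. lin y b)"
            by (rule member_le_sum[OF that _ finB(1)]) (use y(2) in \<open>simp add: order.strict_implies_order\<close>)
          then show ?thesis by (simp add: M_def)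
        qed
        have "0 \<le> (\<Sum>b\<in>B. lin y b)"
          by (rule sum_nonneg) (use y(2) in \<open>simp add: order.strict_implies_order\<close>)
        then have M0: "0 < M" by (simp add: M_def)
        \<comment> \<open>The coefficients make the contribution of \<open>z\<close> cancel at
          \<open>a\<close>, leaving \<open>\<alpha>\<close>. At \<open>b\<close> the value is
          \<open>M\<close> times that of \<open>z\<close> at \<open>f b\<close>, minus
          \<open>lin y b\<close>, and \<open>M\<close> exceeds every value subtracted.\<close>
        let ?w = "\<lambda>i. (M * \<alpha>) * z i + (M * lin z a - 1) * y i"
        have "lin ?w a = \<alpha>" unfolding lin_combine by (simp add: \<alpha>_def algebra_simps)
        moreover have "0 < lin ?w b" if b: "b \<in> B" for b
        proof -
          have "lin ?w b = M * (lin y b * lin z a + \<alpha> * lin z b) - lin y b"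
            unfolding lin_combine by (simp add: algebra_simps)
          moreover have "M * 1 \<le> M * (lin y b * lin z a + \<alpha> * lin z b)"
            using z(2)[OF b] M0 by (intro mult_left_mono) auto
          ultimately show ?thesis using M[OF b] by linarith
        qed
        moreover have "?w \<in> Y" using Y(1)[OF z(1) y(1)] .
        ultimately show ?thesis using A pos by (intro bexI[of _ ?w]) auto
      qed
    qed
  qed
qed

section \<open>Components and the lattice spanned by a graph\<close>

abbreviation comps :: "nat \<Rightarrow> edge set \<Rightarrow> avert set set" where
  "comps n H \<equiv> comp_vsets (aug_verts n H) (aug_edges H)"

definition sg :: "avert set \<Rightarrow> avert set \<Rightarrow> nat \<Rightarrow> int" where
  "sg L R i = (if V i \<in> L then 1 else if V i \<in> R then - 1 else 0)"

definition ind :: "avert set \<Rightarrow> nat \<Rightarrow> int" where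
  "ind C i = (if V i \<in> C then 1 else 0)"

text \<open>The artificial vertex of a directed edge acts as minus the basis vector of its tail.
  Then the vectors at the two ends of any augmented edge add up to 0 or to an edge vector up to sign
  (\<open>vecv_adj\<close>), and directed edges need no separate treatment along paths.\<close>

fun vecv :: "avert \<Rightarrow> (nat \<Rightarrow>\<^sub>0 int)" where
  "vecv (V i) = unitv i"
| "vecv (T i j) = - unitv i"

text \<open>The allowed forms list exactly the endpoint patterns for which the signs 1, -1 and 0,
  combined as in \<open>rho\<close>, give a positive value.\<close>

lemma edge_form_ok_iff:
  assumes "L \<inter> R = {}"
  shows "edge_form_ok (proj L) (proj R) e \<longleftrightarrow> 0 < lin (sg L R) (rho e)"
proof (cases e)
  case (Sgn s i j)
  have "i \<notin> proj L \<or> i \<notin> proj R" "j \<notin> proj L \<or> j \<notin> proj R" using assms by (auto simp: proj_def)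
  then show ?thesis unfolding Sgn
    by (cases s) (auto simp: edge_form_ok_def lin_add lin_uminus lin_diff sg_def proj_def split: if_splits)
next
  case (Dir i j)
  then show ?thesis using assms by (auto simp: edge_form_ok_def lin_diff sg_def proj_def)
qed

lemma adj_sym: "(u, v) \<in> adj AE \<Longrightarrow> (v, u) \<in> adj AE"
  by (auto simp: adj_def)

lemma adj_rtrancl_sym: "(u, v) \<in> (adj AE)\<^sup>* \<Longrightarrow> (v, u) \<in> (adj AE)\<^sup>*"
  by (induction rule: rtrancl_induct) (auto intro: converse_rtrancl_into_rtrancl adj_sym)

lemma adj_augE:
  assumes "(u, v) \<in> adj (aug_edges H)"
  obtains (sgn) s i j where "Sgn s i j \<in> H" "(u = V i \<and> v = V j) \<or> (u = V j \<and> v = V i)"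
  | (tail) i j where "Dir i j \<in> H" "(u = V i \<and> v = T i j) \<or> (u = T i j \<and> v = V i)"
  | (head) i j where "Dir i j \<in> H" "(u = V j \<and> v = T i j) \<or> (u = T i j \<and> v = V j)"
  using assms by (auto simp: adj_def aug_edges_def)

lemma adj_augI:
  "Sgn s i j \<in> H \<Longrightarrow> (V i, V j) \<in> adj (aug_edges H)"
  "Dir i j \<in> H \<Longrightarrow> (V i, T i j) \<in> adj (aug_edges H)"
  "Dir i j \<in> H \<Longrightarrow> (T i j, V j) \<in> adj (aug_edges H)"
  by (auto simp: adj_def aug_edges_def)

section \<open>Components of a single graph and the functionals they carry\<close>

locale graph =
  fixes n :: nat and H :: "edge set"
  assumes wf: "wf_graph n H"
begin

abbreviation "Vs \<equiv> aug_verts n H"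
abbreviation "AE \<equiv> aug_edges H"

lemma finite_H: "finite H"
  using wf by (simp add: wf_graph_def)

lemma ends_range: "e \<in> H \<Longrightarrow> i \<in> ends e \<Longrightarrow> i \<in> {1..n}"
  using wf by (cases e) (force simp: wf_graph_def)+

lemma ends_Vs: "e \<in> H \<Longrightarrow> i \<in> ends e \<Longrightarrow> V i \<in> Vs"
  using ends_range by (auto simp: aug_verts_def)

lemma adj_Vs: "(u, v) \<in> adj AE \<Longrightarrow> u \<in> Vs \<and> v \<in> Vs"
  by (erule adj_augE) (use ends_Vs in \<open>fastforce simp: aug_verts_def\<close>)+

lemma finite_Vs: "finite Vs"
proof -
  have "{T i j | i j. Dir i j \<in> H} = (\<lambda>e. case e of Dir i j \<Rightarrow> T i j) ` (H \<inter> range (case_prod Dir))"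
    by (force simp: image_iff)
  then show ?thesis using finite_H by (simp add: aug_verts_def)
qed

definition cls :: "avert \<Rightarrow> avert set" where
  "cls u = {v \<in> Vs. (u, v) \<in> (adj AE)\<^sup>*}"

lemma comps_eq: "comps n H = cls ` Vs"
  unfolding comp_vsets_def quotient_def cls_def by auto

lemma finite_comps: "finite (comps n H)"
  unfolding comps_eq using finite_Vs by simp

lemma cls_self: "u \<in> Vs \<Longrightarrow> u \<in> cls u"
  by (simp add: cls_def)

lemma cls_in_comps: "u \<in> Vs \<Longrightarrow> cls u \<in> comps n H"
  by (simp add: comps_eq)

lemma comps_cls: "C \<in> comps n H \<Longrightarrow> u \<in> C \<Longrightarrow> C = cls u"
  unfolding comps_eq by (auto simp: cls_def intro: rtrancl_trans adj_rtrancl_sym)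

lemma comps_sub: "C \<in> comps n H \<Longrightarrow> C \<subseteq> Vs"
  unfolding comps_eq by (auto simp: cls_def)

lemma comps_disjoint: "C \<in> comps n H \<Longrightarrow> K \<in> comps n H \<Longrightarrow> u \<in> C \<Longrightarrow> u \<in> K \<Longrightarrow> C = K"
  using comps_cls by metis

lemma comps_closed: "C \<in> comps n H \<Longrightarrow> (u, v) \<in> adj AE \<Longrightarrow> u \<in> C \<Longrightarrow> v \<in> C"
  using comps_cls[of C u] adj_Vs[of u v] by (auto simp: cls_def)

lemma comps_closed_iff: "C \<in> comps n H \<Longrightarrow> (u, v) \<in> adj AE \<Longrightarrow> u \<in> C \<longleftrightarrow> v \<in> C"
  using comps_closed adj_sym by blast

lemma comps_connected: "C \<in> comps n H \<Longrightarrow> u \<in> C \<Longrightarrow> v \<in> C \<Longrightarrow> (u, v) \<in> (adj AE)\<^sup>*"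
  using comps_cls[of C u] by (auto simp: cls_def)

text \<open>An artificial vertex is joined to the tail of its directed edge, so no component
  consists of artificial vertices alone.\<close>

lemma comps_vertex:
  assumes "C \<in> comps n H"
  obtains i where "V i \<in> C" "i \<in> {1..n}"
proof -
  obtain u where u: "u \<in> Vs" "C = cls u" using assms comps_eq by auto
  show ?thesis
  proof (cases u)
    case (V i)
    then show ?thesis using that[of i] u cls_self by (auto simp: aug_verts_def)
  next
    case (T i j)
    then have "Dir i j \<in> H" using u(1) by (auto simp: aug_verts_def)
    then have "V i \<in> C" "i \<in> {1..n}"
      using comps_closed[OF assms adj_sym[OF adj_augI(2)]] u T cls_self ends_range[of "Dir i j" i] by auto
    then show ?thesis using that by blast
  qed
qed

lemma comps_induct [consumes 3, case_names base step]:
  assumes C: "C \<in> comps n H" "r \<in> C" "u \<in> C"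
    and "Q r" "\<And>u v. u \<in> C \<Longrightarrow> v \<in> C \<Longrightarrow> (u, v) \<in> adj AE \<Longrightarrow> Q u \<Longrightarrow> Q v"
  shows "Q u"
proof -
  have "(r, u) \<in> (adj AE)\<^sup>*" using comps_connected C by blast
  then have "u \<in> C \<and> Q u"
    by (induction rule: rtrancl_induct) (use assms comps_closed[OF C(1)] in blast)+
  then show ?thesis by blast
qed

definition zt :: "(nat \<Rightarrow> int) \<Rightarrow> avert \<Rightarrow> int" where
  "zt z u = lin z (vecv u)"

lemma zt_simps [simp]: "zt z (V i) = z i" "zt z (T i j) = - z i"
  by (simp_all add: zt_def lin_uminus)

lemma vecv_adj: "(u, v) \<in> adj AE \<Longrightarrow> vecv u + vecv v \<in> edge_group H"
proof (erule adj_augE)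
  fix s i j assume s: "Sgn s i j \<in> H" "(u = V i \<and> v = V j) \<or> (u = V j \<and> v = V i)"
  then have "unitv i + unitv j \<in> edge_group H"
    using edge_group_rho[OF s(1)] edge_group_uminus[OF edge_group_rho[OF s(1)]] by (cases s) (auto simp: add.commute)
  then show "vecv u + vecv v \<in> edge_group H" using s by (auto simp: add.commute)
next
  fix i j assume "Dir i j \<in> H" "(u = V i \<and> v = T i j) \<or> (u = T i j \<and> v = V i)"
  then show "vecv u + vecv v \<in> edge_group H" using edge_group_0 by auto
next
  fix i j assume s: "Dir i j \<in> H" "(u = V j \<and> v = T i j) \<or> (u = T i j \<and> v = V j)"
  then show "vecv u + vecv v \<in> edge_group H" using edge_group_rho[OF s(1)] by auto
qed

lemma zt_adj:
  assumes "\<And>e. e \<in> H \<Longrightarrow> lin z (rho e) = 0" "(u, v) \<in> adj AE"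
  shows "zt z v = - zt z u"
  using lin_gp_zero[OF assms(1) vecv_adj[OF assms(2)]] by (simp add: zt_def lin_add)

lemma edges_in_adj: "(s, u, v) \<in> edges_in AE C \<Longrightarrow> (u, v) \<in> adj AE \<and> u \<in> C \<and> v \<in> C"
  by (auto simp: edges_in_def adj_def)

lemma bipartition_adj:
  assumes "C \<in> comps n H" "is_bipartition AE C L R" "(u, v) \<in> adj AE" "u \<in> C"
  shows "(u \<in> L \<and> v \<in> R) \<or> (u \<in> R \<and> v \<in> L)"
proof -
  have "v \<in> C" using comps_closed assms by blast
  then obtain s where "(s, u, v) \<in> edges_in AE C \<or> (s, v, u) \<in> edges_in AE C"
    using assms(3,4) by (auto simp: adj_def edges_in_def)
  then show ?thesis using assms(2) unfolding is_bipartition_def by auto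
qed

lemma bipartition_swap: "is_bipartition AE C L R \<Longrightarrow> is_bipartition AE C R L"
  unfolding is_bipartition_def by auto

lemma bipartitionD:
  "is_bipartition AE C L R \<Longrightarrow> L \<union> R = C" "is_bipartition AE C L R \<Longrightarrow> L \<inter> R = {}"
  by (auto simp: is_bipartition_def)

definition sgv :: "avert set \<Rightarrow> avert set \<Rightarrow> avert \<Rightarrow> int" where
  "sgv L R u = (if u \<in> L then 1 else if u \<in> R then - 1 else 0)"

lemma sgv_V [simp]: "sgv L R (V i) = sg L R i"
  by (simp add: sgv_def sg_def)

lemma sgv_adj:
  assumes "C \<in> comps n H" "is_bipartition AE C L R" "(u, v) \<in> adj AE"
  shows "sgv L R v = - sgv L R u"
proof (cases "u \<in> C")
  case True
  then show ?thesis using bipartition_adj[OF assms] bipartitionD(2)[OF assms(2)] by (auto simp: sgv_def)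
next
  case False
  then have "v \<notin> C" using comps_closed_iff assms by blast
  then show ?thesis using False bipartitionD(1)[OF assms(2)] by (auto simp: sgv_def)
qed

lemma lin_sg_rho:
  assumes C: "C \<in> comps n H" "is_bipartition AE C L R" and e: "e \<in> H"
  shows "lin (sg L R) (rho e) = 0"
proof (cases e)
  case (Sgn s i j)
  then have "sg L R j = - sg L R i" using sgv_adj[OF C adj_augI(1)] e by fastforce
  then show ?thesis using Sgn by (simp add: lin_rho)
next
  case (Dir i j)
  then have "sgv L R (T i j) = - sg L R i" "sg L R j = - sgv L R (T i j)"
    using sgv_adj[OF C adj_augI(2)] sgv_adj[OF C adj_augI(3)] e by fastforce+
  then show ?thesis using Dir by (simp add: lin_diff)
qed

lemma lin_ind_rho:
  assumes C: "C \<in> comps n H" and e: "e \<in> H"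
  shows "even (lin (ind C) (rho e))"
proof (cases e)
  case (Sgn s i j)
  then have "V i \<in> C \<longleftrightarrow> V j \<in> C" using comps_closed_iff[OF C adj_augI(1)] e by blast
  then show ?thesis using Sgn by (simp add: lin_rho ind_def)
next
  case (Dir i j)
  then have "V i \<in> C \<longleftrightarrow> V j \<in> C" 
    using comps_closed_iff[OF C adj_augI(2)] comps_closed_iff[OF C adj_augI(3)] e by blast
  then show ?thesis using Dir by (simp add: lin_diff ind_def)
qed

lemma lin_ind_gp:
  assumes C: "C \<in> comps n H" and "v \<in> edge_group H"
  shows "even (lin (ind C) v)"
proof -
  have "even (lin (ind C) a)" if "a \<in> edge_monoid H" for a
    using that by (induction rule: edge_monoid.induct) (auto simp: lin_add lin_ind_rho[OF C])
  then show ?thesis using assms(2) by (auto simp: edge_group_def lin_diff)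
qed

text \<open>A functional vanishing on all edges changes sign along every augmented edge. One nonzero
  value propagates through the component, and the signs give the two sides.\<close>

lemma bipartite_if_nonzero:
  assumes z: "\<And>e. e \<in> H \<Longrightarrow> lin z (rho e) = 0" and C: "C \<in> comps n H" "V i \<in> C" "z i \<noteq> 0"
  shows "bipartite AE C"
proof -
  have nz: "zt z u \<noteq> 0" if "u \<in> C" for u
    using C(1,2) that by (induction rule: comps_induct) (use C(3) zt_adj[of z, OF z] in auto)
  have "is_bipartition AE C {u \<in> C. 0 < zt z u} {u \<in> C. zt z u < 0}"
    unfolding is_bipartition_def
  proof (intro conjI)
    show "\<forall>(s, u, v)\<in>edges_in AE C. u \<in> {u \<in> C. 0 < zt z u} \<and> v \<in> {u \<in> C. zt z u < 0} \<or>
        u \<in> {u \<in> C. zt z u < 0} \<and> v \<in> {u \<in> C. 0 < zt z u}"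
    proof clarify
      fix s u v assume "(s, u, v) \<in> edges_in AE C"
        and *: "\<not> (u \<in> {u \<in> C. zt z u < 0} \<and> v \<in> {u \<in> C. 0 < zt z u})"
      then have "u \<in> C" "v \<in> C" "zt z v = - zt z u" using edges_in_adj zt_adj[of z, OF z] by auto
      then show "u \<in> {u \<in> C. 0 < zt z u} \<and> v \<in> {u \<in> C. zt z u < 0}"
        using nz[of u] * by auto
    qed
  qed (use nz in force)+
  then show ?thesis unfolding bipartite_def by blast
qed

text \<open>The product of \<open>z\<close> with the sign is constant along augmented edges, as both
  factors change sign.\<close>

lemma proportional_on_bipartite:
  assumes z: "\<And>e. e \<in> H \<Longrightarrow> lin z (rho e) = 0"
    and C: "C \<in> comps n H" "is_bipartition AE C L R"
  obtains c where "\<And>i. V i \<in> C \<Longrightarrow> z i = c * sg L R i"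
proof -
  obtain r where r: "V r \<in> C" using comps_vertex[OF C(1)] by blast
  have sq: "sgv L R u * sgv L R u = 1" if "u \<in> C" for u
    using that bipartitionD(1)[OF C(2)] by (auto simp: sgv_def)
  have "zt z u * sgv L R u = z r * sg L R r" if "u \<in> C" for u
    using C(1) r that by (induction rule: comps_induct) (auto simp: zt_adj[of z, OF z] sgv_adj[OF C])
  then have "z i * sg L R i = z r * sg L R r" if "V i \<in> C" for i using that by fastforce
  moreover have "sg L R i * sg L R i = 1" if "V i \<in> C" for i using sq[OF that] by simp
  ultimately have "z i = (z r * sg L R r) * sg L R i" if "V i \<in> C" for i
    using that by (metis mult.assoc mult.right_neutral)
  then show ?thesis using that by blast
qed

lemma keys_rho: "e \<in> H \<Longrightarrow> keys (rho e) \<subseteq> {1..n}"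
proof -
  assume e: "e \<in> H"
  have k: "keys (unitv i) = {i}" for i by (simp add: unitv_def)
  have "keys (rho e) \<subseteq> ends e"
  proof (cases e)
    case (Sgn s i j)
    then show ?thesis using keys_add[of "unitv i" "unitv j"] k by (cases s) (auto simp del: minus_add_distrib)
  next
    case (Dir i j)
    then show ?thesis using keys_diff[of "unitv j" "unitv i"] k by auto
  qed
  then show ?thesis using ends_range[OF e] by auto
qed

lemma keys_mon: "v \<in> edge_monoid H \<Longrightarrow> keys v \<subseteq> {1..n}"
proof (induction rule: edge_monoid.induct)
  case (edge_monoid_step e v)
  then show ?case using keys_rho[of e] keys_add[of "rho e" v] by blast
qed simp

lemma keys_gp: "v \<in> edge_group H \<Longrightarrow> keys v \<subseteq> {1..n}"
proof -
  assume "v \<in> edge_group H"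
  then obtain a b where "v = a - b" "a \<in> edge_monoid H" "b \<in> edge_monoid H" unfolding edge_group_def by blast
  then show ?thesis using keys_mon[of a] keys_mon[of b] keys_diff[of a b] by blast
qed

text \<open>Modulo the group, each vertex vector is plus or minus that of \<open>r\<close>. If twice
  the latter were not in the group, the two cases would exclude each other and form a
  bipartition.\<close>

lemma nonbipartite_double:
  assumes C: "C \<in> comps n H" "\<not> bipartite AE C" and r: "r \<in> C"
  shows "vecv r + vecv r \<in> edge_group H"
proof (rule ccontr)
  assume no: "vecv r + vecv r \<notin> edge_group H"
  let ?L = "{u \<in> C. vecv u - vecv r \<in> edge_group H}" and ?R = "{u \<in> C. vecv u + vecv r \<in> edge_group H}"
  have step: "vecv u - vecv r \<in> edge_group H \<Longrightarrow> vecv v + vecv r \<in> edge_group H"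
    "vecv u + vecv r \<in> edge_group H \<Longrightarrow> vecv v - vecv r \<in> edge_group H" if "(u, v) \<in> adj AE" for u v
  proof -
    have *: "vecv u + vecv v \<in> edge_group H" by (rule vecv_adj[OF that])
    show "vecv v + vecv r \<in> edge_group H" if "vecv u - vecv r \<in> edge_group H"
      using edge_group_diff[OF * that] by (simp add: algebra_simps)
    show "vecv v - vecv r \<in> edge_group H" if "vecv u + vecv r \<in> edge_group H"
      using edge_group_diff[OF * that] by (simp add: algebra_simps)
  qed
  have "u \<in> ?L \<union> ?R" if "u \<in> C" for u
    using C(1) r that by (induction rule: comps_induct) (use step r edge_group_0 in auto)
  moreover have "?L \<inter> ?R = {}"
  proof (rule ccontr)
    assume "?L \<inter> ?R \<noteq> {}"
    then obtain u where "vecv u - vecv r \<in> edge_group H" "vecv u + vecv r \<in> edge_group H" by blast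
    then show False using edge_group_diff[of "vecv u + vecv r" H "vecv u - vecv r"] no by simp
  qed
  ultimately have "is_bipartition AE C ?L ?R"
    unfolding is_bipartition_def using edges_in_adj step by blast
  then show False using C(2) unfolding bipartite_def by blast
qed

text \<open>Every basis vector of the component is congruent to a multiple of one root vector, so
  the part of \<open>v\<close> on the component reduces to a multiple of the root. The hypotheses
  make this multiple 0 in the bipartite case and even otherwise.\<close>

lemma edge_group_component_sum:
  assumes C: "C \<in> comps n H"
    and bip: "\<And>L R. is_bipartition AE C L R \<Longrightarrow> lin (sg L R) v = 0"
    and nonbip: "\<not> bipartite AE C \<Longrightarrow> even (lin (ind C) v)"
  shows "(\<Sum>i\<in>{i \<in> keys v. V i \<in> C}. frag_cmul (lookup v i) (unitv i)) \<in> edge_group H"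
proof -
  obtain r where r: "V r \<in> C" using comps_vertex[OF C] by blast
  let ?X = "{i \<in> keys v. V i \<in> C}"
  obtain s where s: "\<And>i. V i \<in> C \<Longrightarrow> unitv i - frag_cmul (s i) (unitv r) \<in> edge_group H"
    "frag_cmul (\<Sum>i\<in>?X. lookup v i * s i) (unitv r) \<in> edge_group H"
  proof (cases "bipartite AE C")
    case True
    then obtain L R where LR: "is_bipartition AE C L R" unfolding bipartite_def by blast
    have sq: "sg L R r * sg L R r = 1"
      using r bipartitionD(1)[OF LR] by (auto simp: sg_def)
    have "vecv u - frag_cmul (sgv L R u * sg L R r) (unitv r) \<in> edge_group H" if "u \<in> C" for u
      using C r that
    proof (induction rule: comps_induct)
      case base
      show ?case using sq edge_group_0 by simp
    next
      case (step u w)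
      have "(vecv u + vecv w) - (vecv u - frag_cmul (sgv L R u * sg L R r) (unitv r)) \<in> edge_group H"
        by (rule edge_group_diff[OF vecv_adj[OF step(3)] step(4)])
      then show ?case
        by (simp add: sgv_adj[OF C LR step(3)] minus_frag_cmul[symmetric] del: minus_frag_cmul)
    qed
    then have "unitv i - frag_cmul (sg L R i * sg L R r) (unitv r) \<in> edge_group H" if "V i \<in> C" for i
      using that by fastforce
    moreover have "(\<Sum>i\<in>?X. lookup v i * (sg L R i * sg L R r)) = 0"
    proof -
      have "lin (sg L R) v = (\<Sum>i\<in>?X. sg L R i * lookup v i)"
        unfolding lin_def using bipartitionD(1)[OF LR]
        by (intro sum.mono_neutral_right) (auto simp: sg_def)
      then have "(\<Sum>i\<in>?X. sg L R i * lookup v i) * sg L R r = 0" using bip[OF LR] by simp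
      moreover have "(\<Sum>i\<in>?X. lookup v i * (sg L R i * sg L R r)) = (\<Sum>i\<in>?X. sg L R i * lookup v i) * sg L R r"
        unfolding sum_distrib_right by (intro sum.cong) simp_all
      ultimately show ?thesis by simp
    qed
    ultimately show ?thesis using that[of "\<lambda>i. sg L R i * sg L R r"] edge_group_0 by simp
  next
    case False
    have dbl: "frag_cmul 2 (unitv r) \<in> edge_group H"
      using nonbipartite_double[OF C False r] frag_cmul_distrib[of 1 1 "unitv r"] by simp
    have "vecv u - unitv r \<in> edge_group H" if "u \<in> C" for u
      using C r that
    proof (induction rule: comps_induct)
      case base
      show ?case using edge_group_0 by simp
    next
      case (step u w)
      have "(vecv u + vecv w) - (vecv u - unitv r) - frag_cmul 2 (unitv r) \<in> edge_group H"
        by (intro edge_group_diff vecv_adj[OF step(3)] step(4) dbl)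
      then show ?case using frag_cmul_distrib[of 1 1 "unitv r"] by (simp add: algebra_simps)
    qed
    then have "unitv i - frag_cmul 1 (unitv r) \<in> edge_group H" if "V i \<in> C" for i
      using that by fastforce
    moreover have "frag_cmul (\<Sum>i\<in>?X. lookup v i * 1) (unitv r) \<in> edge_group H"
    proof -
      have "lin (ind C) v = (\<Sum>i\<in>?X. ind C i * lookup v i)"
        unfolding lin_def by (intro sum.mono_neutral_right) (auto simp: ind_def)
      also have "\<dots> = (\<Sum>i\<in>?X. lookup v i * 1)"
        by (intro sum.cong) (auto simp: ind_def)
      finally obtain m where "(\<Sum>i\<in>?X. lookup v i * 1) = m * 2" using nonbip[OF False] by (metis evenE mult.commute)
      then show ?thesis using edge_group_frag_cmul[OF dbl, of m] by simp
    qed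
    ultimately show ?thesis using that[of "\<lambda>_. 1"] by simp
  qed
  have "(\<Sum>i\<in>?X. frag_cmul (lookup v i) (unitv i - frag_cmul (s i) (unitv r)))
      + frag_cmul (\<Sum>i\<in>?X. lookup v i * s i) (unitv r) \<in> edge_group H"
    by (intro edge_group_add edge_group_sum edge_group_frag_cmul s) auto
  moreover have "(\<Sum>i\<in>?X. frag_cmul (lookup v i) (unitv i - frag_cmul (s i) (unitv r)))
      + frag_cmul (\<Sum>i\<in>?X. lookup v i * s i) (unitv r) = (\<Sum>i\<in>?X. frag_cmul (lookup v i) (unitv i))"
    by (rule poly_mapping_eqI) (simp add: lookup_add lookup_sum lookup_minus sum_distrib_right
        sum.distrib[symmetric] right_diff_distrib mult.assoc)
  ultimately show ?thesis by simp
qed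

text \<open>The components partition the coordinates, so \<open>v\<close> splits into the sums of
  \<open>edge_group_component_sum\<close>. Necessity of the conditions is in
  \<open>lin_sg_rho\<close> and \<open>lin_ind_gp\<close>.\<close>

lemma edge_group_memI:
  assumes v: "keys v \<subseteq> {1..n}"
    and bip: "\<And>C L R. C \<in> comps n H \<Longrightarrow> is_bipartition AE C L R \<Longrightarrow> lin (sg L R) v = 0"
    and nonbip: "\<And>C. C \<in> comps n H \<Longrightarrow> \<not> bipartite AE C \<Longrightarrow> even (lin (ind C) v)"
  shows "v \<in> edge_group H"
proof -
  have Vs: "V i \<in> Vs" if "i \<in> keys v" for i using that v by (auto simp: aug_verts_def)
  have "v = (\<Sum>i\<in>keys v. frag_cmul (lookup v i) (unitv i))"
    by (rule poly_mapping_eqI) 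
      (auto simp: lookup_sum unitv_def lookup_single when_def in_keys_iff if_distrib sum.delta cong: if_cong)
  also have "\<dots> = (\<Sum>C\<in>comps n H. \<Sum>i\<in>{i \<in> keys v. cls (V i) = C}. frag_cmul (lookup v i) (unitv i))"
    by (rule sum.group[symmetric]) (use finite_comps Vs cls_in_comps in auto)
  also have "\<dots> \<in> edge_group H"
  proof (rule edge_group_sum)
    fix C assume C: "C \<in> comps n H"
    have "{i \<in> keys v. cls (V i) = C} = {i \<in> keys v. V i \<in> C}"
      using comps_cls[OF C] cls_self Vs by blast
    then show "(\<Sum>i\<in>{i \<in> keys v. cls (V i) = C}. frag_cmul (lookup v i) (unitv i)) \<in> edge_group H"
      using edge_group_component_sum[OF C bip[OF C] nonbip[OF C]] by simp
  qed
  finally show ?thesis .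
qed

lemma lin_ind_sg:
  assumes "C \<in> comps n H" "is_bipartition AE C L R"
  shows "even (lin (ind C) v) \<longleftrightarrow> even (lin (sg L R) v)"
proof -
  have "lin (ind C) v - lin (sg L R) v = (\<Sum>i\<in>keys v. (ind C i - sg L R i) * lookup v i)"
    by (simp add: lin_def sum_subtractf left_diff_distrib)
  moreover have "even (\<Sum>i\<in>keys v. (ind C i - sg L R i) * lookup v i)"
    using bipartitionD(1)[OF assms(2)] by (intro dvd_sum) (auto simp: ind_def sg_def)
  ultimately have "even (lin (ind C) v - lin (sg L R) v)" by simp
  then show ?thesis by simp
qed

end

section \<open>Facets and components\<close>

lemma lin_rho_scale:
  assumes "\<And>i. i \<in> ends e \<Longrightarrow> z i = c * y i"
  shows "lin z (rho e) = c * lin y (rho e)"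
proof (cases e)
  case (Sgn s i j)
  then show ?thesis using assms by (cases s) (simp_all add: lin_add lin_diff lin_uminus algebra_simps)
next
  case (Dir i j)
  then show ?thesis using assms by (simp add: lin_diff algebra_simps)
qed

lemma lin_rho_zero: "(\<And>i. i \<in> ends e \<Longrightarrow> z i = 0) \<Longrightarrow> lin z (rho e) = 0"
  using lin_rho_scale[of e z 0 z] by simp

lemma ends_finite: "finite (ends e)" "card (ends e) \<le> 2"
  by (cases e; simp add: card_insert_if)+

lemma lin_rho_ends:
  assumes "lin y (rho e) = 0" "i \<in> ends e" "y i \<noteq> 0" "j \<in> ends e"
  shows "y j \<noteq> 0"
proof (cases e)
  case (Sgn s k l)
  then show ?thesis using assms by (cases s) (auto simp: lin_add lin_diff lin_uminus)
next
  case (Dir k l)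
  then show ?thesis using assms by (auto simp: lin_diff)
qed

lemma lin_ind_disjoint_even:
  assumes "\<And>i. i \<in> ends e \<Longrightarrow> V i \<in> C \<union> K" "C \<inter> K = {}"
  shows "even (lin (ind C) (rho e) + lin (ind K) (rho e))"
proof (cases e)
  case (Sgn s k l)
  then show ?thesis using assms by (cases s) (auto simp: lin_add lin_diff lin_uminus ind_def)
next
  case (Dir k l)
  then show ?thesis using assms by (auto simp: lin_diff ind_def)
qed

lemma sg_nonzero: "is_bipartition AE C L R \<Longrightarrow> sg L R i \<noteq> 0 \<longleftrightarrow> V i \<in> C"
  by (auto simp: is_bipartition_def sg_def)

lemma sg_swap: "is_bipartition AE C L R \<Longrightarrow> sg R L i = - sg L R i"
  by (auto simp: is_bipartition_def sg_def)

lemma lin_sg_swap: "is_bipartition AE C L R \<Longrightarrow> lin (sg R L) v = - lin (sg L R) v"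
  using sg_swap[of AE C L R] by (simp add: lin_def sum_negf)

lemma lin_sg_touches:
  assumes "is_bipartition AE C L R" "lin (sg L R) (rho e) \<noteq> 0"
  obtains i where "i \<in> ends e" "V i \<in> C"
  using lin_rho_zero[of e "sg L R"] assms sg_nonzero[OF assms(1)] by blast

text \<open>The two ends contribute -1, 0 or 1 each, a loop counting its vertex twice. A positive
  total is 1 if an end contributes 0, and 2 if none does.\<close>

lemma lin_sg_pos_cases:
  assumes "is_bipartition AE C L R" "0 < lin (sg L R) (rho e)"
  shows "(\<exists>i\<in>ends e. V i \<notin> C) \<Longrightarrow> lin (sg L R) (rho e) = 1"
    "(\<And>i. i \<in> ends e \<Longrightarrow> V i \<in> C) \<Longrightarrow> lin (sg L R) (rho e) = 2"
proof -
  have nz: "sg L R i = 0 \<longleftrightarrow> V i \<notin> C" for i using sg_nonzero[OF assms(1)] by blast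
  have val: "sg L R i = - 1 \<or> sg L R i = 0 \<or> sg L R i = 1" for i by (simp add: sg_def)
  obtain a b where ab: "ends e = {a, b}" "lin (sg L R) (rho e) = sg L R a + sg L R b \<or>
      lin (sg L R) (rho e) = - (sg L R a + sg L R b) \<or> lin (sg L R) (rho e) = sg L R b - sg L R a"
  proof (cases e)
    case (Sgn s k l)
    then show ?thesis using that[of k l] by (cases s) (simp_all add: lin_add lin_diff lin_uminus)
  next
    case (Dir k l)
    then show ?thesis using that[of k l] by (simp add: lin_diff)
  qed
  show "lin (sg L R) (rho e) = 1" if out: "\<exists>i\<in>ends e. V i \<notin> C"
  proof -
    have "sg L R a = 0 \<or> sg L R b = 0" using out ab(1) nz by auto
    then show ?thesis using ab(2) val[of a] val[of b] assms(2) by linarith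
  qed
  show "lin (sg L R) (rho e) = 2" if all: "\<And>i. i \<in> ends e \<Longrightarrow> V i \<in> C"
  proof -
    have "sg L R a \<noteq> 0" "sg L R b \<noteq> 0" using all[of a] all[of b] ab(1) nz by auto
    then show ?thesis using ab(2) val[of a] val[of b] assms(2) by linarith
  qed
qed

lemma (in graph) ends_connected:
  assumes "e \<in> H" "C \<in> comps n H" "i \<in> ends e" "V i \<in> C" "j \<in> ends e"
  shows "V j \<in> C"
proof (cases e)
  case (Sgn s k l)
  then show ?thesis using assms comps_closed_iff[OF assms(2) adj_augI(1)[of s k l H]] by auto
next
  case (Dir k l)
  then show ?thesis using assms comps_closed_iff[OF assms(2) adj_augI(2)[of k l H]]
      comps_closed_iff[OF assms(2) adj_augI(3)[of k l H]] by auto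
qed

section \<open>A subgraph inside a graph: touched components and component counts\<close>

locale subgraph_pair =
  fixes n :: nat and E H :: "edge set"
  assumes wfE: "wf_graph n E" and sub: "H \<subseteq> E"
begin

sublocale E: graph n E by unfold_locales (rule wfE)

sublocale H: graph n H
proof unfold_locales
  have "finite H" using finite_subset[OF sub E.finite_H] .
  then show "wf_graph n H" using wfE subsetD[OF sub] by (simp add: wf_graph_def)
qed

text \<open>Expresses through edges alone that \<open>C\<close> is not a component of the larger
  graph (\<open>untouched_iff\<close>).\<close>

definition touched :: "avert set \<Rightarrow> bool" where
  "touched C \<longleftrightarrow> (\<exists>e\<in>E - H. \<exists>i\<in>ends e. V i \<in> C)"

lemma untouchedD: "\<not> touched C \<Longrightarrow> e \<in> E \<Longrightarrow> i \<in> ends e \<Longrightarrow> V i \<in> C \<Longrightarrow> e \<in> H"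
  by (auto simp: touched_def)

lemma Vs_mono: "H.Vs \<subseteq> E.Vs"
  using sub by (auto simp: aug_verts_def)

lemma AE_mono: "H.AE \<subseteq> E.AE"
  unfolding aug_edges_def by (intro Un_mono Collect_mono) (use sub in blast)+

lemma adj_mono: "adj H.AE \<subseteq> adj E.AE"
  using AE_mono unfolding adj_def by (simp add: subset_iff) blast

lemma V_mem_Vs: "i \<in> {1..n} \<Longrightarrow> V i \<in> H.Vs"
  by (auto simp: aug_verts_def)

lemma cls_mono: "H.cls u \<subseteq> E.cls u"
  unfolding H.cls_def E.cls_def using Vs_mono rtrancl_mono[OF adj_mono] by auto

lemma E_ends_Vs: "e \<in> E \<Longrightarrow> i \<in> ends e \<Longrightarrow> V i \<in> H.Vs"
  using V_mem_Vs E.ends_range by blast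

lemma comp_sub_E_comp:
  assumes "C \<in> comps n H" "K \<in> comps n E" "u \<in> C" "u \<in> K"
  shows "C \<subseteq> K"
  using H.comps_cls[OF assms(1,3)] E.comps_cls[OF assms(2,4)] cls_mono by auto

definition up :: "avert set \<Rightarrow> avert set" where
  "up C = E.cls (SOME u. u \<in> C)"

lemma up:
  assumes "C \<in> comps n H"
  shows "up C \<in> comps n E" "C \<subseteq> up C"
proof -
  obtain i where "V i \<in> C" using H.comps_vertex[OF assms] by blast
  then have u: "(SOME u. u \<in> C) \<in> C" by (rule someI)
  then have u': "(SOME u. u \<in> C) \<in> E.Vs" using H.comps_sub[OF assms] Vs_mono by blast
  show K: "up C \<in> comps n E" unfolding up_def by (rule E.cls_in_comps[OF u'])
  show "C \<subseteq> up C" by (rule comp_sub_E_comp[OF assms K u]) (use E.cls_self[OF u'] up_def in auto)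
qed

lemma up_eqI: "C \<in> comps n H \<Longrightarrow> K \<in> comps n E \<Longrightarrow> u \<in> C \<Longrightarrow> u \<in> K \<Longrightarrow> up C = K"
  using up E.comps_disjoint by blast

lemma untouched_comp:
  assumes C: "C \<in> comps n H" and "\<not> touched C"
  shows "C \<in> comps n E" "edges_in E.AE C = edges_in H.AE C"
proof -
  have adjH: "(u, v) \<in> adj H.AE" if "(u, v) \<in> adj E.AE" "u \<in> C" for u v
    using that(1)
  proof (cases rule: adj_augE)
    case (sgn s i j)
    then have "Sgn s i j \<in> H"
      using untouchedD[OF assms(2), of _ i] untouchedD[OF assms(2), of _ j] that(2) by auto
    then show ?thesis using sgn adj_augI(1) adj_sym by blast
  next
    case (tail i j)
    have "Dir i j \<in> H"
    proof (rule ccontr)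
      assume "Dir i j \<notin> H"
      moreover from this have "T i j \<notin> C" using H.comps_sub[OF C] by (auto simp: aug_verts_def)
      ultimately show False using tail untouchedD[OF assms(2), of "Dir i j" i] that(2) by auto
    qed
    then show ?thesis using tail adj_augI(2) adj_sym by blast
  next
    case (head i j)
    have "Dir i j \<in> H"
    proof (rule ccontr)
      assume "Dir i j \<notin> H"
      moreover from this have "T i j \<notin> C" using H.comps_sub[OF C] by (auto simp: aug_verts_def)
      ultimately show False using head untouchedD[OF assms(2), of "Dir i j" j] that(2) by auto
    qed
    then show ?thesis using head adj_augI(3) adj_sym by blast
  qed
  obtain r where r: "V r \<in> C" using H.comps_vertex[OF C] by blast
  have "E.cls (V r) \<subseteq> C"
  proof
    fix u assume "u \<in> E.cls (V r)"
    then have "(V r, u) \<in> (adj E.AE)\<^sup>*" by (simp add: E.cls_def)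
    then show "u \<in> C"
      by (induction rule: rtrancl_induct) (use r adjH H.comps_closed[OF C] in blast)+
  qed
  then have "C = E.cls (V r)" using cls_mono H.comps_cls[OF C r] by blast
  then show "C \<in> comps n E" using E.cls_in_comps r H.comps_sub[OF C] Vs_mono by blast
  show "edges_in E.AE C = edges_in H.AE C"
  proof
    show "edges_in H.AE C \<subseteq> edges_in E.AE C" using AE_mono by (simp add: edges_in_def) blast
    show "edges_in E.AE C \<subseteq> edges_in H.AE C"
    proof clarify
      fix s u v assume uv: "(s, u, v) \<in> edges_in E.AE C"
      have "(s, u, v) \<in> H.AE"
      proof (rule ccontr)
        assume no: "(s, u, v) \<notin> H.AE"
        have T: "T i j \<in> C \<Longrightarrow> Dir i j \<in> H" for i j
          using H.comps_sub[OF C] by (auto simp: aug_verts_def)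
        obtain i j where ij: "u = V i" "v = V j" "Sgn s i j \<in> E" "Sgn s i j \<notin> H"
          using uv no T unfolding edges_in_def aug_edges_def by auto
        then have "V i \<in> C" using uv by (simp add: edges_in_def)
        then show False using untouchedD[OF assms(2) ij(3), of i] ij(4) by simp
      qed
      then show "(s, u, v) \<in> edges_in H.AE C" using uv by (auto simp: edges_in_def)
    qed
  qed
qed

text \<open>Components are compared together with their edges. This matters for a signed edge
  outside \<open>H\<close> with both ends in \<open>C\<close>, which touches \<open>C\<close>
  without changing the vertex set; a directed one would add an artificial vertex.\<close>

lemma untouched_iff:
  assumes C: "C \<in> comps n H"
  shows "(C, edges_in H.AE C) \<in> components E.Vs E.AE \<longleftrightarrow> \<not> touched C"
proof
  assume "\<not> touched C"
  then show "(C, edges_in H.AE C) \<in> components E.Vs E.AE"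
    using untouched_comp[OF C] unfolding components_def by (metis (mono_tags, lifting) mem_Collect_eq)
next
  assume "(C, edges_in H.AE C) \<in> components E.Vs E.AE"
  then have CE: "C \<in> comps n E" and eq: "edges_in H.AE C = edges_in E.AE C"
    by (auto simp: components_def)
  show "\<not> touched C"
  proof
    assume "touched C"
    then obtain e i where e: "e \<in> E" "e \<notin> H" "i \<in> ends e" "V i \<in> C" unfolding touched_def by blast
    show False
    proof (cases e)
      case (Sgn s k l)
      then have "V k \<in> C" "V l \<in> C" using E.ends_connected[OF e(1) CE e(3,4)] by auto
      then have "(s, V k, V l) \<in> edges_in E.AE C" using Sgn e(1) by (auto simp: edges_in_def aug_edges_def)
      then have "(s, V k, V l) \<in> edges_in H.AE C" using eq by simp
      then have "(s, V k, V l) \<in> H.AE" by (simp add: edges_in_def)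
      then show False using Sgn e(2) by (auto simp: aug_edges_def)
    next
      case (Dir k l)
      then have "V k \<in> C" using E.ends_connected[OF e(1) CE e(3,4)] by auto
      then have "T k l \<in> C" using E.comps_closed[OF CE adj_augI(2)] e(1) Dir by blast
      then show False using H.comps_sub[OF C] Dir e(2) by (auto simp: aug_verts_def)
    qed
  qed
qed

lemma untouched_bipartite:
  assumes C: "C \<in> comps n H" "\<not> touched C"
  shows "is_bipartition E.AE C L R \<longleftrightarrow> is_bipartition H.AE C L R"
    "bipartite E.AE C \<longleftrightarrow> bipartite H.AE C"
  using untouched_comp(2)[OF C] by (simp_all add: is_bipartition_def bipartite_def)

lemma facet_subgraph_iff:
  "facet_subgraph n E H \<longleftrightarrow> nbicomp n H = nbicomp n E + 1 \<and>
    (\<forall>C\<in>comps n H. bipartite H.AE C \<and> touched C \<longrightarrow>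
      (\<exists>L R. is_bipartition H.AE C L R \<and> (\<forall>e\<in>E - H. 0 < lin (sg L R) (rho e))))"
proof -
  have "(\<forall>e\<in>E - H. edge_form_ok (proj L) (proj R) e) \<longleftrightarrow> (\<forall>e\<in>E - H. 0 < lin (sg L R) (rho e))"
    if "is_bipartition H.AE C L R" for C L R
    using edge_form_ok_iff[OF H.bipartitionD(2)[OF that]] by blast
  then have "(\<forall>C\<in>comps n H. bipartite H.AE C \<and> (C, edges_in H.AE C) \<notin> components E.Vs E.AE \<longrightarrow>
      (\<exists>L R. is_bipartition H.AE C L R \<and> (\<forall>e\<in>E - H. edge_form_ok (proj L) (proj R) e))) \<longleftrightarrow>
    (\<forall>C\<in>comps n H. bipartite H.AE C \<and> touched C \<longrightarrow>
      (\<exists>L R. is_bipartition H.AE C L R \<and> (\<forall>e\<in>E - H. 0 < lin (sg L R) (rho e))))"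
    by (intro ball_cong refl) (simp add: untouched_iff cong: conj_cong)
  then show ?thesis unfolding facet_subgraph_def using sub by blast
qed

text \<open>Relabelling \<open>q\<close> as \<open>C\<close> gives a labelling constant along all
  edges of \<open>E\<close>, so distinct components of \<open>H\<close> other than \<open>q\<close>
  stay in distinct components of \<open>E\<close>. The case \<open>q = C\<close> is
  included.\<close>

lemma ncomp_le_merge:
  assumes C: "C \<in> comps n H" "q \<in> comps n H"
    and ends: "\<And>e i. e \<in> E - H \<Longrightarrow> i \<in> ends e \<Longrightarrow> V i \<in> C \<union> q"
  shows "ncomp n H \<le> ncomp n E + 1"
proof -
  \<comment> \<open>The artificial vertex of an edge outside \<open>H\<close> lies in no component
    of \<open>H\<close>; it inherits the label of its tail.\<close>
  define base where "base = (\<lambda>u. if u \<in> H.Vs then u else case u of V i \<Rightarrow> V i | T i j \<Rightarrow> V i)"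
  define lbl where "lbl = (\<lambda>u. if base u \<in> q then C else H.cls (base u))"
  have lbl_V: "lbl (V i) = C" if "e \<in> E - H" "i \<in> ends e" for e i
    using ends[OF that] E_ends_Vs[of e i] that H.comps_cls[OF C(1), of "V i"]
    by (auto simp: lbl_def base_def)
  have same: "lbl u = lbl v" if "(u, v) \<in> adj H.AE" for u v
  proof -
    have uv: "u \<in> H.Vs" "v \<in> H.Vs" using H.adj_Vs[OF that] by auto
    have "H.cls u = H.cls v"
      using H.comps_cls[OF H.cls_in_comps[OF uv(1)]] H.comps_closed[OF H.cls_in_comps[OF uv(1)] that]
        H.cls_self[OF uv(1)] by blast
    moreover have "u \<in> q \<longleftrightarrow> v \<in> q" using H.comps_closed_iff[OF C(2) that] .
    ultimately show ?thesis using uv by (simp add: lbl_def base_def)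
  qed
  have const: "lbl u = lbl v" if "(u, v) \<in> adj E.AE" for u v
    using that
  proof (cases rule: adj_augE)
    case (sgn s i j)
    show ?thesis
    proof (cases "Sgn s i j \<in> H")
      case True
      then show ?thesis using same adj_augI(1)[OF True] sgn(2) by auto
    next
      case False
      then show ?thesis using lbl_V[of "Sgn s i j"] sgn by auto
    qed
  next
    case (tail i j)
    show ?thesis
    proof (cases "Dir i j \<in> H")
      case True
      then show ?thesis using same adj_augI(2)[OF True] tail(2) by auto
    next
      case False
      then have "base (T i j) = V i" by (auto simp: base_def aug_verts_def)
      moreover have "base (V i) = V i" by (simp add: base_def)
      ultimately have "lbl (T i j) = lbl (V i)" by (simp add: lbl_def)
      then show ?thesis using tail(2) by auto
    qed
  next
    case (head i j)
    show ?thesis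
    proof (cases "Dir i j \<in> H")
      case True
      then show ?thesis using same adj_augI(3)[OF True] head(2) by auto
    next
      case False
      then have "base (T i j) = V i" by (auto simp: base_def aug_verts_def)
      moreover have "base (V i) = V i" by (simp add: base_def)
      ultimately have "lbl (T i j) = lbl (V i)" by (simp add: lbl_def)
      then show ?thesis using head lbl_V[of "Dir i j"] False by auto
    qed
  qed
  have lbl_path: "lbl u = lbl v" if "(u, v) \<in> (adj E.AE)\<^sup>*" for u v
    using that by (induction rule: rtrancl_induct) (use const in auto)
  have lbl_comp: "lbl u = K" if "K \<in> comps n H - {q}" "u \<in> K" for K u
    using that H.comps_disjoint[of K q u] C(2) H.comps_cls[of K u] H.comps_sub[of K]
    by (auto simp: lbl_def base_def)
  have "inj_on up (comps n H - {q})"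
  proof (rule inj_onI)
    fix K K' assume K: "K \<in> comps n H - {q}" "K' \<in> comps n H - {q}" "up K = up K'"
    obtain u v where "V u \<in> K" "V v \<in> K'" using K H.comps_vertex by (metis DiffD1)
    moreover from this have "V u \<in> up K" "V v \<in> up K" using K up(2) by blast+
    ultimately show "K = K'"
      using lbl_path[OF E.comps_connected[OF up(1)[of K]]] lbl_comp K by (metis DiffD1)
  qed
  then have "card (comps n H - {q}) \<le> card (comps n E)"
    using up(1) E.finite_comps by (intro card_inj_on_le[of up]) auto
  then show ?thesis unfolding ncomp_def using C(2) H.finite_comps by simp
qed

text \<open>Three components of \<open>H\<close> fall into one component of \<open>E\<close>, so the
  components of \<open>H\<close> other than \<open>q1\<close> and \<open>q2\<close> already reach
  every component of \<open>E\<close>.\<close>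

lemma ncomp_ge_merge:
  assumes C: "C \<in> comps n H" "q1 \<in> comps n H" "q2 \<in> comps n H" "C \<noteq> q1" "C \<noteq> q2" "q1 \<noteq> q2"
    and e1: "e1 \<in> E" "i1 \<in> ends e1" "V i1 \<in> C" "j1 \<in> ends e1" "V j1 \<in> q1"
    and e2: "e2 \<in> E" "i2 \<in> ends e2" "V i2 \<in> C" "j2 \<in> ends e2" "V j2 \<in> q2"
  shows "ncomp n E + 2 \<le> ncomp n H"
proof -
  have "V i1 \<in> up C" "V i2 \<in> up C" using up(2)[OF C(1)] e1 e2 by auto
  then have "V j1 \<in> up C" "V j2 \<in> up C"
    using E.ends_connected[OF e1(1) up(1)[OF C(1)] e1(2) _ e1(4)]
      E.ends_connected[OF e2(1) up(1)[OF C(1)] e2(2) _ e2(4)] by auto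
  then have eq: "up q1 = up C" "up q2 = up C" using up_eqI up(1)[OF C(1)] C e1(5) e2(5) by blast+
  have "comps n E \<subseteq> up ` (comps n H - {q1, q2})"
  proof
    fix K assume K: "K \<in> comps n E"
    obtain i where i: "V i \<in> K" "i \<in> {1..n}" using E.comps_vertex[OF K] by blast
    have *: "H.cls (V i) \<in> comps n H" "V i \<in> H.cls (V i)"
      using H.cls_in_comps H.cls_self V_mem_Vs[OF i(2)] by auto
    then have "up (H.cls (V i)) = K" using up_eqI K i by blast
    then show "K \<in> up ` (comps n H - {q1, q2})" using * eq C by (cases "H.cls (V i) \<in> {q1, q2}") auto
  qed
  then have "card (comps n E) \<le> card (up ` (comps n H - {q1, q2}))"
    by (intro card_mono) (use H.finite_comps in auto)
  also have "\<dots> \<le> card (comps n H - {q1, q2})" by (intro card_image_le) (use H.finite_comps in auto)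
  also have "\<dots> = card (comps n H) - 2" using C H.finite_comps by (subst card_Diff_subset) auto
  finally have "card (comps n E) \<le> card (comps n H) - 2" .
  moreover have "2 \<le> card (comps n H)"
    using card_mono[OF H.finite_comps, of "{q1, q2}"] C by auto
  ultimately show ?thesis unfolding ncomp_def by linarith
qed

end

text \<open>A proper face of codimension one with supporting functional \<open>\<sigma>\<close>. The
  codimension is expressed by \<open>dep\<close>: on the edges of \<open>E\<close>, every functional
  vanishing on \<open>H\<close> is a rational multiple of \<open>\<sigma>\<close>.\<close>

locale ray_face = subgraph_pair +
  fixes \<sigma> :: "nat \<Rightarrow> int"
  assumes \<sigma>_zero: "\<And>e. e \<in> H \<Longrightarrow> lin \<sigma> (rho e) = 0"
    and \<sigma>_pos: "\<And>e. e \<in> E - H \<Longrightarrow> 0 < lin \<sigma> (rho e)"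
    and dep: "\<And>y. (\<And>e. e \<in> H \<Longrightarrow> lin y (rho e) = 0) \<Longrightarrow>
      \<exists>p q. p \<noteq> 0 \<and> (\<forall>e\<in>E. p * lin y (rho e) = q * lin \<sigma> (rho e))"
    and proper: "E - H \<noteq> {}"
begin

text \<open>By \<open>dep\<close> the functional of the component is a rational multiple of
  \<open>\<sigma>\<close> on \<open>E\<close>, and exchanging the sides makes a nonzero multiple
  positive. If the multiple were 0, a touching edge would have value 0, hence both ends in
  \<open>C\<close>, where \<open>\<sigma>\<close> is proportional to the functional and would vanish
  on that edge too.\<close>

lemma touched_bipartite:
  assumes C: "C \<in> comps n H" "bipartite H.AE C" "touched C"
  shows "\<exists>L R. is_bipartition H.AE C L R \<and> (\<forall>e\<in>E - H. 0 < lin (sg L R) (rho e))"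
proof -
  obtain L R where LR: "is_bipartition H.AE C L R" using C(2) unfolding bipartite_def by blast
  obtain p q where pq: "p \<noteq> 0" "\<And>e. e \<in> E \<Longrightarrow> p * lin (sg L R) (rho e) = q * lin \<sigma> (rho e)"
    using dep[of "sg L R"] H.lin_sg_rho[OF C(1) LR] by blast
  have "q \<noteq> 0"
  proof
    assume "q = 0"
    obtain e i where e: "e \<in> E - H" "i \<in> ends e" "V i \<in> C" using C(3) unfolding touched_def by blast
    then have y0: "lin (sg L R) (rho e) = 0" using pq(2)[of e] pq(1) \<open>q = 0\<close> by simp
    obtain c where c: "\<And>i. V i \<in> C \<Longrightarrow> \<sigma> i = c * sg L R i"
      using H.proportional_on_bipartite[of \<sigma>, OF \<sigma>_zero C(1) LR] by blast
    have "V j \<in> C" if "j \<in> ends e" for j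
      using lin_rho_ends[OF y0 e(2) _ that] sg_nonzero[OF LR] e(3) by blast
    then have "lin \<sigma> (rho e) = c * lin (sg L R) (rho e)" using c by (intro lin_rho_scale) auto
    then show False using \<sigma>_pos[OF e(1)] y0 by simp
  qed
  show ?thesis
  proof (cases "0 < p * q")
    case True
    have "0 < lin (sg L R) (rho e)" if "e \<in> E - H" for e
    proof -
      have "p * p * lin (sg L R) (rho e) = (p * q) * lin \<sigma> (rho e)"
        using pq(2)[of e] that by (simp add: mult.assoc)
      also have "0 < \<dots>" using True \<sigma>_pos[OF that] by simp
      finally have "0 < p * p * lin (sg L R) (rho e)" .
      then show ?thesis by (metis mult_nonneg_nonpos not_le zero_le_square)
    qed
    then show ?thesis using LR by blast
  next
    case False
    then have neg: "p * q < 0" using pq(1) \<open>q \<noteq> 0\<close> by (metis linorder_neqE_linordered_idom mult_eq_0_iff)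
    have "0 < lin (sg R L) (rho e)" if "e \<in> E - H" for e
    proof -
      have "p * p * lin (sg L R) (rho e) = (p * q) * lin \<sigma> (rho e)"
        using pq(2)[of e] that by (simp add: mult.assoc)
      also have "\<dots> < 0" using neg \<sigma>_pos[OF that] by (rule mult_neg_pos)
      finally have "p * p * lin (sg L R) (rho e) < 0" .
      then have "lin (sg L R) (rho e) < 0" by (metis mult_nonneg_nonneg not_le zero_le_square)
      then show ?thesis using lin_sg_swap[OF LR] by simp
    qed
    then show ?thesis using H.bipartition_swap[OF LR] by blast
  qed
qed

definition D where "D = {C \<in> comps n H. bipartite H.AE C \<and> touched C}"

lemma D_meets_edge:
  assumes "C \<in> D" "e \<in> E - H"
  obtains i where "i \<in> ends e" "V i \<in> C"
proof -
  obtain L R where LR: "is_bipartition H.AE C L R" "0 < lin (sg L R) (rho e)"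
    using touched_bipartite[of C] assms unfolding D_def by blast
  show ?thesis by (rule lin_sg_touches[OF LR(1)]) (use LR(2) that in auto)
qed

lemma D_nonempty: "D \<noteq> {}"
proof -
  obtain e where e: "e \<in> E - H" using proper by blast
  then have "lin \<sigma> (rho e) \<noteq> 0" using \<sigma>_pos by fastforce
  then obtain i where i: "i \<in> ends e" "\<sigma> i \<noteq> 0" using lin_rho_zero by blast
  have Vi: "V i \<in> H.Vs" using E_ends_Vs e i by blast
  have "bipartite H.AE (H.cls (V i))"
    by (rule H.bipartite_if_nonzero[of \<sigma>, OF \<sigma>_zero H.cls_in_comps[OF Vi] H.cls_self[OF Vi] i(2)])
  moreover have "touched (H.cls (V i))" unfolding touched_def using e i H.cls_self[OF Vi] by blast
  ultimately show ?thesis unfolding D_def using H.cls_in_comps[OF Vi] by blast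
qed

lemma up_D:
  assumes "C \<in> D" "C' \<in> D"
  shows "up C = up C'"
proof -
  obtain e where e: "e \<in> E - H" using proper by blast
  obtain i j where i: "i \<in> ends e" "V i \<in> C" "j \<in> ends e" "V j \<in> C'"
    using D_meets_edge assms e by metis
  have C: "C \<in> comps n H" "C' \<in> comps n H" using assms by (auto simp: D_def)
  have "V j \<in> up C" using E.ends_connected[OF _ up(1)[OF C(1)] i(1) _ i(3)] up(2)[OF C(1)] i e by blast
  then show ?thesis using up_eqI[OF C(2) up(1)[OF C(1)] i(4)] by simp
qed

text \<open>Every outside edge meets every member of \<open>D\<close>, and it has at most two
  ends.\<close>

lemma card_D_le: "finite D" "card D \<le> 2"
proof -
  obtain e where e: "e \<in> E - H" using proper by blast
  have "D \<subseteq> (\<lambda>i. H.cls (V i)) ` ends e"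
  proof
    fix C assume C: "C \<in> D"
    obtain i where "i \<in> ends e" "V i \<in> C" using D_meets_edge[OF C e] by blast
    then show "C \<in> (\<lambda>i. H.cls (V i)) ` ends e" using C H.comps_cls unfolding D_def by blast
  qed
  note sub_D = this
  show "finite D" by (rule finite_subset[OF sub_D finite_imageI[OF ends_finite(1)]])
  show "card D \<le> 2" using surj_card_le[OF ends_finite(1) sub_D] ends_finite(2)[of e] by linarith
qed

text \<open>Let K be the component of \<open>E\<close> containing \<open>C0\<close>. If K is
  bipartite, its functional vanishes on \<open>E\<close> and shows that all original vertices of K
  lie in members of \<open>D\<close>. A single member would then contain an outside edge, and by
  proportionality its functional would be 0 there as well as positive. If K is not bipartite, two
  members would yield functionals proportional on \<open>E\<close>, and a nonzero combination
  vanishing on \<open>E\<close> would make K bipartite.\<close>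

lemma card_D:
  assumes C0: "C0 \<in> D"
  shows "card D = (if bipartite E.AE (up C0) then 2 else 1)"
proof -
  have C: "C0 \<in> comps n H" and K: "up C0 \<in> comps n E" "C0 \<subseteq> up C0"
    using C0 up unfolding D_def by auto
  obtain e where e: "e \<in> E - H" using proper by blast
  have "card D \<noteq> 0" using card_D_le D_nonempty by simp
  moreover have "card D \<noteq> 1" if b: "bipartite E.AE (up C0)"
  proof
    assume "card D = 1"
    then have D: "D = {C0}" using C0 by (auto simp: card_1_singleton_iff)
    obtain L R where LR: "is_bipartition E.AE (up C0) L R" using b unfolding bipartite_def by blast
    have zero: "\<And>e. e \<in> E \<Longrightarrow> lin (sg L R) (rho e) = 0" by (rule E.lin_sg_rho[OF K(1) LR])
    then have zeroH: "\<And>e. e \<in> H \<Longrightarrow> lin (sg L R) (rho e) = 0" using sub by blast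
    have inC0: "V i \<in> C0" if i: "V i \<in> up C0" "i \<in> {1..n}" for i
    proof -
      have Vi: "V i \<in> H.Vs" by (rule V_mem_Vs[OF i(2)])
      let ?C = "H.cls (V i)"
      have c: "?C \<in> comps n H" "V i \<in> ?C" using H.cls_in_comps[OF Vi] H.cls_self[OF Vi] by auto
      have "bipartite H.AE ?C"
        by (rule H.bipartite_if_nonzero[of "sg L R", OF zeroH c]) (use sg_nonzero[OF LR] i in auto)
      moreover have "touched ?C"
      proof (rule ccontr)
        assume un: "\<not> touched ?C"
        have "?C = up C0" using E.comps_disjoint[OF untouched_comp(1)[OF c(1) un] K(1) c(2) i(1)] .
        then show False using un C0 K(2) unfolding touched_def D_def by blast
      qed
      ultimately have "?C \<in> D" using c unfolding D_def by blast
      then show ?thesis using c D by auto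
    qed
    obtain i where i: "i \<in> ends e" "V i \<in> C0" using D_meets_edge[OF C0 e] by blast
    have all: "V j \<in> C0" if "j \<in> ends e" for j
      using inC0 E.ends_connected[OF _ K(1) i(1) _ that] i K(2) e E.ends_range[of e j] that by blast
    obtain L' R' where LR': "is_bipartition H.AE C0 L' R'" "0 < lin (sg L' R') (rho e)"
      using touched_bipartite[of C0] C0 e unfolding D_def by blast
    obtain c where c: "\<And>i. V i \<in> C0 \<Longrightarrow> sg L R i = c * sg L' R' i"
      using H.proportional_on_bipartite[of "sg L R", OF zeroH C LR'(1)] by blast
    have "lin (sg L R) (rho e) = c * lin (sg L' R') (rho e)" using all c by (intro lin_rho_scale) auto
    then have "c = 0" using zero[of e] e LR'(2) by auto
    then have "sg L R i = 0" using c[OF i(2)] by simp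
    then show False using sg_nonzero[OF LR] i K(2) by blast
  qed
  moreover have "card D \<noteq> 2" if nb: "\<not> bipartite E.AE (up C0)"
  proof
    assume "card D = 2"
    then obtain C1 C2 where D: "C1 \<in> D" "C2 \<in> D" "C1 \<noteq> C2" by (auto simp: card_2_iff)
    then have C12: "C1 \<in> comps n H" "C2 \<in> comps n H" by (auto simp: D_def)
    obtain L1 R1 where 1: "is_bipartition H.AE C1 L1 R1"
      using touched_bipartite[of C1] D unfolding D_def by blast
    obtain L2 R2 where 2: "is_bipartition H.AE C2 L2 R2" "0 < lin (sg L2 R2) (rho e)"
      using touched_bipartite[of C2] D e unfolding D_def by blast
    obtain p1 q1 where pq1: "p1 \<noteq> 0" "\<And>e. e \<in> E \<Longrightarrow> p1 * lin (sg L1 R1) (rho e) = q1 * lin \<sigma> (rho e)"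
      using dep[of "sg L1 R1"] H.lin_sg_rho[OF C12(1) 1] by blast
    obtain p2 q2 where pq2: "p2 \<noteq> 0" "\<And>e. e \<in> E \<Longrightarrow> p2 * lin (sg L2 R2) (rho e) = q2 * lin \<sigma> (rho e)"
      using dep[of "sg L2 R2"] H.lin_sg_rho[OF C12(2) 2(1)] by blast
    have "q2 \<noteq> 0" using pq2(2)[of e] pq2(1) 2(2) e by auto
    \<comment> \<open>The coefficients cancel the multiples of \<open>\<sigma>\<close> to which both
      functionals amount on \<open>E\<close>. As \<open>C1\<close> and \<open>C2\<close> are
      disjoint, the combination does not vanish on \<open>C1\<close>.\<close>
    let ?w = "\<lambda>i. (q2 * p1) * sg L1 R1 i + (- (q1 * p2)) * sg L2 R2 i"
    have w0: "lin ?w (rho f) = 0" if "f \<in> E" for f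
    proof -
      have "lin ?w (rho f) = q2 * (p1 * lin (sg L1 R1) (rho f)) - q1 * (p2 * lin (sg L2 R2) (rho f))"
        unfolding lin_combine by (simp add: mult.assoc)
      then show ?thesis unfolding pq1(2)[OF that] pq2(2)[OF that] by simp
    qed
    obtain i where i: "V i \<in> C1" using H.comps_vertex[OF C12(1)] by blast
    then have "V i \<notin> C2" using H.comps_disjoint[OF C12] D(3) by blast
    then have "?w i \<noteq> 0" using sg_nonzero[OF 1, of i] sg_nonzero[OF 2(1), of i] i \<open>q2 \<noteq> 0\<close> pq1(1) by auto
    moreover have "V i \<in> up C0" using up(2)[OF C12(1)] up_D[OF D(1) C0] i by blast
    ultimately have "bipartite E.AE (up C0)" using E.bipartite_if_nonzero[of ?w, OF w0 K(1)] by blast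
    then show False using nb by blast
  qed
  ultimately show ?thesis using card_D_le(2) by (auto simp: le_Suc_eq numeral_2_eq_2)
qed

text \<open>Apart from \<open>D\<close>, the bipartite components of \<open>H\<close> are those of
  \<open>E\<close> other than the one containing \<open>D\<close>. If that one is bipartite it is
  replaced by two; if not, one bipartite component is gained.\<close>

lemma nbicomp_eq: "nbicomp n H = nbicomp n E + 1"
proof -
  obtain C0 where C0: "C0 \<in> D" using D_nonempty by blast
  have C: "C0 \<in> comps n H" and K: "up C0 \<in> comps n E" "C0 \<subseteq> up C0"
    using C0 up unfolding D_def by auto
  let ?BH = "{C \<in> comps n H. bipartite H.AE C}" and ?BE = "{C \<in> comps n E. bipartite E.AE C}"
  have eq: "?BH - D = ?BE - {up C0}"
  proof (intro equalityI subsetI)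
    fix C' assume "C' \<in> ?BH - D"
    then have C': "C' \<in> comps n H" "bipartite H.AE C'" "\<not> touched C'" unfolding D_def by auto
    have "C' \<noteq> up C0" using C'(3) C0 K(2) unfolding D_def touched_def by blast
    then show "C' \<in> ?BE - {up C0}" using untouched_comp(1) untouched_bipartite(2) C' by blast
  next
    fix K' assume "K' \<in> ?BE - {up C0}"
    then have K': "K' \<in> comps n E" "bipartite E.AE K'" "K' \<noteq> up C0" by auto
    obtain i where i: "V i \<in> K'" "i \<in> {1..n}" using E.comps_vertex[OF K'(1)] by blast
    let ?C = "H.cls (V i)"
    have c: "?C \<in> comps n H" "V i \<in> ?C" using H.cls_in_comps H.cls_self V_mem_Vs[OF i(2)] by auto
    have "?C \<subseteq> K'" by (rule comp_sub_E_comp[OF c(1) K'(1) c(2) i(1)])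
    have un: "\<not> touched ?C"
    proof
      assume "touched ?C"
      then obtain e j where e: "e \<in> E - H" "j \<in> ends e" "V j \<in> ?C" unfolding touched_def by blast
      obtain k where k: "k \<in> ends e" "V k \<in> C0" using D_meets_edge[OF C0 e(1)] by blast
      have "V k \<in> K'" using E.ends_connected[OF _ K'(1) e(2) _ k(1)] e \<open>?C \<subseteq> K'\<close> by blast
      then show False using E.comps_disjoint[OF K'(1) K(1)] k K(2) K'(3) by blast
    qed
    have "?C = K'" by (rule E.comps_disjoint[OF untouched_comp(1)[OF c(1) un] K'(1) c(2) i(1)])
    then show "K' \<in> ?BH - D" using untouched_bipartite(2)[OF c(1) un] K' c un unfolding D_def by auto
  qed
  have "card ?BH = card D + card (?BH - D)"
  proof -
    have "D \<subseteq> ?BH" by (auto simp: D_def)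
    moreover have "finite ?BH" using H.finite_comps by simp
    ultimately show ?thesis using card_D_le(1) card_Diff_subset[of D ?BH] card_mono[of ?BH D] by linarith
  qed
  moreover have "card ?BE = card (?BE - {up C0}) + (if bipartite E.AE (up C0) then 1 else 0)"
  proof (cases "bipartite E.AE (up C0)")
    case True
    then have "up C0 \<in> ?BE" using K by blast
    then have "card ?BE = Suc (card (?BE - {up C0}))"
      using E.finite_comps by (intro card.remove) auto
    then show ?thesis using True by simp
  next
    case False
    then have "?BE - {up C0} = ?BE" by blast
    then show ?thesis using False by simp
  qed
  ultimately show ?thesis unfolding nbicomp_def eq card_D[OF C0] by auto
qed

lemma facet: "facet_subgraph n E H"
  unfolding facet_subgraph_iff using nbicomp_eq touched_bipartite by blast

text \<open>If all outside edges stay in \<open>C\<close>, they all have value 2 and any of them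
  serves. Otherwise \<open>e0\<close> leaves \<open>C\<close> for a component \<open>?q\<close>; a
  third component would violate the bound, so all outside edges have their ends in \<open>C\<close>
  and \<open>?q\<close>. The multiple \<open>c\<close> is then the value of the functional of
  \<open>C\<close>, 1 or 2.\<close>

lemma generator:
  assumes le: "ncomp n H \<le> ncomp n E + 1"
  shows "\<exists>e0\<in>E - H. \<forall>e\<in>E - H. \<exists>c\<ge>1. rho e - frag_cmul c (rho e0) \<in> edge_group H"
proof -
  obtain C where D: "C \<in> D" using D_nonempty by blast
  then have C: "C \<in> comps n H" by (simp add: D_def)
  obtain L R where LR: "is_bipartition H.AE C L R" and pos: "\<And>e. e \<in> E - H \<Longrightarrow> 0 < lin (sg L R) (rho e)"
    using touched_bipartite[of C] D unfolding D_def by blast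
  let ?y = "sg L R"
  \<comment> \<open>By \<open>dep\<close>, vanishing of the one functional \<open>?y\<close> on
    \<open>w\<close> forces vanishing for every bipartite component; only parities on components
    other than \<open>C\<close> remain.\<close>
  have edge_groupI': "w \<in> edge_group H" if w: "w \<in> edge_group E" "lin ?y w = 0"
    and par: "\<And>K. K \<in> comps n H \<Longrightarrow> K \<noteq> C \<Longrightarrow> even (lin (ind K) w)" for w
  proof (rule H.edge_group_memI[OF E.keys_gp[OF w(1)]])
    fix K L' R' assume K: "K \<in> comps n H" "is_bipartition H.AE K L' R'"
    have scale: "p * lin y w = q * lin \<sigma> w" if "\<And>e. e \<in> E \<Longrightarrow> p * lin y (rho e) = q * lin \<sigma> (rho e)" for p q y
      using lin_gp_zero[of E "\<lambda>i. p * y i + (- q) * \<sigma> i", OF _ w(1)] that unfolding lin_combine by simp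
    obtain p q where pq: "p \<noteq> 0" "\<And>e. e \<in> E \<Longrightarrow> p * lin ?y (rho e) = q * lin \<sigma> (rho e)"
      using dep[of ?y] H.lin_sg_rho[OF C LR] by blast
    obtain p' q' where pq': "p' \<noteq> 0" "\<And>e. e \<in> E \<Longrightarrow> p' * lin (sg L' R') (rho e) = q' * lin \<sigma> (rho e)"
      using dep[of "sg L' R'"] H.lin_sg_rho[OF K] by blast
    obtain e where "e \<in> E - H" using proper by blast
    then have "q \<noteq> 0" using pq(1) pq(2)[of e] pos[of e] by auto
    then have "lin \<sigma> w = 0" using scale[OF pq(2)] w(2) by simp
    then show "lin (sg L' R') w = 0" using scale[OF pq'(2)] pq'(1) by simp
  next
    fix K assume "K \<in> comps n H" "\<not> bipartite H.AE K"
    moreover from this have "K \<noteq> C" using LR unfolding bipartite_def by blast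
    ultimately show "even (lin (ind K) w)" using par by blast
  qed
  show ?thesis
  proof (cases "\<forall>e\<in>E - H. \<forall>i\<in>ends e. V i \<in> C")
    case True
    obtain e0 where e0: "e0 \<in> E - H" using proper by blast
    have "rho e - frag_cmul 1 (rho e0) \<in> edge_group H" if e: "e \<in> E - H" for e
    proof (rule edge_groupI')
      show "rho e - frag_cmul 1 (rho e0) \<in> edge_group E" using e e0 by (auto intro: edge_group_diff edge_group_rho)
      show "lin ?y (rho e - frag_cmul 1 (rho e0)) = 0"
        using lin_sg_pos_cases(2)[OF LR pos] True e e0 by (simp add: lin_diff)
      fix K assume K: "K \<in> comps n H" "K \<noteq> C"
      have "lin (ind K) (rho f) = 0" if "f \<in> E - H" for f
        using True that H.comps_disjoint[OF K(1) C] K(2) by (intro lin_rho_zero) (auto simp: ind_def)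
      then show "even (lin (ind K) (rho e - frag_cmul 1 (rho e0)))" using e e0 by (simp add: lin_diff)
    qed
    then show ?thesis using e0 by (metis order_refl)
  next
    case False
    then obtain e0 i0 where e0: "e0 \<in> E - H" "i0 \<in> ends e0" "V i0 \<notin> C" by blast
    have Vi: "V i0 \<in> H.Vs" using E_ends_Vs e0 by blast
    let ?q = "H.cls (V i0)"
    have q: "?q \<in> comps n H" "V i0 \<in> ?q" "?q \<noteq> C" using H.cls_in_comps[OF Vi] H.cls_self[OF Vi] e0 by auto
    have cover: "V i \<in> C \<union> ?q" if e: "e \<in> E - H" "i \<in> ends e" for e i
    proof (rule ccontr)
      assume i: "V i \<notin> C \<union> ?q"
      have Vi: "V i \<in> H.Vs" using E_ends_Vs e by blast
      have q': "H.cls (V i) \<in> comps n H" "V i \<in> H.cls (V i)"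
        using H.cls_in_comps[OF Vi] H.cls_self[OF Vi] by auto
      obtain k k0 where "k \<in> ends e" "V k \<in> C" "k0 \<in> ends e0" "V k0 \<in> C"
        using D_meets_edge[OF D] e(1) e0(1) by metis
      then have "ncomp n E + 2 \<le> ncomp n H"
        using ncomp_ge_merge[OF C q(1) q'(1), of e0 k0 i0 e k i] q q' i e e0 by blast
      then show False using le by simp
    qed
    have y0: "lin ?y (rho e0) = 1" using lin_sg_pos_cases(1)[OF LR pos[OF e0(1)]] e0 by blast
    have "rho e - frag_cmul (lin ?y (rho e)) (rho e0) \<in> edge_group H" (is "?w \<in> _") if e: "e \<in> E - H" for e
    proof (rule edge_groupI')
      show "?w \<in> edge_group E" using e e0 by (auto intro: edge_group_diff edge_group_rho edge_group_frag_cmul)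
      show y: "lin ?y ?w = 0" by (simp add: lin_diff lin_frag_cmul y0)
      fix K assume K: "K \<in> comps n H" "K \<noteq> C"
      show "even (lin (ind K) ?w)"
      proof (cases "K = ?q")
        case True
        \<comment> \<open>Edges with all ends in \<open>C\<close> and \<open>?q\<close> have equal
          parity on both, and on \<open>C\<close> the parity is that of \<open>?y\<close>, which is
          0 on the vector \<open>?w\<close>.\<close>
        have "even (lin (ind C) (rho f) + lin (ind K) (rho f))" if "f \<in> E - H" for f
          using True cover[OF that] H.comps_disjoint[OF K(1) C] K(2) by (intro lin_ind_disjoint_even) auto
        from this[OF e] this[OF e0(1)] show ?thesis 
          using H.lin_ind_sg[OF C LR, of "rho e"] H.lin_ind_sg[OF C LR, of "rho e0"] y0
          by (auto simp: lin_diff lin_frag_cmul)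
      next
        case False
        have "lin (ind K) (rho f) = 0" if f: "f \<in> E - H" for f
        proof (rule lin_rho_zero)
          fix i assume "i \<in> ends f"
          then have "V i \<in> C \<union> ?q" using cover f by blast
          then have "V i \<notin> K" using H.comps_disjoint[OF K(1) C] H.comps_disjoint[OF K(1) q(1)] K(2) False by blast
          then show "ind K i = 0" by (simp add: ind_def)
        qed
        from this[OF e] this[OF e0(1)] show ?thesis by (simp add: lin_diff lin_frag_cmul)
      qed
    qed
    moreover have "1 \<le> lin ?y (rho e)" if "e \<in> E - H" for e using pos[OF that] by simp
    ultimately show ?thesis using e0 by blast
  qed
qed

end

section \<open>The edge ring\<close>

abbreviation xpow :: "'a \<Rightarrow> ('a \<Rightarrow>\<^sub>0 'k::field)" where
  "xpow v \<equiv> Poly_Mapping.single v 1"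

lemma xpow_add: "xpow (u + v) = xpow u * (xpow v :: 'a::monoid_add \<Rightarrow>\<^sub>0 'k::field)"
  by (simp add: mult_single)

lemma xpow_scale: "xpow (frag_cmul (int k) u) = (xpow u ^ k :: (nat \<Rightarrow>\<^sub>0 int) \<Rightarrow>\<^sub>0 'k::field)"
proof (induction k)
  case (Suc k)
  have "frag_cmul (int (Suc k)) u = u + frag_cmul (int k) u"
    using frag_cmul_distrib[of 1 "int k" u] by simp
  then show ?case using Suc by (simp add: mult_single[symmetric] xpow_add)
qed simp

lemma xpow_nonzero: "(xpow v :: 'a \<Rightarrow>\<^sub>0 'k::field) \<noteq> 0"
  by (metis lookup_single_eq lookup_zero zero_neq_one)

lemma prime_of_power:
  assumes A: "subring_set A" and P: "prime_of A P" and "x \<in> A" "x ^ k \<in> P"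
  shows "x \<in> P"
  using assms(4)
proof (induction k)
  case 0
  then show ?case using prime_ofD(2)[OF P] by simp
next
  case (Suc k)
  then show ?case using prime_ofD(3)[OF P assms(3) subring_setD(7)[OF A assms(3)]] by auto
qed

lemma edge_monoid_frag_cmul:
  assumes "v \<in> edge_monoid E" "0 \<le> c"
  shows "frag_cmul c v \<in> edge_monoid E"
proof -
  have "frag_cmul (int k) v \<in> edge_monoid E" for k
  proof (induction k)
    case (Suc k)
    then have "v + frag_cmul (int k) v \<in> edge_monoid E" by (rule edge_monoid_add[OF assms(1)])
    then show ?case using frag_cmul_distrib[of 1 "int k" v] by simp
  qed (simp add: edge_monoid_0)
  from this[of "nat c"] show ?thesis using assms(2) by simp
qed

lemma edge_monoid_sum: "(\<And>i. i \<in> X \<Longrightarrow> f i \<in> edge_monoid E) \<Longrightarrow> sum f X \<in> edge_monoid E"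
  by (induction X rule: infinite_finite_induct) (auto simp: edge_monoid_0 edge_monoid_add)

lemma semigroup_ring_mon: "semigroup_ring (edge_monoid E)"
  by unfold_locales (auto simp: edge_monoid_0 edge_monoid_add)

text \<open>Multiply by the twist: if \<open>F0\<close> and \<open>F1\<close> are the even and odd parts of \<open>F\<close>, then
  \<open>(F0 + F1) * (F0 - F1) = F0\<^sup>2 - F1\<^sup>2\<close> has only even exponents.\<close>

lemma (in semigroup_ring) exists_even_element:
  fixes X :: "('a \<Rightarrow> int) set"
  assumes Q: "prime_of A Q" "Q \<noteq> {0}" and X: "finite X"
    and add: "\<And>\<chi> u v. \<chi> \<in> X \<Longrightarrow> \<chi> (u + v) = \<chi> u + \<chi> v"
  shows "\<exists>F\<in>Q. F \<noteq> 0 \<and> (\<forall>v\<in>keys F. \<forall>\<chi>\<in>X. even (\<chi> v))"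
  using X add
proof (induction X rule: finite_induct)
  case empty
  then show ?case using Q(2) ideal_ofD(2)[OF prime_ofD(1)[OF Q(1)]] by auto
next
  case (insert \<chi> X)
  then obtain F where F: "F \<in> Q" "F \<noteq> 0" "\<And>v \<chi>. v \<in> keys F \<Longrightarrow> \<chi> \<in> X \<Longrightarrow> even (\<chi> v)" by blast
  note QD = ideal_ofD[OF prime_ofD(1)[OF Q(1)]]
  define F0 F1 where "F0 = restr (\<lambda>v. even (\<chi> v)) F" and "F1 = restr (\<lambda>v. \<not> even (\<chi> v)) F"
  have split: "F = F0 + F1" unfolding F0_def F1_def by (rule restr_split)
  have FA: "F0 \<in> A" "F1 \<in> A" using A_restr QD(1)[OF F(1)] by (auto simp: F0_def F1_def)
  let ?G = "F * (F0 - F1)"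
  have "F0 - F1 \<noteq> 0"
  proof
    assume eq: "F0 - F1 = 0"
    have "F = 0"
    proof (rule poly_mapping_eqI)
      fix v
      have "lookup (F0 - F1) v = 0" using eq by simp
      then show "lookup F v = lookup 0 v"
        by (cases "even (\<chi> v)") (auto simp: F0_def F1_def lookup_minus lookup_restr)
    qed
    then show False using F(2) by simp
  qed
  then have "?G \<noteq> 0" using F(2) by simp
  moreover have "?G \<in> Q" using QD(5)[OF AD(6)[OF FA] F(1)] .
  moreover have "even (\<chi>' v)" if v: "v \<in> keys ?G" and \<chi>': "\<chi>' \<in> insert \<chi> X" for v \<chi>'
  proof (cases "\<chi>' = \<chi>")
    case True
    have "?G = F0 * F0 - F1 * F1" unfolding split by (simp add: algebra_simps)
    then have "v \<in> keys (F0 * F0) \<or> v \<in> keys (F1 * F1)" using v keys_diff[of "F0 * F0" "F1 * F1"] by auto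
    then show ?thesis
      unfolding True using insert.prems[of \<chi>] by (auto elim!: keys_multE simp: F0_def F1_def keys_restr)
  next
    case False
    obtain a b where ab: "v = a + b" "a \<in> keys F" "b \<in> keys (F0 - F1)" using v by (rule keys_multE)
    have "b \<in> keys F" using ab(3) keys_diff[of F0 F1] by (auto simp: F0_def F1_def keys_restr)
    then show ?thesis using insert.prems[OF \<chi>'] F(3) ab False \<chi>' by auto
  qed
  ultimately show ?case by blast
qed

text \<open>The situation behind a subgraph violating the bound: \<open>C\<close> is the only
  touched bipartite component, and the outside edge \<open>e1\<close> leaves it. As
  \<open>e1\<close> has height 1 for the functional, its multiples can compensate any
  height.\<close>

locale positive_face = subgraph_pair +
  fixes C L R e1
  assumes C: "C \<in> comps n H" and LR: "is_bipartition H.AE C L R"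
    and pos: "\<And>e. e \<in> E - H \<Longrightarrow> 0 < lin (sg L R) (rho e)"
    and e1: "e1 \<in> E - H" "lin (sg L R) (rho e1) = 1"
    and untouched: "\<And>K. K \<in> comps n H \<Longrightarrow> K \<noteq> C \<Longrightarrow> bipartite H.AE K \<Longrightarrow> \<not> touched K"
begin

abbreviation "y \<equiv> sg L R"

lemma y_rho_nonneg: "e \<in> E \<Longrightarrow> 0 \<le> lin y (rho e)"
  using H.lin_sg_rho[OF C LR] pos[of e] by (cases "e \<in> H") auto

lemma y_zero_mon:
  assumes "v \<in> edge_monoid E" "lin y v = 0"
  shows "v \<in> edge_monoid H"
proof -
  have "v \<in> edge_monoid {e \<in> E. lin y (rho e) = 0}" by (rule lin_mon_face[OF y_rho_nonneg assms])
  moreover have "{e \<in> E. lin y (rho e) = 0} \<subseteq> H" using pos by fastforce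
  ultimately show ?thesis using edge_monoid_mono by blast
qed

lemma y_mon_H: "v \<in> edge_monoid H \<Longrightarrow> lin y v = 0"
  by (rule lin_mon_zero[OF H.lin_sg_rho[OF C LR]])

text \<open>Untouched bipartite components are components of \<open>E\<close> as well, so their
  functionals vanish on \<open>edge_group E\<close>. What is left is the value on \<open>C\<close>,
  determined by \<open>y\<close> up to a factor, and the parities.\<close>

lemma edge_group_even:
  assumes v: "v \<in> edge_group E" "lin y v = 0" "\<And>K. K \<in> comps n H \<Longrightarrow> even (lin (ind K) v)"
  shows "v \<in> edge_group H"
proof (rule H.edge_group_memI[OF E.keys_gp[OF v(1)]])
  fix K L' R' assume K: "K \<in> comps n H" "is_bipartition H.AE K L' R'"
  show "lin (sg L' R') v = 0"
  proof (cases "K = C")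
    case True
    obtain c where c: "\<And>i. V i \<in> C \<Longrightarrow> sg L' R' i = c * y i"
      using H.proportional_on_bipartite[of "sg L' R'", OF H.lin_sg_rho[OF K] C LR] by blast
    have "sg L' R' i = c * y i" for i
      using c sg_nonzero[OF LR, of i] sg_nonzero[OF K(2), of i] True by (cases "V i \<in> C") auto
    then have "sg L' R' = (\<lambda>i. c * y i + 0 * y i)" by auto
    then have "lin (sg L' R') v = c * lin y v + 0 * lin y v" by (simp only: lin_combine)
    then show ?thesis using v(2) by simp
  next
    case False
    then have un: "\<not> touched K" using untouched K unfolding bipartite_def by blast
    show ?thesis
      by (rule lin_gp_zero[OF E.lin_sg_rho[OF untouched_comp(1)[OF K(1) un]] v(1)])
        (use untouched_bipartite(1)[OF K(1) un] K(2) in auto)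
  qed
qed (use v(3) in blast)

text \<open>A nonzero element of \<open>Q\<close> with even exponents has, up to a monomial of the face, the form
  \<open>x^v0 * G\<close> with \<open>v0\<close> an exponent of minimal height and \<open>G\<close> outside \<open>P\<close>; so \<open>Q\<close> contains the monomial \<open>x^v0\<close>.\<close>

lemma face_prime_minimal:
  fixes Q :: "((nat \<Rightarrow>\<^sub>0 int) \<Rightarrow>\<^sub>0 'k::field) set"
  defines "A \<equiv> sring (edge_monoid E)"
  defines "P \<equiv> {f \<in> A. \<forall>v\<in>keys f. 0 < lin y v}"
  assumes Q: "prime_of A Q" "Q \<subseteq> P" "Q \<noteq> {0}"
  shows "Q = P"
proof
  interpret semigroup_ring "edge_monoid E" A unfolding A_def by (rule semigroup_ring_mon)
  note QD = ideal_ofD[OF prime_ofD(1)[OF Q(1)]]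
  \<comment> \<open>Even exponents make the parity conditions of \<open>edge_group_even\<close>
    automatic for differences of exponents of \<open>F\<close>.\<close>
  have "\<exists>F\<in>Q. F \<noteq> 0 \<and> (\<forall>v\<in>keys F. \<forall>\<chi>\<in>(\<lambda>K. lin (ind K)) ` comps n H. even (\<chi> v))"
    by (rule exists_even_element[OF Q(1,3)]) (use H.finite_comps in \<open>auto simp: lin_add\<close>)
  then obtain F where F: "F \<in> Q" "F \<noteq> 0" 
    and ev: "\<And>v K. v \<in> keys F \<Longrightarrow> K \<in> comps n H \<Longrightarrow> even (lin (ind K) v)" by blast
  have FE: "keys F \<subseteq> edge_monoid E" using QD(1)[OF F(1)] A_iff by blast
  have ne: "lin y ` keys F \<noteq> {}" "finite (lin y ` keys F)" using F(2) by auto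
  obtain v0 where v0: "v0 \<in> keys F" "lin y v0 = Min (lin y ` keys F)" using Min_in[OF ne(2,1)] by auto
  have min: "lin y v0 \<le> lin y v" if "v \<in> keys F" for v
    unfolding v0(2) using that ne by (intro Min_le) auto
  have "\<exists>b\<in>edge_monoid H. v - v0 + b \<in> edge_monoid E" if v: "v \<in> keys F" for v
  proof -
    define N where "N = lin y v - lin y v0"
    have N: "0 \<le> N" "even N"
      using min[OF v] ev[OF v C] ev[OF v0(1) C] H.lin_ind_sg[OF C LR] by (auto simp: N_def)
    \<comment> \<open>Subtracting copies of \<open>rho e1\<close> brings the height to 0. Their
      number \<open>N\<close> is even because height and sum over \<open>C\<close> agree modulo 2,
      so the parities survive.\<close>
    let ?w = "v - v0 - frag_cmul N (rho e1)"
    have "?w \<in> edge_group H"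
    proof (rule edge_group_even)
      show "?w \<in> edge_group E" using FE v v0(1) e1 by (intro edge_group_diff edge_group_frag_cmul edge_group_rho edge_monoid_gp) auto
      show "lin y ?w = 0" by (simp add: lin_diff lin_frag_cmul e1 N_def)
      show "even (lin (ind K) ?w)" if "K \<in> comps n H" for K
        using ev[OF v that] ev[OF v0(1) that] N(2) by (simp add: lin_diff lin_frag_cmul)
    qed
    then obtain a b where ab: "?w = a - b" "a \<in> edge_monoid H" "b \<in> edge_monoid H" unfolding edge_group_def by blast
    have "v - v0 + b = frag_cmul N (rho e1) + a" using ab(1) by (simp add: algebra_simps)
    also have "\<dots> \<in> edge_monoid E"
      using edge_monoid_frag_cmul[OF edge_monoid_rho N(1)] e1 ab(2) edge_monoid_mono[OF sub] by (intro edge_monoid_add) auto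
    finally show ?thesis using ab(3) by blast
  qed
  then obtain b where b: "\<And>v. v \<in> keys F \<Longrightarrow> b v \<in> edge_monoid H" "\<And>v. v \<in> keys F \<Longrightarrow> v - v0 + b v \<in> edge_monoid E"
    by metis
  \<comment> \<open>One exponent on the face that clears the denominators of all terms of
    \<open>F\<close>.\<close>
  define t where "t = (\<Sum>v\<in>keys F. b v)"
  have t: "t \<in> edge_monoid H" unfolding t_def by (rule edge_monoid_sum) (rule b(1))
  have tE: "t - v0 + v \<in> edge_monoid E" if v: "v \<in> keys F" for v
  proof -
    have "t = b v + (\<Sum>v\<in>keys F - {v}. b v)" unfolding t_def using v by (intro sum.remove) auto
    then have "t - v0 + v = (v - v0 + b v) + (\<Sum>v\<in>keys F - {v}. b v)" by (simp add: algebra_simps)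
    moreover have "(\<Sum>v\<in>keys F - {v}. b v) \<in> edge_monoid E" using b(1) edge_monoid_mono[OF sub] by (intro edge_monoid_sum) auto
    ultimately show ?thesis using edge_monoid_add b(2)[OF v] by metis
  qed
  let ?G = "xpow (t - v0) * F"
  have kG: "keys ?G = (+) (t - v0) ` keys F" by (rule keys_monom_mult)
  have "?G \<in> A" unfolding A_iff kG using tE by auto
  \<comment> \<open>The term of \<open>?G\<close> coming from \<open>v0\<close> has exponent
    \<open>t\<close>, of height 0. This keeps \<open>?G\<close> out of \<open>P\<close>, so that
    primality of \<open>Q\<close> applies to the factor \<open>xpow v0\<close>.\<close>
  moreover have "t \<in> keys ?G" unfolding kG using v0(1) by force
  then have "?G \<notin> P" using y_mon_H[OF t] unfolding P_def by force
  moreover have "xpow v0 * ?G = xpow t * F"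
    by (simp add: mult.assoc[symmetric] mult_single)
  moreover have "xpow t * F \<in> Q" using QD(4) F(1) t edge_monoid_mono[OF sub] by (auto intro: A_single)
  moreover have "xpow v0 \<in> A" using FE v0 by (auto intro: A_single)
  ultimately have xv0: "xpow v0 \<in> Q" using prime_ofD(3)[OF Q(1)] Q(2) by (metis subsetD)
  have v0E: "v0 \<in> edge_monoid E" and v0pos: "0 < lin y v0" using xv0 Q(2) FE v0 by (auto simp: P_def)
  have xQ: "xpow u \<in> Q" if u: "u \<in> edge_monoid E" "0 < lin y u" for u
  proof -
    \<comment> \<open>Weighting \<open>u\<close> and \<open>v0\<close> with each other's height
      equalizes the heights; the extra factor 2 settles the parities.\<close>
    define k l where "k = nat (2 * lin y v0)" and "l = nat (2 * lin y u)"
    have kl: "int k = 2 * lin y v0" "int l = 2 * lin y u" "l \<noteq> 0" using u v0pos by (auto simp: k_def l_def)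
    have "frag_cmul (int k) u - frag_cmul (int l) v0 \<in> edge_group H"
    proof (rule edge_group_even)
      show "frag_cmul (int k) u - frag_cmul (int l) v0 \<in> edge_group E"
        using u v0E by (intro edge_group_diff edge_group_frag_cmul edge_monoid_gp) auto
      show "lin y (frag_cmul (int k) u - frag_cmul (int l) v0) = 0" by (simp add: lin_diff lin_frag_cmul kl)
      show "even (lin (ind K) (frag_cmul (int k) u - frag_cmul (int l) v0))" for K
        by (simp add: lin_diff lin_frag_cmul kl)
    qed
    then obtain a b where ab: "frag_cmul (int k) u - frag_cmul (int l) v0 = a - b" "a \<in> edge_monoid H" "b \<in> edge_monoid H"
      unfolding edge_group_def by blast
    then have eq: "frag_cmul (int k) u + b = frag_cmul (int l) v0 + a" by (simp add: algebra_simps)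
    have "xpow u ^ k * xpow b = xpow v0 ^ l * (xpow a :: (nat \<Rightarrow>\<^sub>0 int) \<Rightarrow>\<^sub>0 'k)"
      unfolding xpow_scale[symmetric] xpow_add[symmetric] eq ..
    moreover obtain l' where "l = Suc l'" using kl(3) not0_implies_Suc by blast
    moreover have abE: "xpow a \<in> A" "xpow b \<in> A" "xpow u \<in> A" "xpow v0 \<in> A"
      using ab edge_monoid_mono[OF sub] u v0E by (auto intro: A_single)
    moreover have "xpow v0 * (xpow v0 ^ l' * xpow a) \<in> Q"
      using abE by (intro QD(5)[OF _ xv0] AD(4) AD(7))
    ultimately have "xpow u ^ k * xpow b \<in> Q" by (simp add: mult.assoc)
    moreover have "xpow b \<notin> Q" using Q(2) y_mon_H[OF ab(3)] by (auto simp: P_def)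
    ultimately have "xpow u ^ k \<in> Q" using prime_ofD(3)[OF Q(1) AD(7)[OF abE(3)] abE(2)] by blast
    then show ?thesis by (rule prime_of_power[OF subring_A Q(1) abE(3)])
  qed
  show "P \<subseteq> Q"
  proof
    fix f assume f: "f \<in> P"
    have "Poly_Mapping.single u (lookup f u) \<in> Q" if u: "u \<in> keys f" for u
    proof -
      have "Poly_Mapping.single 0 (lookup f u) * xpow u \<in> Q"
        using xQ[of u] u f by (intro QD(4) A_single) (auto simp: P_def A_iff edge_monoid_0)
      then show ?thesis by (simp add: mult_single)
    qed
    then have "(\<Sum>u\<in>keys f. Poly_Mapping.single u (lookup f u)) \<in> Q"
      by (rule ideal_of_sum[OF prime_ofD(1)[OF Q(1)]])
    then show "f \<in> Q" using sum_single_lookup[of f] by (rule back_subst[OF _ sym])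
  qed
qed (rule Q(2))

text \<open>Heights on \<open>P\<close> are at least 1, so dividing the height 1 monomials of
  \<open>e1\<close> and \<open>e2\<close> by a generator \<open>p\<close> leaves cofactors outside
  \<open>P\<close>. Eliminating \<open>p\<close> and comparing exponents of height 1 shows that the
  two edge vectors differ by exponents on the face.\<close>

lemma serre_R1_congruent:
  assumes R1: "serre_R1 (sring (edge_monoid E) :: ((nat \<Rightarrow>\<^sub>0 int) \<Rightarrow>\<^sub>0 'k::field) set)"
    and e2: "e2 \<in> E - H" "lin y (rho e2) = 1"
  shows "rho e1 - rho e2 \<in> edge_group H"
proof -
  define A :: "((nat \<Rightarrow>\<^sub>0 int) \<Rightarrow>\<^sub>0 'k::field) set" where "A = sring (edge_monoid E)"
  define P where "P = {f \<in> A. \<forall>v\<in>keys f. 0 < lin y v}"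
  interpret semigroup_ring "edge_monoid E" A unfolding A_def by (rule semigroup_ring_mon)
  have nonneg: "0 \<le> lin y v" if "v \<in> edge_monoid E" for v by (rule lin_mon_nonneg[OF y_rho_nonneg that])
  have P: "prime_of A P"
    unfolding P_def by (rule prime_of_positive[of "lin y", OF lin_add nonneg])
  have minimal: "\<And>Q. prime_of A Q \<Longrightarrow> Q \<subseteq> P \<Longrightarrow> Q \<noteq> {0} \<Longrightarrow> Q = P"
    using face_prime_minimal unfolding P_def A_def by blast
  obtain p where p: "p \<in> P" "\<And>f. f \<in> P \<Longrightarrow> \<exists>b\<in>A - P. \<exists>c\<in>A. b * f = p * c"
  proof (rule principal_of_serre_R1[OF subring_A P R1[folded A_def] minimal])
    fix p assume "p \<in> P" "\<And>f. f \<in> P \<Longrightarrow> \<exists>b\<in>A - P. \<exists>c\<in>A. b * f = p * c"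
    then show thesis by (rule that)
  qed
  have x: "xpow (rho e1) \<in> P" "xpow (rho e2) \<in> P"
    using e1 e2 by (auto simp: P_def A_iff edge_monoid_rho)
  have unit: "\<exists>v\<in>keys f. v \<in> edge_monoid H" if f: "f \<in> A" "f \<notin> P" for f
  proof -
    obtain v where v: "v \<in> keys f" "\<not> 0 < lin y v" using f unfolding P_def by blast
    then have "v \<in> edge_monoid E" using f A_iff by blast
    then show ?thesis using v nonneg[of v] y_zero_mon[of v] by force
  qed
  \<comment> \<open>With \<open>c\<close> in \<open>P\<close>, every term of \<open>p * c\<close>
    would have height at least 2, but the left side has a term of height 1.\<close>
  have cofactor: "c \<notin> P" if bc: "b \<in> A - P" "c \<in> A" "b * xpow (rho e) = p * c" "lin y (rho e) = 1" for b c e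
  proof
    assume c: "c \<in> P"
    obtain v where v: "v \<in> keys b" "v \<in> edge_monoid H" using unit bc(1) by blast
    then have "rho e + v \<in> keys (p * c)"
      unfolding bc(3)[symmetric] by (subst mult.commute) (simp add: keys_monom_mult)
    then obtain u w where uw: "rho e + v = u + w" "u \<in> keys p" "w \<in> keys c" by (rule keys_multE)
    then have "lin y u + lin y w = 1" using y_mon_H[OF v(2)] bc(4) by (metis lin_add add.right_neutral)
    moreover have "0 < lin y u" "0 < lin y w" using uw p(1) c by (auto simp: P_def)
    ultimately show False by linarith
  qed
  obtain b1 c1 where 1: "b1 \<in> A - P" "c1 \<in> A" "b1 * xpow (rho e1) = p * c1" using p(2)[OF x(1)] by blast
  obtain b2 c2 where 2: "b2 \<in> A - P" "c2 \<in> A" "b2 * xpow (rho e2) = p * c2" using p(2)[OF x(2)] by blast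
  have c: "c1 \<in> A - P" "c2 \<in> A - P" using cofactor[OF 1 e1(2)] cofactor[OF 2 e2(2)] 1 2 by auto
  have notP: "b1 * c2 \<in> A - P" using 1 c AD(4) prime_ofD(3)[OF P] by blast
  have eq: "xpow (rho e1) * (b1 * c2) = xpow (rho e2) * (b2 * c1)"
  proof -
    have "xpow (rho e1) * (b1 * c2) = (b1 * xpow (rho e1)) * c2" by (simp add: algebra_simps)
    also have "\<dots> = (b2 * xpow (rho e2)) * c1" unfolding 1(3) 2(3) by (simp add: algebra_simps)
    finally show ?thesis by (simp add: algebra_simps)
  qed
  obtain v where v: "v \<in> keys (b1 * c2)" "v \<in> edge_monoid H" using unit notP by blast
  then have "rho e1 + v \<in> keys (xpow (rho e1) * (b1 * c2))" by (simp only: keys_monom_mult) simp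
  then have "rho e1 + v \<in> keys (xpow (rho e2) * (b2 * c1))" by (simp only: eq)
  then obtain w where w: "rho e1 + v = rho e2 + w" "w \<in> keys (b2 * c1)" unfolding keys_monom_mult by blast
  have "b2 * c1 \<in> A" using 2 c AD(4) by blast
  then have "w \<in> edge_monoid E" using w(2) A_iff by blast
  moreover have "lin y w = 0"
  proof -
    have "lin y (rho e1 + v) = lin y (rho e2 + w)" by (simp only: w(1))
    then show ?thesis using e1(2) e2(2) y_mon_H[OF v(2)] by (simp add: lin_add)
  qed
  ultimately have "w \<in> edge_monoid H" by (rule y_zero_mon)
  moreover have "rho e1 - rho e2 = w - v" using w(1) by (simp add: algebra_simps)
  ultimately show ?thesis using edge_groupI v(2) by metis
qed

end

lemma serre_R1_imp_ncomp_le: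
  assumes wf: "wf_graph n E" and R1: "serre_R1 (edge_ring E :: ((nat \<Rightarrow>\<^sub>0 int) \<Rightarrow>\<^sub>0 'k::field) set)"
    and facet: "facet_subgraph n E H"
  shows "ncomp n H \<le> ncomp n E + 1"
proof (rule ccontr)
  assume no: "\<not> ?thesis"
  interpret subgraph_pair n E H
    by unfold_locales (use wf facet in \<open>auto simp: facet_subgraph_def\<close>)
  have nb: "nbicomp n H = nbicomp n E + 1" and
    orient: "\<And>C. C \<in> comps n H \<Longrightarrow> bipartite H.AE C \<Longrightarrow> touched C \<Longrightarrow>
      \<exists>L R. is_bipartition H.AE C L R \<and> (\<forall>e\<in>E - H. 0 < lin (sg L R) (rho e))"
    using facet unfolding facet_subgraph_iff by auto
  \<comment> \<open>If no bipartite component were touched, all of them would be bipartite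
    components of \<open>E\<close>, and \<open>H\<close> could not have one more.\<close>
  have "\<exists>C\<in>comps n H. bipartite H.AE C \<and> touched C"
  proof (rule ccontr)
    assume "\<not> ?thesis"
    then have "{C \<in> comps n H. bipartite H.AE C} \<subseteq> {C \<in> comps n E. bipartite E.AE C}"
      using untouched_comp(1) untouched_bipartite(2) by blast
    then have "nbicomp n H \<le> nbicomp n E"
      unfolding nbicomp_def using E.finite_comps by (intro card_mono) auto
    then show False using nb by simp
  qed
  then obtain C where C: "C \<in> comps n H" "bipartite H.AE C" "touched C" by blast
  obtain L R where LR: "is_bipartition H.AE C L R" and pos: "\<And>e. e \<in> E - H \<Longrightarrow> 0 < lin (sg L R) (rho e)"
    using orient[OF C] by blast
  have meets: "\<exists>i\<in>ends e. V i \<in> K" if K: "K \<in> comps n H" "bipartite H.AE K" "touched K" and e: "e \<in> E - H" for K e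
  proof -
    obtain L' R' where LR': "is_bipartition H.AE K L' R'" "0 < lin (sg L' R') (rho e)" using orient[OF K] e by blast
    obtain i where "i \<in> ends e" "V i \<in> K" by (rule lin_sg_touches[OF LR'(1)]) (use LR'(2) in auto)
    then show ?thesis by blast
  qed
  have out: "\<exists>e\<in>E - H. \<exists>i\<in>ends e. V i \<notin> C \<union> q" if "q \<in> comps n H" for q
    using ncomp_le_merge[OF C(1) that] no by blast
  \<comment> \<open>The merging bound is used with \<open>q = C\<close> to find an edge leaving
    \<open>C\<close>, and again with the component so reached to find a second edge avoiding
    it.\<close>
  obtain e1 i1 where e1: "e1 \<in> E - H" "i1 \<in> ends e1" "V i1 \<notin> C" using out[OF C(1)] by blast
  have V1: "V i1 \<in> H.Vs" using E_ends_Vs e1 by blast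
  define q where "q = H.cls (V i1)"
  have q: "q \<in> comps n H" "V i1 \<in> q" using H.cls_in_comps[OF V1] H.cls_self[OF V1] by (auto simp: q_def)
  obtain e2 i2 where e2: "e2 \<in> E - H" "i2 \<in> ends e2" "V i2 \<notin> C" "V i2 \<notin> q" using out[OF q(1)] by blast
  obtain j1 where j1: "j1 \<in> ends e1" "V j1 \<in> C" using meets[OF C e1(1)] by blast
  obtain j2 where j2: "j2 \<in> ends e2" "V j2 \<in> C" using meets[OF C e2(1)] by blast
  have ends: "ends e1 = {i1, j1}" "ends e2 = {i2, j2}"
    using e1 e2 j1 j2 by (cases e1; cases e2; auto)+
  have qC: "q \<inter> C = {}" using H.comps_disjoint[OF q(1) C(1)] q(2) e1(3) by blast
  have one: "lin (sg L R) (rho e1) = 1" "lin (sg L R) (rho e2) = 1"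
    using lin_sg_pos_cases(1)[OF LR pos] e1 e2 by blast+
  interpret positive_face n E H C L R e1
  proof unfold_locales
    \<comment> \<open>A touched \<open>K\<close> would meet both edges outside \<open>C\<close>,
      hence contain \<open>i1\<close> and \<open>i2\<close>, which lie in different
      components.\<close>
    show "\<not> touched K" if K: "K \<in> comps n H" "K \<noteq> C" "bipartite H.AE K" for K
    proof
      assume t: "touched K"
      have disj: "K \<inter> C = {}" using H.comps_disjoint[OF K(1) C(1)] K(2) by blast
      have "V i1 \<in> K" "V i2 \<in> K" 
        using meets[OF K(1,3) t e1(1)] meets[OF K(1,3) t e2(1)] ends disj j1 j2 by auto
      then show False using H.comps_disjoint[OF K(1) q(1)] q(2) e2(4) by blast
    qed
  qed (use C LR pos e1 one in auto)
  have "even (lin (ind q) (rho e1 - rho e2))"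
    by (rule H.lin_ind_gp[OF q(1) serre_R1_congruent[OF R1[unfolded edge_ring_eq_sring] e2(1) one(2)]])
  moreover have "lin (ind q) (rho e2) = 0"
    using ends(2) e2(4) j2(2) qC by (intro lin_rho_zero) (auto simp: ind_def)
  moreover have "odd (lin (ind q) (rho e1))"
  proof (cases e1)
    case (Sgn s k l)
    then show ?thesis using ends(1) q(2) j1(2) qC by (cases s) (auto simp: lin_add lin_diff lin_uminus ind_def doubleton_eq_iff)
  next
    case (Dir k l)
    then show ?thesis using ends(1) q(2) j1(2) qC by (auto simp: lin_diff ind_def doubleton_eq_iff)
  qed
  ultimately show False by (simp add: lin_diff)
qed

text \<open>When \<open>P\<close> contains a monomial, height one replaces a facet theorem for
  cones: a proper face strictly larger than that of \<open>H\<close> would give a nonzero prime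
  strictly inside \<open>P\<close>.\<close>

lemma ncomp_le_imp_principal:
  fixes P :: "((nat \<Rightarrow>\<^sub>0 int) \<Rightarrow>\<^sub>0 'k::field) set" and E :: "edge set"
  defines "A \<equiv> sring (edge_monoid E)"
  assumes wf: "wf_graph n E" and facets: "\<And>H. facet_subgraph n E H \<Longrightarrow> ncomp n H \<le> ncomp n E + 1"
    and P: "prime_of A P" "P \<noteq> {0}" and height: "\<And>Q. prime_of A Q \<Longrightarrow> Q \<subset> P \<Longrightarrow> Q = {0}"
  shows "\<exists>p\<in>P. \<forall>f\<in>P. \<exists>b\<in>A - P. \<exists>c\<in>A. b * f = p * c"
proof -
  interpret semigroup_ring "edge_monoid E" A unfolding A_def by (rule semigroup_ring_mon)
  interpret height_one_prime "edge_monoid E" A P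
    by unfold_locales (use P height in \<open>auto simp: A_def\<close>)
  interpret E: graph n E by unfold_locales (rule wf)
  have quasi: "\<exists>p\<in>P. \<forall>f\<in>P. quasi_multiple p f"
  proof (cases "\<exists>v. xpow v \<in> P")
    case False
    interpret height_one_prime_no_monomial "edge_monoid E" A P "n + 1"
    proof unfold_locales
      show "i < n + 1" if "v \<in> edge_monoid E" "i \<in> keys v" for v i using E.keys_mon[OF that(1)] that(2) by auto
    qed (use False in auto)
    show ?thesis by (rule exists_generator)
  next
    case True
    then obtain u where u: "xpow u \<in> P" by blast
    then have uE: "u \<in> edge_monoid E" using PD(1) by (force simp: A_iff)
    define H where "H = {e \<in> E. xpow (rho e) \<notin> P}"
    interpret subgraph_pair n E H by unfold_locales (use wf in \<open>auto simp: H_def\<close>)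
    have xA: "xpow v \<in> A" if "v \<in> edge_monoid E" for v using that by (rule A_single)
    have x_mult: "xpow (v + w) \<in> P \<longleftrightarrow> xpow v \<in> P \<or> xpow w \<in> P" if "v \<in> edge_monoid E" "w \<in> edge_monoid E" for v w
      unfolding xpow_add using prime_ofD(3)[OF P(1) xA[OF that(1)] xA[OF that(2)]]
        PD(4)[OF xA[OF that(1)]] PD(5)[OF xA[OF that(2)]] by blast
    have x_0: "xpow 0 \<notin> P" using prime_ofD(2)[OF P(1)] by simp
    have sub_mon: "v \<in> edge_monoid E" if "v \<in> edge_monoid H" for v using that edge_monoid_mono[OF sub] by blast
    have monH: "xpow v \<notin> P" if "v \<in> edge_monoid H" for v
      using that
    proof (induction v rule: edge_monoid.induct)
      case (edge_monoid_step e v)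
      then show ?case using x_mult[of "rho e" v] edge_monoid_rho[of e E] sub_mon by (auto simp: H_def)
    qed (rule x_0)
    have monE: "v \<in> edge_monoid H" if "v \<in> edge_monoid E" "xpow v \<notin> P" for v
      using that
    proof (induction v rule: edge_monoid.induct)
      case (edge_monoid_step e v)
      then show ?case using x_mult[of "rho e" v] edge_monoid_rho[of e E] by (auto simp: H_def intro: edge_monoid.edge_monoid_step)
    qed (rule edge_monoid.edge_monoid_0)
    have proper: "E - H \<noteq> {}" using u uE monH sub by (metis Diff_eq_empty_iff subset_antisym)
    have edge_P: "xpow (rho e) \<in> P" if "e \<in> E - H" for e using that by (auto simp: H_def)
    obtain \<sigma> where \<sigma>_zero: "\<And>e. e \<in> H \<Longrightarrow> lin \<sigma> (rho e) = 0"
      and \<sigma>_pos: "\<And>e. e \<in> E - H \<Longrightarrow> 0 < lin \<sigma> (rho e)"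
    proof -
      let ?Y = "{y. \<forall>e\<in>H. lin y (rho e) = 0}" and ?X = "{v :: nat \<Rightarrow>\<^sub>0 int. keys v \<subseteq> {1..n}}"
      have "\<exists>y\<in>?Y. \<forall>a\<in>rho ` (E - H). 0 < lin y a"
      proof (rule gordan[where X = ?X and \<Lambda> = "edge_group H"])
        show "(\<lambda>i. a * y i + b * z i) \<in> ?Y" if "y \<in> ?Y" "z \<in> ?Y" for y z a b
          using that by (simp add: lin_combine)
        show "(\<lambda>_. 0) \<in> ?Y" by (simp add: lin_def)
        show "v + w \<in> ?X" if "v \<in> ?X" "w \<in> ?X" for v w using that keys_add[of v w] by blast
        show "finite (rho ` (E - H))" using E.finite_H by simp
        show "rho ` (E - H) \<subseteq> ?X" using E.keys_rho by blast
        \<comment> \<open>Vanishing of all functionals settles the bipartite components and doubling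
          settles the parities, hence the factor 2 in the hypothesis \<open>sep\<close> of
          \<open>gordan\<close>.\<close>
        show "frag_cmul 2 v \<in> edge_group H" if v: "v \<in> ?X" "\<And>y. y \<in> ?Y \<Longrightarrow> lin y v = 0" for v
        proof (rule H.edge_group_memI)
          show "keys (frag_cmul 2 v) \<subseteq> {1..n}" using v(1) keys_cmul[of 2 v] by blast
          show "lin (sg L R) (frag_cmul 2 v) = 0" if "C \<in> comps n H" "is_bipartition H.AE C L R" for C L R
            using v(2)[of "sg L R"] H.lin_sg_rho[OF that] by (simp add: lin_frag_cmul)
        qed (simp add: lin_frag_cmul)
        \<comment> \<open>A nonempty sum of outside edges has its monomial in \<open>P\<close>. If
          it were a difference \<open>a - b\<close> of exponents on the face, the monomial of
          \<open>a\<close> would lie in \<open>P\<close> too.\<close>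
        show "cone (rho ` (E - H)) \<inter> edge_group H = {}"
        proof (rule ccontr)
          assume "cone (rho ` (E - H)) \<inter> edge_group H \<noteq> {}"
          then obtain v where v: "v \<in> cone (rho ` (E - H))" "v \<in> edge_group H" by blast
          have vP: "v \<in> edge_monoid E \<and> xpow v \<in> P" using v(1)
          proof induction
            case (cone_base a)
            then show ?case using edge_P edge_monoid_rho[of _ E] by blast
          next
            case (cone_add a b)
            then show ?case using x_mult edge_monoid_add by blast
          qed
          obtain a b where ab: "v = a - b" "a \<in> edge_monoid H" "b \<in> edge_monoid H" using v(2) unfolding edge_group_def by blast
          then have "a = v + b" by simp
          then show False using x_mult[of v b] vP monH[OF ab(2)] sub_mon[OF ab(3)] by simp
        qed
      qed
      then show ?thesis using that by blast
    qed
    have \<sigma>_nonneg: "0 \<le> lin \<sigma> (rho e)" if "e \<in> E" for e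
      using \<sigma>_zero[of e] \<sigma>_pos[of e] that by (cases "e \<in> H") auto
    have P_sub: "{f \<in> A. \<forall>v\<in>keys f. 0 < lin y v} \<subseteq> P" if y: "\<And>e. e \<in> H \<Longrightarrow> lin y (rho e) = 0" for y
    proof
      fix f assume f: "f \<in> {f \<in> A. \<forall>v\<in>keys f. 0 < lin y v}"
      have "Poly_Mapping.single v (lookup f v) \<in> P" if v: "v \<in> keys f" for v
      proof -
        have vE: "v \<in> edge_monoid E" "0 < lin y v" using f v by (auto simp: A_iff)
        then have "v \<notin> edge_monoid H" using lin_mon_zero[of H y v, OF y] by auto
        then have "Poly_Mapping.single 0 (lookup f v) * xpow v \<in> P"
          using monE vE by (intro PD(4) A_single edge_monoid_0) blast
        then show ?thesis by (simp add: mult_single)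
      qed
      then have "(\<Sum>v\<in>keys f. Poly_Mapping.single v (lookup f v)) \<in> P"
        by (rule ideal_of_sum[OF prime_ofD(1)[OF P(1)]])
      then show "f \<in> P" using sum_single_lookup[of f] by (rule back_subst[OF _ sym])
    qed
    have dep: "\<exists>p q. p \<noteq> 0 \<and> (\<forall>e\<in>E. p * lin y (rho e) = q * lin \<sigma> (rho e))"
      if y: "\<And>e. e \<in> H \<Longrightarrow> lin y (rho e) = 0" for y
    proof -
      \<comment> \<open>With \<open>e0\<close> of smallest ratio of \<open>y\<close> to
        \<open>\<sigma>\<close>, the combination \<open>z\<close> below is nonnegative on
        \<open>E\<close> and vanishes on \<open>H\<close> and at \<open>e0\<close>. Its prime misses
        the monomial of \<open>e0\<close>, so it lies strictly inside \<open>P\<close> and is zero,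
        which forces \<open>z\<close> to vanish on all of \<open>E\<close>.\<close>
      let ?r = "\<lambda>e. of_int (lin y (rho e)) / of_int (lin \<sigma> (rho e)) :: rat"
      have fin: "finite (?r ` (E - H))" "?r ` (E - H) \<noteq> {}" using E.finite_H proper by auto
      obtain e0 where "Min (?r ` (E - H)) = ?r e0" "e0 \<in> E - H" using Min_in[OF fin] by (rule imageE)
      then have e0: "e0 \<in> E - H" "?r e0 = Min (?r ` (E - H))" by simp_all
      have r: "lin y (rho e0) * lin \<sigma> (rho e) \<le> lin y (rho e) * lin \<sigma> (rho e0)" if e: "e \<in> E - H" for e
      proof -
        have "?r e0 \<le> ?r e" unfolding e0(2) using e fin(1) by (intro Min_le) auto
        then have "of_int (lin y (rho e0) * lin \<sigma> (rho e)) \<le> (of_int (lin y (rho e) * lin \<sigma> (rho e0)) :: rat)"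
          using \<sigma>_pos[OF e] \<sigma>_pos[OF e0(1)] by (simp add: divide_simps mult.commute)
        then show ?thesis by (simp only: of_int_le_iff)
      qed
      define z where "z = (\<lambda>i. lin \<sigma> (rho e0) * y i + (- lin y (rho e0)) * \<sigma> i)"
      have z: "lin z v = lin \<sigma> (rho e0) * lin y v - lin y (rho e0) * lin \<sigma> v" for v
        unfolding z_def lin_combine by simp
      have zH: "lin z (rho e) = 0" if "e \<in> H" for e using that y \<sigma>_zero by (simp add: z)
      have zE: "0 \<le> lin z (rho e)" if "e \<in> E" for e
        using zH[of e] r[of e] that by (cases "e \<in> H") (auto simp: z mult.commute)
      let ?Q = "{f \<in> A. \<forall>v\<in>keys f. 0 < lin z v}"
      have "prime_of A ?Q"
        by (rule prime_of_positive[of "lin z", OF lin_add lin_mon_nonneg[of E z, OF zE]])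
      moreover have "?Q \<subseteq> P" by (rule P_sub) (rule zH)
      moreover have "xpow (rho e0) \<in> P" "xpow (rho e0) \<notin> ?Q" using edge_P[OF e0(1)] by (auto simp: z)
      ultimately have Q0: "?Q = {0}" using height by blast
      have "lin z (rho e) = 0" if e: "e \<in> E" for e
      proof (rule ccontr)
        assume "lin z (rho e) \<noteq> 0"
        then have "xpow (rho e) \<in> ?Q" using zE[OF e] edge_monoid_rho[OF e] by (auto simp: A_iff)
        then show False unfolding Q0 by (simp add: xpow_nonzero)
      qed
      then have "\<forall>e\<in>E. lin \<sigma> (rho e0) * lin y (rho e) = lin y (rho e0) * lin \<sigma> (rho e)"
        by (simp add: z)
      moreover have "lin \<sigma> (rho e0) \<noteq> 0" using \<sigma>_pos[OF e0(1)] by simp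
      ultimately show ?thesis by blast
    qed
    interpret ray_face n E H \<sigma> by unfold_locales (use \<sigma>_zero \<sigma>_pos dep proper in auto)
    obtain e0 where e0: "e0 \<in> E - H" "\<And>e. e \<in> E - H \<Longrightarrow> \<exists>c\<ge>1. rho e - frag_cmul c (rho e0) \<in> edge_group H"
      using generator[OF facets[OF facet]] by blast
    let ?p = "xpow (rho e0) :: (nat \<Rightarrow>\<^sub>0 int) \<Rightarrow>\<^sub>0 'k"
    have edge: "quasi_multiple ?p (xpow (rho e))" if e: "e \<in> E - H" for e
    proof -
      obtain c a b where c: "1 \<le> c" and ab: "rho e - frag_cmul c (rho e0) = a - b" "a \<in> edge_monoid H" "b \<in> edge_monoid H"
        using e0(2)[OF e] unfolding edge_group_def by blast
      \<comment> \<open>One copy of \<open>rho e0\<close> is split off as the factor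
        \<open>?p\<close>; \<open>1 \<le> c\<close> keeps the remaining multiple nonnegative, hence
        in the monoid.\<close>
      have "frag_cmul c (rho e0) = rho e0 + frag_cmul (c - 1) (rho e0)"
        using frag_cmul_distrib[of 1 "c - 1" "rho e0"] by simp
      then have eq: "b + rho e = rho e0 + (frag_cmul (c - 1) (rho e0) + a)"
        using ab(1) by (simp add: algebra_simps)
      have "frag_cmul (c - 1) (rho e0) + a \<in> edge_monoid E"
        using edge_monoid_frag_cmul[OF edge_monoid_rho, of e0 E "c - 1"] e0(1) c sub_mon[OF ab(2)] by (intro edge_monoid_add) auto
      then have "xpow (frag_cmul (c - 1) (rho e0) + a) \<in> A" "xpow (rho e) \<in> A" "xpow b \<in> A - P"
        using xA edge_monoid_rho[of e E] e sub_mon[OF ab(3)] monH[OF ab(3)] by auto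
      moreover have "xpow b * xpow (rho e) = ?p * xpow (frag_cmul (c - 1) (rho e0) + a)"
        by (simp only: xpow_add[symmetric] eq)
      ultimately show ?thesis unfolding quasi_multiple_def by blast
    qed
    have mono: "quasi_multiple ?p (xpow v)" if "v \<in> edge_monoid E" "xpow v \<in> P" for v
      using that
    proof (induction v rule: edge_monoid.induct)
      case edge_monoid_0
      then show ?case using x_0 by blast
    next
      case (edge_monoid_step e v)
      show ?case
      proof (cases "e \<in> H")
        case True
        then have "xpow v \<in> P" using edge_monoid_step x_mult[of "rho e" v] edge_monoid_rho[of e E] by (auto simp: H_def)
        then have "quasi_multiple ?p (xpow (rho e) * xpow v)"
          using edge_monoid_step xA edge_monoid_rho[of e E] by (intro quasi_multiple_mult) auto
        then show ?thesis by (simp only: xpow_add)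
      next
        case False
        then have "quasi_multiple ?p (xpow v * xpow (rho e))"
          using edge edge_monoid_step xA by (intro quasi_multiple_mult) auto
        then show ?thesis by (simp only: xpow_add mult.commute)
      qed
    qed
    have "quasi_multiple ?p f" if f: "f \<in> P" for f
    proof -
      have "quasi_multiple ?p (Poly_Mapping.single v (lookup f v))" if v: "v \<in> keys f" for v
      proof -
        have "v \<in> edge_monoid E" using PD(1)[OF f] v by (auto simp: A_iff)
        then have "quasi_multiple ?p (Poly_Mapping.single 0 (lookup f v) * xpow v)"
          using monomial_prime[OF u f v] by (intro quasi_multiple_mult mono A_single edge_monoid_0)
        then show ?thesis by (simp add: mult_single)
      qed
      then have "quasi_multiple ?p (\<Sum>v\<in>keys f. Poly_Mapping.single v (lookup f v))"
        by (rule quasi_multiple_sum)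
      then show ?thesis using sum_single_lookup[of f] by (rule back_subst[OF _ sym])
    qed
    then show ?thesis using edge_P[OF e0(1)] by blast
  qed
  then show ?thesis unfolding quasi_multiple_def by blast
qed

lemma ncomp_le_imp_serre_R1:
  assumes wf: "wf_graph n E" and facets: "\<And>H. facet_subgraph n E H \<Longrightarrow> ncomp n H \<le> ncomp n E + 1"
  shows "serre_R1 (edge_ring E :: ((nat \<Rightarrow>\<^sub>0 int) \<Rightarrow>\<^sub>0 'k::field) set)"
proof -
  define A :: "((nat \<Rightarrow>\<^sub>0 int) \<Rightarrow>\<^sub>0 'k::field) set" where "A = sring (edge_monoid E)"
  interpret semigroup_ring "edge_monoid E" A unfolding A_def by (rule semigroup_ring_mon)
  have "regular_local_ring (sub_ring_of (localization A P))"
    if P: "prime_of A P" and dim: "krull_dim (sub_ring_of (localization A P)) \<le> 1" for P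
  proof -
    have "\<exists>p\<in>P. \<forall>f\<in>P. \<exists>b\<in>A - P. \<exists>c\<in>A. b * f = p * c"
    proof (cases "P = {0}")
      case True
      then show ?thesis using AD(1,2) by (intro bexI[of _ 0] ballI bexI[of _ 1]) auto
    next
      case False
      show ?thesis
        using ncomp_le_imp_principal[OF wf facets P[unfolded A_def] False]
          krull_dim_localization_le_1D[OF subring_A P dim] unfolding A_def by blast
    qed
    then show ?thesis using regular_localization_principal[OF subring_A P dim] by blast
  qed
  then show ?thesis
    unfolding edge_ring_eq_sring serre_R1_def using primeideal_sub_ring_of[OF subring_A]
    by (simp add: A_def)
qed

theorem mainTheorem11:
  fixes n :: nat and E :: "edge set"
  assumes "wf_graph n E"
  shows "serre_R1 (edge_ring E :: ((nat \<Rightarrow>\<^sub>0 int) \<Rightarrow>\<^sub>0 'k::field) set) \<longleftrightarrow>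
         (\<forall>H. facet_subgraph n E H \<longrightarrow> ncomp n H \<le> ncomp n E + 1)"
  using serre_R1_imp_ncomp_le[OF assms] ncomp_le_imp_serre_R1[OF assms] by blast

end
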